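(* Let $t(n,m)$ be the time required to solve the all-pairs shortest paths problem in directed acyclic graphs with $n$ vertices and $m$ non-negatively weighted edges. Then there is a randomized algorithm that, given a directed graph with $n$ vertices, $m$ non-negatively weighted edges, and a number of directed cycles polynomial in $n$, each directed cycle having at least $d$ vertices, solves the all-pairs shortest paths problem (computes the shortest-path distances for all ordered pairs of vertices) in $O(t(n,m)+n^3\ln n/d)$ time with high probability.
   Context: "With high probability" means with probability at least $1-1/n$ (or tending to $1$ polynomially fast in $n$). The distance from $u$ to $v$ is the minimum total weight of a directed path from $u$ to $v$ (and $+\infty$ if none exists). *)

theory Defs
  imports
    "HOL-Probability.Probability_Mass_Function"
    "HOL-Computational_Algebra.Polynomial"
    "Graph_Theory.Graph_Theory"
begin

section \<open>Model of computation: a randomized real RAM\<close>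

text \<open>
  Programs of a structured WHILE-language act on two separate memories, one for natural numbers
  (indices, counters, flags) and one for edge weights and distances. Each memory consists of
  two-dimensional arrays; a scalar is an array that is used at position (0,0) only, a vector one
  that is used in column 0 only.

  On natural numbers the machine offers addition, truncated subtraction, halving and comparison.
  Multiplication is left out, as usual for RAMs with unit cost, so that huge numbers cannot be
  produced in a few steps (two-dimensional indexing makes up for it in address computations).
  Weights can only be copied, added, subtracted and compared; there is no conversion from weights
  to natural numbers. Weights are extended reals because distances may be \<open>\<infinity>\<close>;
  note that \<open>\<infinity> - \<infinity> = \<infinity>\<close> for type \<open>ereal\<close>.
\<close>

type_synonym name = nat

record state =
  nats :: "name \<times> nat \<times> nat \<Rightarrow> nat"
  vals :: "name \<times> nat \<times> nat \<Rightarrow> ereal"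

datatype nexp =
    NConst nat
  | NGet name nexp nexp
  | NAdd nexp nexp
  | NSub nexp nexp
  | NHalf nexp

datatype vexp =
    VConst int
  | VInfty
  | VGet name nexp nexp
  | VAdd vexp vexp
  | VSub vexp vexp

datatype bexp =
    NLess nexp nexp
  | VLess vexp vexp
  | Neg bexp
  | Conj bexp bexp

datatype com =
    Skip
  | NSet name nexp nexp nexp
  | VSet name nexp nexp vexp
  | Rand name nexp nexp nexp
  | Seq com com
  | Cond bexp com com
  | While bexp com

primrec nval :: "nexp \<Rightarrow> state \<Rightarrow> nat" where
  "nval (NConst k) s = k"
| "nval (NGet a e f) s = nats s (a, nval e s, nval f s)"
| "nval (NAdd e f) s = nval e s + nval f s"
| "nval (NSub e f) s = nval e s - nval f s"
| "nval (NHalf e) s = nval e s div 2"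

primrec vval :: "vexp \<Rightarrow> state \<Rightarrow> ereal" where
  "vval (VConst k) s = ereal (real_of_int k)"
| "vval VInfty s = \<infinity>"
| "vval (VGet a e f) s = vals s (a, nval e s, nval f s)"
| "vval (VAdd x y) s = vval x s + vval y s"
| "vval (VSub x y) s = vval x s - vval y s"

primrec bval :: "bexp \<Rightarrow> state \<Rightarrow> bool" where
  "bval (NLess e f) s \<longleftrightarrow> nval e s < nval f s"
| "bval (VLess x y) s \<longleftrightarrow> vval x s < vval y s"
| "bval (Neg b) s \<longleftrightarrow> \<not> bval b s"
| "bval (Conj b c) s \<longleftrightarrow> bval b s \<and> bval c s"

text \<open>
  Small-step semantics. Executing an assignment, a random choice or the test of a conditional or
  a loop takes one step, whatever the size of the expressions involved: that size is a constant
  for each program. \<open>Rand a e f g\<close> draws a number uniformly from \<open>{0..g}\<close>,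
  independently of all previous draws. The final configurations are those of the form
  \<open>(Skip, s)\<close>; they are absorbing.
\<close>

primrec step :: "com \<Rightarrow> state \<Rightarrow> (com \<times> state) pmf" where
  "step Skip s = return_pmf (Skip, s)"
| "step (NSet a e f g) s =
     return_pmf (Skip, s\<lparr>nats := (nats s)((a, nval e s, nval f s) := nval g s)\<rparr>)"
| "step (VSet a e f x) s =
     return_pmf (Skip, s\<lparr>vals := (vals s)((a, nval e s, nval f s) := vval x s)\<rparr>)"
| "step (Rand a e f g) s =
     map_pmf (\<lambda>k. (Skip, s\<lparr>nats := (nats s)((a, nval e s, nval f s) := k)\<rparr>))
       (pmf_of_set {..nval g s})"
| "step (Seq c1 c2) s =
     (if c1 = Skip then return_pmf (c2, s)
      else map_pmf (\<lambda>(c1', s'). (Seq c1' c2, s')) (step c1 s))"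
| "step (Cond b c1 c2) s = return_pmf (if bval b s then c1 else c2, s)"
| "step (While b c) s = return_pmf (if bval b s then Seq c (While b c) else Skip, s)"

primrec run :: "nat \<Rightarrow> com \<times> state \<Rightarrow> (com \<times> state) pmf" where
  "run 0 cs = return_pmf cs"
| "run (Suc k) cs = bind_pmf (step (fst cs) (snd cs)) (run k)"


section \<open>Weighted directed graphs and their cycles\<close>

definition weighted_digraph ::
    "nat \<Rightarrow> nat \<Rightarrow> nat pair_pre_digraph \<Rightarrow> (nat \<times> nat \<Rightarrow> real) \<Rightarrow> bool" where
  "weighted_digraph n m G w \<longleftrightarrow>
     pair_fin_digraph G \<and> pverts G = {..<n} \<and> card (parcs G) = m \<and> (\<forall>e\<in>parcs G. 0 \<le> w e)"

text \<open>
  A directed cycle is identified with its set of arcs, so that the closed walks which traverse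
  the same cycle from different starting points are counted once. The vertices of a cycle
  \<open>C\<close> are the tails of its arcs.
\<close>

definition dicycles :: "nat pair_pre_digraph \<Rightarrow> (nat \<times> nat) set set" where
  "dicycles G = {set p | p. pre_digraph.cycle (with_proj G) p}"

definition dicycle_verts :: "(nat \<times> nat) set \<Rightarrow> nat set" where
  "dicycle_verts C = fst ` C"

definition dag :: "nat pair_pre_digraph \<Rightarrow> bool" where
  "dag G \<longleftrightarrow> (\<nexists>p. pre_digraph.cycle (with_proj G) p)"


section \<open>Solving all-pairs shortest paths\<close>

text \<open>
  The input is the number of vertices together with the weight matrix, in which \<open>\<infinity>\<close>
  marks the absence of an arc. All other memory cells, including those reserved for the output,
  hold arbitrary values initially.
\<close>

definition input_state ::
    "nat \<Rightarrow> nat pair_pre_digraph \<Rightarrow> (nat \<times> nat \<Rightarrow> real) \<Rightarrow> state \<Rightarrow> bool" where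
  "input_state n G w s \<longleftrightarrow>
     nats s (0, 0, 0) = n \<and>
     (\<forall>u<n. \<forall>v<n. vals s (0, u, v) = (if (u, v) \<in> parcs G then ereal (w (u, v)) else \<infinity>))"

text \<open>\<open>wf_digraph.\<mu>\<close> is the infimum of the costs of all walks from \<open>u\<close> to \<open>v\<close>,
  hence \<open>\<infinity>\<close> if there is none.\<close>

definition output_state ::
    "nat \<Rightarrow> nat pair_pre_digraph \<Rightarrow> (nat \<times> nat \<Rightarrow> real) \<Rightarrow> state \<Rightarrow> bool" where
  "output_state n G w s \<longleftrightarrow>
     (\<forall>u<n. \<forall>v<n. vals s (1, u, v) = wf_digraph.\<mu> (with_proj G) w u v)"

text \<open>With probability at least \<open>q\<close>, the program has terminated within time \<open>T\<close> and
  its output is correct.\<close>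

definition solves_apsp_within ::
    "com \<Rightarrow> nat \<Rightarrow> nat pair_pre_digraph \<Rightarrow> (nat \<times> nat \<Rightarrow> real) \<Rightarrow> real \<Rightarrow> real \<Rightarrow> bool" where
  "solves_apsp_within c n G w T q \<longleftrightarrow>
     (\<forall>s. input_state n G w s \<longrightarrow>
        (\<exists>k. real k \<le> T \<and>
           q \<le> measure_pmf.prob (run k (c, s)) {(c', s'). c' = Skip \<and> output_state n G w s'}))"

text \<open>\<open>t\<close> bounds the worst-case running time of some program on acyclic graphs with exactly
  \<open>n\<close> vertices and \<open>m\<close> arcs. Nothing else is required of \<open>t\<close>, in particular no
  monotonicity.\<close>

definition dag_apsp_time :: "(nat \<Rightarrow> nat \<Rightarrow> nat) \<Rightarrow> bool" where
  "dag_apsp_time t \<longleftrightarrow>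
     (\<exists>c. \<forall>n m G w. 1 \<le> n \<and> weighted_digraph n m G w \<and> dag G \<longrightarrow>
        solves_apsp_within c n G w (real (t n m)) 1)"

end

(* A vertex sample of size O(n ln n / d) meets each of the polynomially many cycles with high
   probability. The sample need not be large enough for a d known in advance: vertices without
   present predecessors are eliminated one after the other, and a random vertex is deleted only when
   there is none. As soon as the vertices drawn so far meet every cycle, elimination never gets stuck
   again, so the set S of deleted vertices is no larger than the smallest such initial part of the
   sample.

   The assumed algorithm is only given for acyclic graphs with exactly n vertices and m arcs.
   Removing S would change both numbers, so instead all arcs are oriented along the elimination
   order, with S in front. No arc leads into S, hence distances between the other vertices are those
   of G - S, and the number of arcs is unchanged unless G has a loop or a 2-cycle. In that case
   d \<le> 2, and all vertices are put into S.

   Distances in G are then found by the Floyd-Warshall algorithm, in which a pivot outside S has to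
   be tried only for pairs that involve S; this takes time O(n^2 + |S| n^2). The overhead n^2 is
   covered by n^3 ln n / d if there is a cycle (as then d \<le> n), and by t(n, m) otherwise, since
   every algorithm has to write n^2 output cells, one in each step. *)
theory Submission
  imports Defs
begin

section \<open>Weakest preconditions with step bounds for randomized programs\<close>

section \<open>Reasoning about programs\<close>

text \<open>Only \<open>draw\<close> is treated probabilistically. For a fixed sample the rest is
  verified for all runs by \<open>wp\<close>, and \<open>success_Seq\<close> transfers the
  probability of a good sample to the whole program. The given program may itself be randomized;
  success with probability 1 is converted into correctness of every run. The sample size \<sigma>
  exists in the analysis only: the program, ignorant of d and of the number of cycles, always draws
  n vertices and then appends a list of all vertices. These further entries leave no vertex present
  whatever is drawn, and they yield the choice \<open>\<sigma> = 2 * n\<close> with certain success,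
  for the cases in which more than n draws would be called for or opposite arcs exist. The distances
  of G - S never appear in the proof: all that the orientation has to deliver are values on the kept
  vertices that lie between \<open>distance\<close> and \<open>weight\<close> and satisfy the
  triangle inequality. Floyd-Warshall is verified in the same style, by triangle inequalities
  through the pivots processed so far instead of shortest paths with restricted inner
  vertices.\<close>

lemma run_Skip: "run k (Skip, s) = return_pmf (Skip, s)"
  by (induction k) (auto simp: bind_return_pmf)

lemma run_add: "run (k + l) cs = bind_pmf (run k cs) (run l)"
proof (induction k arbitrary: cs)
  case (Suc k)
  then have "run (k + l) = (\<lambda>cs. bind_pmf (run k cs) (run l))" by blast
  then show ?case by (simp add: bind_assoc_pmf)
qed (simp add: bind_return_pmf)

text \<open>Random choices are read demonically: every run in the support must have halted. As
  halted configurations are absorbing, \<open>T\<close> acts as an upper bound on the time and may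
  be enlarged.\<close>

definition wp :: "com \<Rightarrow> nat \<Rightarrow> (state \<Rightarrow> bool) \<Rightarrow> state \<Rightarrow> bool" where
  "wp c T Q s \<longleftrightarrow> (\<forall>(c', s')\<in>set_pmf (run T (c, s)). c' = Skip \<and> Q s')"

lemma wp_mono:
  assumes "wp c T Q s" "T \<le> T'" "\<And>s'. Q s' \<Longrightarrow> Q' s'"
  shows "wp c T' Q' s"
proof -
  obtain l where "T' = T + l" using assms(2) le_Suc_ex by blast
  then show ?thesis using assms(1,3) by (force simp: wp_def run_add run_Skip)
qed

lemma wp_0: "wp c 0 Q s \<longleftrightarrow> c = Skip \<and> Q s"
  by (simp add: wp_def)

lemma wp_Suc: "wp c (Suc T) Q s \<longleftrightarrow> (\<forall>(c', s')\<in>set_pmf (step c s). wp c' T Q s')"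
  by (auto simp: wp_def)

lemma wp_Skip: "wp Skip T Q s \<longleftrightarrow> Q s"
  by (simp add: wp_def run_Skip)

text \<open>The additional step is the one that removes the finished \<open>Skip\<close> from the
  sequence.\<close>

lemma wp_Seq:
  assumes "wp c1 T1 (wp c2 T2 Q) s" "T1 + 1 + T2 \<le> T"
  shows "wp (Seq c1 c2) T Q s"
proof -
  have "wp (Seq c1 c2) (T1 + 1 + T2) Q s"
    using assms(1)
  proof (induction T1 arbitrary: c1 s)
    case 0
    then show ?case by (simp add: wp_0 wp_Suc)
  next
    case (Suc T1)
    show ?case
    proof (cases "c1 = Skip")
      case True
      then have "wp c2 T2 Q s" using Suc.prems by (simp add: wp_Skip)
      then have "wp c2 (Suc T1 + T2) Q s" by (rule wp_mono) auto
      then show ?thesis using True by (simp add: wp_Suc)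
    next
      case False
      have "wp (Seq c1' c2) (T1 + 1 + T2) Q s'" if "(c1', s') \<in> set_pmf (step c1 s)" for c1' s'
        using Suc.prems that by (intro Suc.IH) (auto simp: wp_Suc)
      then show ?thesis
        using False unfolding add_Suc wp_Suc[of "Seq c1 c2"] by auto
    qed
  qed
  then show ?thesis by (rule wp_mono) (use assms(2) in auto)
qed

lemma wp_simps:
  "1 \<le> T \<Longrightarrow> wp (NSet a e f g) T Q s = Q (s\<lparr>nats := (nats s)((a, nval e s, nval f s) := nval g s)\<rparr>)"
  "1 \<le> T \<Longrightarrow> wp (VSet a e f x) T Q s = Q (s\<lparr>vals := (vals s)((a, nval e s, nval f s) := vval x s)\<rparr>)"
  "1 \<le> T \<Longrightarrow> wp (Rand a e f g) T Q s =
     (\<forall>k\<le>nval g s. Q (s\<lparr>nats := (nats s)((a, nval e s, nval f s) := k)\<rparr>))"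
  "1 \<le> T \<Longrightarrow> wp (Cond b c1 c2) T Q s = wp (if bval b s then c1 else c2) (T - 1) Q s"
  "1 \<le> T \<Longrightarrow> wp (While b c) T Q s = wp (if bval b s then Seq c (While b c) else Skip) (T - 1) Q s"
  "1 \<le> T \<Longrightarrow> wp (Seq Skip c2) T Q s = wp c2 (T - 1) Q s"
  by (cases T; auto simp: wp_Suc wp_Skip)+

lemma wp_Seq_simps:
  "2 \<le> T \<Longrightarrow> wp (Seq (NSet a e f g) c2) T Q s =
     wp c2 (T - 2) Q (s\<lparr>nats := (nats s)((a, nval e s, nval f s) := nval g s)\<rparr>)"
  "2 \<le> T \<Longrightarrow> wp (Seq (VSet a e f x) c2) T Q s =
     wp c2 (T - 2) Q (s\<lparr>vals := (vals s)((a, nval e s, nval f s) := vval x s)\<rparr>)"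
  "1 \<le> T \<Longrightarrow> wp (Seq (Cond b c1 c1') c2) T Q s =
     wp (Seq (if bval b s then c1 else c1') c2) (T - 1) Q s"
proof -
  assume "2 \<le> T"
  then obtain T' where "T = Suc (Suc T')"
    by (metis One_nat_def Suc_1 Suc_le_D Suc_le_mono)
  then show "wp (Seq (NSet a e f g) c2) T Q s =
     wp c2 (T - 2) Q (s\<lparr>nats := (nats s)((a, nval e s, nval f s) := nval g s)\<rparr>)"
   "wp (Seq (VSet a e f x) c2) T Q s =
     wp c2 (T - 2) Q (s\<lparr>vals := (vals s)((a, nval e s, nval f s) := vval x s)\<rparr>)"
    by (simp_all add: wp_Suc)
next
  assume "1 \<le> T"
  then obtain T' where "T = Suc T'" by (cases T) auto
  then show "wp (Seq (Cond b c1 c1') c2) T Q s =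
     wp (Seq (if bval b s then c1 else c1') c2) (T - 1) Q s"
    by (simp add: wp_Suc)
qed

subsection \<open>Memory that a program leaves alone\<close>

primrec nmods :: "com \<Rightarrow> name set" where
  "nmods Skip = {}"
| "nmods (NSet a e f g) = {a}"
| "nmods (VSet a e f x) = {}"
| "nmods (Rand a e f g) = {a}"
| "nmods (Seq c1 c2) = nmods c1 \<union> nmods c2"
| "nmods (Cond b c1 c2) = nmods c1 \<union> nmods c2"
| "nmods (While b c) = nmods c"

primrec vmods :: "com \<Rightarrow> name set" where
  "vmods Skip = {}"
| "vmods (NSet a e f g) = {}"
| "vmods (VSet a e f x) = {a}"
| "vmods (Rand a e f g) = {}"
| "vmods (Seq c1 c2) = vmods c1 \<union> vmods c2"
| "vmods (Cond b c1 c2) = vmods c1 \<union> vmods c2"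
| "vmods (While b c) = vmods c"

lemma finite_mods: "finite (nmods c)" "finite (vmods c)"
  by (induction c) auto

definition frame :: "name set \<Rightarrow> name set \<Rightarrow> state \<Rightarrow> state \<Rightarrow> bool" where
  "frame N V s s' \<longleftrightarrow>
     (\<forall>a i j. a \<notin> N \<longrightarrow> nats s' (a, i, j) = nats s (a, i, j)) \<and>
     (\<forall>a i j. a \<notin> V \<longrightarrow> vals s' (a, i, j) = vals s (a, i, j))"

lemma frame_refl: "frame N V s s"
  by (simp add: frame_def)

lemma frame_trans: "frame N V s s' \<Longrightarrow> frame N' V' s' s'' \<Longrightarrow> frame (N \<union> N') (V \<union> V') s s''"
  by (simp add: frame_def)

lemma frame_mono: "frame N V s s' \<Longrightarrow> N \<subseteq> N' \<Longrightarrow> V \<subseteq> V' \<Longrightarrow> frame N' V' s s'"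
  by (auto simp: frame_def)

lemma step_frame:
  "(c', s') \<in> set_pmf (step c s) \<Longrightarrow>
     nmods c' \<subseteq> nmods c \<and> vmods c' \<subseteq> vmods c \<and> frame (nmods c) (vmods c) s s'"
proof (induction c arbitrary: c' s')
  case (Seq c1 c2)
  then show ?case
    by (fastforce simp: frame_def split: if_splits)
qed (auto simp: frame_def)

lemma run_frame:
  "(c', s') \<in> set_pmf (run k (c, s)) \<Longrightarrow> frame (nmods c) (vmods c) s s'"
proof (induction k arbitrary: c s)
  case 0
  then show ?case by (simp add: frame_refl)
next
  case (Suc k)
  then obtain c1 s1 where 1: "(c1, s1) \<in> set_pmf (step c s)" "(c', s') \<in> set_pmf (run k (c1, s1))"
    by auto
  show ?case
    using frame_trans[OF conjunct2[OF conjunct2[OF step_frame[OF 1(1)]]] Suc.IH[OF 1(2)]]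
    by (rule frame_mono) (use step_frame[OF 1(1)] in auto)
qed

lemma wp_frame:
  assumes "wp c T Q s"
  shows "wp c T (\<lambda>s'. Q s' \<and> frame (nmods c) (vmods c) s s') s"
  using assms run_frame by (fastforce simp: wp_def)

text \<open>The frame is read off the syntax, so specifications of subprograms need not list what
  they preserve.\<close>

lemma wp_conseq:
  assumes "wp c T Q s" "T \<le> T'" "\<And>s'. Q s' \<Longrightarrow> frame (nmods c) (vmods c) s s' \<Longrightarrow> Q' s'"
  shows "wp c T' Q' s"
  using wp_mono[OF wp_frame[OF assms(1)] assms(2)] assms(3) by blast

lemma wp_Seq_conseq:
  assumes "wp c1 T1 P s" "T1 + 1 + T2 \<le> T"
    and "\<And>s'. P s' \<Longrightarrow> frame (nmods c1) (vmods c1) s s' \<Longrightarrow> wp c2 T2 Q s'"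
  shows "wp (Seq c1 c2) T Q s"
  by (rule wp_Seq[OF wp_conseq[OF assms(1) order_refl assms(3)] assms(2)])

subsection \<open>Loops\<close>

text \<open>The measure bounds the number of iterations. Each costs two steps beyond the body, for
  the test and for removing \<open>Skip\<close>; the last 1 pays for the failing test.\<close>

lemma wp_While_frame:
  assumes "I s"
    and "\<And>s'. I s' \<Longrightarrow> bval b s' \<Longrightarrow> frame (nmods c) (vmods c) s s' \<Longrightarrow>
           wp c T (\<lambda>s''. I s'' \<and> M s'' < M s') s'"
    and "\<And>s'. I s' \<Longrightarrow> \<not> bval b s' \<Longrightarrow> frame (nmods c) (vmods c) s s' \<Longrightarrow> Q s'"
    and "M s \<le> (m::nat)"
  shows "wp (While b c) (m * (T + 2) + 1) Q s"
proof -
  have "wp (While b c) (m * (T + 2) + 1) Q s'"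
    if "I s'" "frame (nmods c) (vmods c) s s'" "M s' \<le> m" for s'
    using that
  proof (induction m arbitrary: s')
    case 0
    show ?case
    proof (cases "bval b s'")
      case True
      \<comment> \<open>At measure 0 the body would have to decrease the measure further; its
        postcondition is unsatisfiable, but some run always exists.\<close>
      have "wp c T (\<lambda>_. False) s'"
        by (rule wp_mono[OF assms(2)[OF 0(1) True 0(2)]]) (use 0 in auto)
      then show ?thesis
        using set_pmf_not_empty[of "run T (c, s')"] by (auto simp: wp_def)
    next
      case False
      then show ?thesis using assms(3) 0 by (simp add: wp_simps wp_Skip)
    qed
  next
    case (Suc m)
    show ?case
    proof (cases "bval b s'")
      case True
      have "wp (Seq c (While b c)) (T + 1 + (m * (T + 2) + 1)) Q s'"
      proof (rule wp_Seq_conseq[OF assms(2)[OF Suc.prems(1) True Suc.prems(2)] order_refl])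
        fix s'' assume "I s'' \<and> M s'' < M s'" "frame (nmods c) (vmods c) s' s''"
        then show "wp (While b c) (m * (T + 2) + 1) Q s''"
          using Suc.IH Suc.prems frame_trans[OF Suc.prems(2), of "nmods c" "vmods c" s''] by auto
      qed
      then have "wp (Seq c (While b c)) (Suc m * (T + 2)) Q s'"
        by (rule wp_mono) auto
      then show ?thesis using True by (simp add: wp_simps)
    next
      case False
      then show ?thesis using assms(3) Suc by (simp add: wp_simps wp_Skip)
    qed
  qed
  then show ?thesis using assms(1,4) frame_refl by blast
qed

abbreviation sget :: "name \<Rightarrow> nexp" where
  "sget a \<equiv> NGet a (NConst 0) (NConst 0)"

abbreviation sset :: "name \<Rightarrow> nexp \<Rightarrow> com" where
  "sset a \<equiv> NSet a (NConst 0) (NConst 0)"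

definition loop :: "name \<Rightarrow> nexp \<Rightarrow> com \<Rightarrow> com" where
  "loop i e c = While (NLess (sget i) e) (Seq c (sset i (NAdd (sget i) (NConst 1))))"

definition iter :: "name \<Rightarrow> nexp \<Rightarrow> com \<Rightarrow> com" where
  "iter i e c = Seq (sset i (NConst 0)) (loop i e c)"

lemma mods_iter [simp]:
  "nmods (iter i e c) = insert i (nmods c)" "vmods (iter i e c) = vmods c"
  by (auto simp: iter_def loop_def)

text \<open>Four steps per iteration come on top of the body: the test, the increment and two
  removals of \<open>Skip\<close>. The cost \<open>\<tau> k\<close> depends on the index because the
  pivot loops skip most of their work at some vertices. The invariant has to be insensitive to the
  counter, which changes after the body has established \<open>I (Suc k)\<close>.\<close>

lemma wp_iter:
  assumes "\<And>s'. frame {i} {} s s' \<Longrightarrow> I 0 s'"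
    and "\<And>k s' s''. I k s' \<Longrightarrow> frame {i} {} s' s'' \<Longrightarrow> I k s''"
    and "\<And>s'. frame (insert i (nmods c)) (vmods c) s s' \<Longrightarrow> nval e s' = n"
    and "i \<notin> nmods c"
    and "\<And>k s'. k < n \<Longrightarrow> I k s' \<Longrightarrow> nats s' (i, 0, 0) = k \<Longrightarrow>
           frame (insert i (nmods c)) (vmods c) s s' \<Longrightarrow> wp c (\<tau> k) (I (Suc k)) s'"
    and "(\<Sum>k<n. \<tau> k) + n * 4 + 3 \<le> T"
  shows "wp (iter i e c) T (I n) s"
proof -
  let ?F = "frame (insert i (nmods c)) (vmods c) s"
  have *: "wp (loop i e c) ((\<Sum>k=k..<n. \<tau> k) + (n - k) * 4 + 1) (I n) s'"
    if "k \<le> n" "I k s'" "nats s' (i, 0, 0) = k" "?F s'" for k s'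
    using that
  proof (induction "n - k" arbitrary: k s')
    case 0
    then show ?case using assms(3) by (simp add: loop_def wp_simps wp_Skip)
  next
    case (Suc m)
    then have "k < n" by simp
    have "wp c (\<tau> k) (\<lambda>s''. I (Suc k) s'' \<and> frame (nmods c) (vmods c) s' s'') s'"
      by (rule wp_frame[OF assms(5)]) (use \<open>k < n\<close> Suc in auto)
    then have "wp (Seq c (sset i (NAdd (sget i) (NConst 1)))) (\<tau> k + 1 + 1)
        (wp (loop i e c) ((\<Sum>k=Suc k..<n. \<tau> k) + (n - Suc k) * 4 + 1) (I n)) s'"
    proof (rule wp_Seq_conseq[OF _ order_refl])
      fix s'' assume s'': "I (Suc k) s'' \<and> frame (nmods c) (vmods c) s' s''"
      define s3 where "s3 = s''\<lparr>nats := (nats s'')((i, 0, 0) := Suc k)\<rparr>"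
      have f: "frame {i} {} s'' s3" by (simp add: s3_def frame_def)
      have "?F s3"
        using frame_trans[OF Suc.prems(4) frame_trans[OF conjunct2[OF s''] f]]
        by (rule frame_mono) auto
      moreover have "nats s'' (i, 0, 0) = k"
        using s'' assms(4) Suc.prems(3) by (simp add: frame_def)
      ultimately show "wp (sset i (NAdd (sget i) (NConst 1))) 1
           (wp (loop i e c) ((\<Sum>k=Suc k..<n. \<tau> k) + (n - Suc k) * 4 + 1) (I n)) s''"
        using Suc.hyps(1)[of "Suc k" s3] Suc.hyps(2) \<open>k < n\<close> assms(2)[OF conjunct1[OF s''] f]
        by (simp add: wp_simps s3_def)
    qed
    then have "wp (Seq (Seq c (sset i (NAdd (sget i) (NConst 1)))) (loop i e c))
        ((\<tau> k + 1 + 1) + 1 + ((\<Sum>k=Suc k..<n. \<tau> k) + (n - Suc k) * 4 + 1)) (I n) s'"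
      by (rule wp_Seq) auto
    moreover have "(\<Sum>k=k..<n. \<tau> k) = \<tau> k + (\<Sum>k=Suc k..<n. \<tau> k)"
      using \<open>k < n\<close> by (simp add: sum.atLeast_Suc_lessThan)
    ultimately have "wp (Seq (Seq c (sset i (NAdd (sget i) (NConst 1)))) (loop i e c))
        ((\<Sum>k=k..<n. \<tau> k) + (n - k) * 4) (I n) s'"
      by (rule_tac wp_mono) (use \<open>k < n\<close> in \<open>auto\<close>)
    moreover have "bval (NLess (sget i) e) s'"
      using \<open>k < n\<close> Suc.prems(3,4) assms(3) by simp
    ultimately show ?case
      unfolding loop_def by (simp add: wp_simps)
  qed
  have "wp (loop i e c) ((\<Sum>k<n. \<tau> k) + n * 4 + 1) (I n) (s\<lparr>nats := (nats s)((i, 0, 0) := 0)\<rparr>)"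
    using *[of 0] assms(1) by (simp add: frame_def atLeast0LessThan)
  then have "wp (iter i e c) ((\<Sum>k<n. \<tau> k) + n * 4 + 3) (I n) s"
    by (simp add: iter_def wp_Seq_simps)
  then show ?thesis by (rule wp_mono) (use assms(6) in auto)
qed

subsection \<open>Every step changes at most one weight\<close>

lemma step_vals:
  "(c', s') \<in> set_pmf (step c s) \<Longrightarrow> \<exists>x y. vals s' = (vals s)(x := y)"
  (is "_ \<Longrightarrow> ?P s s'")
proof -
  have refl: "?P s s" for s :: state
    by (metis fun_upd_triv)
  show "(c', s') \<in> set_pmf (step c s) \<Longrightarrow> ?P s s'"
proof (induction c arbitrary: c' s')
  case (Seq c1 c2)
  then show ?case by (auto simp del: split_paired_Ex simp: refl split: if_splits)
qed (auto simp del: split_paired_Ex simp: fun_upd_triv intro: refl)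
qed

text \<open>The source of the lower bound on the given running time in
  \<open>square_le_time\<close>.\<close>

lemma run_vals:
  "(c', s') \<in> set_pmf (run k (c, s)) \<Longrightarrow>
     finite {x. vals s' x \<noteq> vals s x} \<and> card {x. vals s' x \<noteq> vals s x} \<le> k"
proof (induction k arbitrary: c s)
  case (Suc k)
  then obtain c1 s1 where 1: "(c1, s1) \<in> set_pmf (step c s)" "(c', s') \<in> set_pmf (run k (c1, s1))"
    by auto
  obtain x y where "vals s1 = (vals s)(x := y)" using step_vals[OF 1(1)] by blast
  then have "{x. vals s' x \<noteq> vals s x} \<subseteq> insert x {x. vals s' x \<noteq> vals s1 x}" by auto
  moreover have "finite {x. vals s' x \<noteq> vals s1 x}" "card {x. vals s' x \<noteq> vals s1 x} \<le> k"
    using Suc.IH[OF 1(2)] by auto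
  moreover have "card (insert x {x. vals s' x \<noteq> vals s1 x}) \<le> Suc k"
    using card_insert_le_m1[of "Suc k" "{x. vals s' x \<noteq> vals s1 x}" x] calculation(3) by simp
  ultimately show ?case
    using card_mono[of "insert x {x. vals s' x \<noteq> vals s1 x}" "{x. vals s' x \<noteq> vals s x}"]
    by (auto intro: finite_subset)
qed simp

subsection \<open>Probability of success\<close>

definition success :: "com \<Rightarrow> nat \<Rightarrow> (state \<Rightarrow> bool) \<Rightarrow> state \<Rightarrow> real" where
  "success c T Q s = measure_pmf.prob (run T (c, s)) {(c', s'). c' = Skip \<and> Q s'}"

lemma prob_bind_pmf:
  "measure_pmf.prob (bind_pmf M f) A = measure_pmf.expectation M (\<lambda>x. measure_pmf.prob (f x) A)"
proof -
  have "ennreal (measure_pmf.prob (bind_pmf M f) A) = (\<integral>\<^sup>+ x. ennreal (measure_pmf.prob (f x) A) \<partial>M)"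
    by (simp add: measure_pmf.emeasure_eq_measure[symmetric])
  also have "\<dots> = ennreal (measure_pmf.expectation M (\<lambda>x. measure_pmf.prob (f x) A))"
    by (rule nn_integral_eq_integral) (auto intro!: measure_pmf.integrable_const_bound[where B = 1])
  finally show ?thesis by (simp add: integral_nonneg)
qed

lemma success_0: "success c 0 Q s = (if c = Skip \<and> Q s then 1 else 0)"
  by (simp add: success_def)

lemma success_Suc:
  "success c (Suc T) Q s = measure_pmf.expectation (step c s) (\<lambda>(c', s'). success c' T Q s')"
  by (simp add: success_def prob_bind_pmf case_prod_unfold)

lemma success_le_1: "success c T Q s \<le> 1" and success_nonneg: "0 \<le> success c T Q s"
  by (simp_all add: success_def)

lemma wp_imp_success: "wp c T Q s \<Longrightarrow> success c T Q s = 1"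
  unfolding wp_def success_def
  by (subst measure_pmf.prob_eq_1) (auto simp: AE_measure_pmf_iff)

text \<open>Distributions are discrete, so an event of probability 1 contains every outcome of
  positive mass. This turns the hypothesis on the given program into a specification of all its
  runs.\<close>

lemma success_imp_wp: "success c T Q s = 1 \<Longrightarrow> wp c T Q s"
  unfolding wp_def success_def
  by (subst (asm) measure_pmf.prob_eq_1) (auto simp: AE_measure_pmf_iff)

lemma success_mono:
  assumes "T \<le> T'" "\<And>s'. Q s' \<Longrightarrow> Q' s'"
  shows "success c T Q s \<le> success c T' Q' s"
proof -
  obtain l where T': "T' = T + l" using assms(1) le_Suc_ex by blast
  have "success c T Q s \<le> success c T Q' s"
    unfolding success_def by (rule measure_pmf.finite_measure_mono) (use assms(2) in auto)
  also have "\<dots> = measure_pmf.expectation (run T (c, s)) (indicator {(c', s'). c' = Skip \<and> Q' s'})"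
    by (simp add: success_def)
  also have "\<dots> \<le> measure_pmf.expectation (run T (c, s))
      (\<lambda>cs. measure_pmf.prob (run l cs) {(c', s'). c' = Skip \<and> Q' s'})"
    by (rule integral_mono)
      (auto intro!: measure_pmf.integrable_const_bound[where B = 1]
        simp: run_Skip indicator_def split: prod.split)
  also have "\<dots> = success c T' Q' s"
    by (simp add: success_def T' run_add prob_bind_pmf)
  finally show ?thesis .
qed

text \<open>Only a lower bound: a final state of \<open>c1\<close> from which \<open>c2\<close>
  might fail counts as a failure. That suffices, since after good draws the remaining program
  succeeds for sure.\<close>

lemma success_Seq:
  "success c1 T1 (wp c2 T2 Q) s \<le> success (Seq c1 c2) (Suc (T1 + T2)) Q s"
proof (induction T1 arbitrary: c1 s)
  case 0
  show ?case
  proof (cases "c1 = Skip \<and> wp c2 T2 Q s")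
    case True
    then have "success (Seq c1 c2) (Suc (0 + T2)) Q s = 1"
      using wp_imp_success[of c2 T2 Q s] by (simp add: success_Suc)
    then show ?thesis by (simp add: success_le_1)
  next
    case False
    then have "success c1 0 (wp c2 T2 Q) s = 0" by (auto simp: success_0)
    then show ?thesis by (simp add: success_nonneg)
  qed
next
  case (Suc T1)
  show ?case
  proof (cases "c1 = Skip")
    case True
    have "success Skip (Suc T1) (wp c2 T2 Q) s = (if wp c2 T2 Q s then 1 else 0)"
      unfolding success_def by (simp add: run_Skip)
    moreover have "wp (Seq Skip c2) (Suc (Suc T1 + T2)) Q s" if "wp c2 T2 Q s"
      by (rule wp_Seq[of _ 0]) (use that in \<open>auto simp: wp_0\<close>)
    ultimately show ?thesis
      using True wp_imp_success success_nonneg by auto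
  next
    case False
    have "success c1 (Suc T1) (wp c2 T2 Q) s =
        measure_pmf.expectation (step c1 s) (\<lambda>(c', s'). success c' T1 (wp c2 T2 Q) s')"
      by (rule success_Suc)
    also have "\<dots> \<le> measure_pmf.expectation (step c1 s)
        (\<lambda>(c', s'). success (Seq c' c2) (Suc (T1 + T2)) Q s')"
      by (rule integral_mono)
        (auto intro!: measure_pmf.integrable_const_bound[where B = 1] Suc.IH
          simp: success_le_1 success_nonneg split: prod.split)
    also have "\<dots> = success (Seq c1 c2) (Suc (Suc T1 + T2)) Q s"
      using False by (subst success_Suc) (simp add: case_prod_unfold)
    finally show ?thesis .
  qed
qed

section \<open>Shortest-path distances, characterized by triangle inequalities\<close>

section \<open>Distances\<close>

locale wdigraph =
  fixes n m :: nat and G :: "nat pair_pre_digraph" and w :: "nat \<times> nat \<Rightarrow> real"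
  assumes weighted_digraph: "weighted_digraph n m G w"

sublocale wdigraph \<subseteq> pair_fin_digraph G
  using weighted_digraph unfolding weighted_digraph_def by (rule conjunct1)

context wdigraph
begin

lemma pverts: "pverts G = {..<n}" and card_parcs: "card (parcs G) = m"
  and weight_nonneg: "e \<in> parcs G \<Longrightarrow> 0 \<le> w e"
  using weighted_digraph by (auto simp: weighted_digraph_def)

lemma arc_less: "(u, v) \<in> parcs G \<Longrightarrow> u < n \<and> v < n"
  using in_arcsD1 in_arcsD2 pverts by blast

definition weight :: "nat \<Rightarrow> nat \<Rightarrow> ereal" where
  "weight u v = (if (u, v) \<in> parcs G then ereal (w (u, v)) else \<infinity>)"

abbreviation distance :: "nat \<Rightarrow> nat \<Rightarrow> ereal" where
  "distance \<equiv> wf_digraph.\<mu> (with_proj G) w"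

lemma awalk_cost_nonneg: "awalk u p v \<Longrightarrow> 0 \<le> awalk_cost w p"
  by (rule pos_cost_pos_awalk_cost) (auto intro: weight_nonneg)

lemma distance_nonneg: "0 \<le> distance u v"
  unfolding \<mu>_def by (rule INF_greatest) (use awalk_cost_nonneg in auto)

lemma distance_self: "u < n \<Longrightarrow> distance u u = 0"
  using min_cost_le_walk_cost[of u "[]" u w] distance_nonneg[of u u]
  by (auto simp: awalk_Nil_iff pverts zero_ereal_def[symmetric])

lemma distance_le_weight: "distance u v \<le> weight u v"
  using min_cost_le_walk_cost[of u "[(u, v)]" v w] arc_less[of u v]
  by (auto simp: weight_def awalk_Cons_iff awalk_Nil_iff pverts)

lemma distance_triangle: "distance u v \<le> distance u k + distance k v"
proof (cases "distance u k = \<infinity> \<or> distance k v = \<infinity>")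
  case False
  then have "u \<rightarrow>\<^sup>*\<^bsub>with_proj G\<^esub> k" "k \<rightarrow>\<^sup>*\<^bsub>with_proj G\<^esub> v"
    using \<mu>_reach_conv[of w] by auto
  then obtain p q where "apath u p k" "distance u k = awalk_cost w p"
      "apath k q v" "distance k v = awalk_cost w q"
    using min_cost_awalk[of u k w] min_cost_awalk[of k v w] weight_nonneg by auto
  moreover from this have "awalk u (p @ q) v"
    by (blast intro: awalk_appendI awalkI_apath)
  ultimately show ?thesis
    using min_cost_le_walk_cost[of u "p @ q" v w] by simp
qed (use distance_nonneg in auto)

text \<open>Telescoping the triangle inequality along a walk bounds \<open>D u v\<close> by the cost
  of the walk. Matrices that never drop below \<open>distance\<close> are thereby determined as soon
  as they satisfy all triangle inequalities.\<close>

lemma distance_greatest: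
  assumes "\<And>u. u < n \<Longrightarrow> D u u \<le> 0"
    and "\<And>u v. u < n \<Longrightarrow> v < n \<Longrightarrow> D u v \<le> weight u v"
    and "\<And>u k v. u < n \<Longrightarrow> k < n \<Longrightarrow> v < n \<Longrightarrow> D u v \<le> D u k + D k v"
    and "u < n" "v < n"
  shows "D u v \<le> distance u v"
proof -
  have "D u v \<le> ereal (awalk_cost w p)" if "awalk u p v" "u < n" for u p
    using that
  proof (induction p arbitrary: u)
    case Nil
    then show ?case using assms(1) by (auto simp: awalk_Nil_iff zero_ereal_def)
  next
    case (Cons e p)
    obtain x where e: "e = (u, x)" "(u, x) \<in> parcs G" "awalk x p v"
      using Cons.prems by (cases e) (auto simp: awalk_Cons_iff)
    then have "x < n" using arc_less by blast
    have "D u v \<le> D u x + D x v" using assms(3,5) \<open>x < n\<close> Cons.prems by blast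
    also have "\<dots> \<le> weight u x + ereal (awalk_cost w p)"
      by (intro add_mono assms(2) Cons.IH e \<open>x < n\<close> Cons.prems)
    also have "\<dots> = ereal (awalk_cost w (e # p))"
      using e by (simp add: weight_def)
    finally show ?case .
  qed
  then show ?thesis
    unfolding \<mu>_def using assms(4) by (auto intro: INF_greatest)
qed

subsection \<open>Floyd-Warshall steps\<close>

text \<open>Holds for every intermediate matrix. The diagonal has to be exactly 0 so that a pivot
  leaves its own row and column unchanged.\<close>

definition approx :: "(nat \<Rightarrow> nat \<Rightarrow> ereal) \<Rightarrow> bool" where
  "approx D \<longleftrightarrow> (\<forall>u<n. \<forall>v<n. distance u v \<le> D u v \<and> D u v \<le> weight u v) \<and> (\<forall>u<n. D u u = 0)"

text \<open>Takes the place of the usual invariant about shortest paths with all inner vertices in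
  \<open>K\<close>.\<close>

definition closed_under :: "(nat \<Rightarrow> nat \<Rightarrow> ereal) \<Rightarrow> nat set \<Rightarrow> bool" where
  "closed_under D K \<longleftrightarrow> (\<forall>k\<in>K. \<forall>u<n. \<forall>v<n. D u v \<le> D u k + D k v)"

definition pivot :: "nat \<Rightarrow> (nat \<Rightarrow> nat \<Rightarrow> ereal) \<Rightarrow> nat \<Rightarrow> nat \<Rightarrow> ereal" where
  "pivot k D u v = min (D u v) (D u k + D k v)"

lemma approx_nonneg: "approx D \<Longrightarrow> u < n \<Longrightarrow> v < n \<Longrightarrow> 0 \<le> D u v"
  using distance_nonneg order_trans unfolding approx_def by blast

text \<open>By \<open>D k k = 0\<close>. Consequently an update in place may read old or new entries
  and may visit the pairs in any order.\<close>

lemma pivot_row_column: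
  assumes "approx D" "k < n"
  shows "u < n \<Longrightarrow> pivot k D u k = D u k" "v < n \<Longrightarrow> pivot k D k v = D k v"
  using assms by (auto simp: pivot_def approx_def)

lemma approx_pivot:
  assumes "approx D" "k < n"
  shows "approx (pivot k D)"
proof -
  have "distance u v \<le> D u k + D k v" if "u < n" "v < n" for u v
    by (rule order_trans[OF distance_triangle add_mono]) (use assms that in \<open>auto simp: approx_def\<close>)
  moreover have "pivot k D u u = 0" if "u < n" for u
    using that assms approx_nonneg[OF assms(1)]
    by (auto simp: pivot_def approx_def min_def intro!: antisym)
  ultimately show ?thesis
    using assms by (auto simp: approx_def pivot_def intro: min.coboundedI1)
qed

lemma closed_under_pivot:
  assumes D: "approx D" "k < n" and cl: "closed_under D K" and "K \<subseteq> {..<n}"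
  shows "closed_under (pivot k D) (insert k K)"
proof -
  have k: "pivot k D u v \<le> pivot k D u k + pivot k D k v" if "u < n" "v < n" for u v
    using that pivot_row_column[OF D] by (simp add: pivot_def)
  have "pivot k D u v \<le> pivot k D u j + pivot k D j v" if uv: "u < n" "v < n" and "j \<in> K" for u v j
  proof -
    have "j < n" using assms \<open>j \<in> K\<close> by auto
    note nonneg = approx_nonneg[OF D(1)]
    have cl: "D x y \<le> D x j + D j y" if "x < n" "y < n" for x y
      using cl \<open>j \<in> K\<close> that by (simp add: closed_under_def)
    \<comment> \<open>Each of the two entries on the right-hand side is either an old one or a
      detour through \<open>k\<close>; the bounds 1 to 4 treat the four combinations.\<close>
    have 1: "pivot k D u v \<le> D u j + D j v"
      using cl[OF uv] by (auto simp: pivot_def min_le_iff_disj)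
    have "pivot k D u v \<le> D u k + D k v" by (simp add: pivot_def)
    also have "\<dots> \<le> D u k + (D k j + D j v)"
      by (intro add_mono cl order_refl D uv)
    finally have 2: "pivot k D u v \<le> D u k + D k j + D j v" by (simp add: ac_simps)
    have "pivot k D u v \<le> D u k + D k v" by (simp add: pivot_def)
    also have "\<dots> \<le> (D u j + D j k) + D k v"
      by (intro add_mono cl order_refl D uv)
    finally have 3: "pivot k D u v \<le> D u j + (D j k + D k v)" by (simp add: ac_simps)
    have "pivot k D u v \<le> D u k + D k v" by (simp add: pivot_def)
    \<comment> \<open>The route u, k, j, k, v contains the closed part k, j, k, whose cost is
      non-negative and can be inserted for free.\<close>
    also have "\<dots> \<le> (D u k + D k j) + (D j k + D k v)"
      using add_mono[of "D u k" "D u k + D k j" "D k v" "D j k + D k v"]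
        nonneg[OF \<open>k < n\<close> \<open>j < n\<close>] nonneg[OF \<open>j < n\<close> \<open>k < n\<close>]
        add_increasing2[of "D k j" "D u k" "D u k"] add_increasing[of "D j k" "D k v" "D k v"]
      by simp
    finally have 4: "pivot k D u v \<le> (D u k + D k j) + (D j k + D k v)" .
    show ?thesis
      using 1 2 3 4 unfolding pivot_def[of k D u j] pivot_def[of k D j v]
      by (auto simp: min_def)
  qed
  then show ?thesis
    using k by (auto simp: closed_under_def)
qed

lemma approx_closed_eq_distance:
  assumes "approx D" "closed_under D {..<n}" "u < n" "v < n"
  shows "D u v = distance u v"
  using assms distance_greatest[of D u v]
  by (auto simp: approx_def closed_under_def intro!: antisym)

end

section \<open>Directed cycles inside sets of vertices without a source\<close>

section \<open>Cycles\<close>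

text \<open>A walk can be prolonged backwards forever. With as many arcs as there are vertices it
  visits one vertex more than exist, so some vertex repeats.\<close>

lemma (in pair_fin_digraph) exists_cycle:
  assumes "pverts G \<noteq> {}" "\<And>v. v \<in> pverts G \<Longrightarrow> \<exists>u. (u, v) \<in> parcs G"
  shows "\<exists>p. cycle p"
proof -
  obtain z where z: "z \<in> pverts G" using assms(1) by blast
  have "\<exists>u p. awalk u p z \<and> length p = k" for k
  proof (induction k)
    case 0
    then show ?case using z by (auto simp: awalk_Nil_iff)
  next
    case (Suc k)
    then obtain u p where "awalk u p z" "length p = k" by blast
    moreover from this obtain x where "(x, u) \<in> parcs G"
      using assms(2) awalk_hd_in_verts by blast
    ultimately have "awalk x ((x, u) # p) z \<and> length ((x, u) # p) = Suc k"
      using in_arcsD1 by (auto simp: awalk_Cons_iff)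
    then show ?case by blast
  qed
  then obtain u p where p: "awalk u p z" "length p = card (pverts G)" by blast
  have "set (awalk_verts u p) \<subseteq> pverts G"
    using p(1) by (rule awalkE') simp
  then have "\<not> distinct (awalk_verts u p)"
    using card_mono[OF pair_finite_verts, of "set (awalk_verts u p)"]
      distinct_card[of "awalk_verts u p"] length_awalk_verts[of u p] p(2)
    by linarith
  then obtain r where "closed_w r"
    using awalk_not_distinct_decomp[OF p(1)] by (auto simp: closed_w_def)
  then show ?thesis by (rule closed_w_imp_cycle)
qed

context wdigraph
begin

text \<open>\<open>exists_cycle\<close> for the subgraph induced by \<open>U\<close>. It serves both
  to analyse a stuck elimination and to find cycles on at most two vertices.\<close>

lemma dicycle_within:
  assumes "U \<subseteq> {..<n}" "U \<noteq> {}" "\<And>v. v \<in> U \<Longrightarrow> \<exists>u\<in>U. (u, v) \<in> parcs G"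
  shows "\<exists>C\<in>dicycles G. dicycle_verts C \<subseteq> U"
proof -
  define H where "H = \<lparr>pverts = U, parcs = parcs G \<inter> U \<times> U\<rparr>"
  have H: "pair_fin_digraph H"
    unfolding pair_fin_digraph_def pair_wf_digraph_def pair_fin_digraph_axioms_def
    by (auto simp: H_def pair_finite_arcs intro: finite_subset[OF assms(1)])
  then have wf: "wf_digraph (with_proj H)"
    by (simp add: wf_digraph_wp_iff pair_fin_digraph_def)
  obtain p where p: "pre_digraph.cycle (with_proj H) p"
    using pair_fin_digraph.exists_cycle[OF H] assms by (force simp: H_def)
  have "subgraph (with_proj H) (with_proj G)"
    using assms(1) wf wf_digraph_axioms
    by (auto simp: subgraph_def compatible_def H_def pverts)
  then have "cycle p" using p by (rule subgraph_cycle)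
  moreover have "set p \<subseteq> parcs H"
    using p by (auto simp: pre_digraph.cycle_def pre_digraph.awalk_def)
  then have "dicycle_verts (set p) \<subseteq> U"
    by (auto simp: dicycle_verts_def H_def)
  ultimately show ?thesis by (auto simp: dicycles_def)
qed

lemma dicycle_subset: "C \<in> dicycles G \<Longrightarrow> C \<subseteq> parcs G"
  by (auto simp: dicycles_def cycle_def awalk_def)

lemma finite_dicycles: "finite (dicycles G)"
  using dicycle_subset by (intro finite_subset[OF _ finite_Pow_iff[THEN iffD2, OF pair_finite_arcs]]) auto

lemma dicycle_verts_subset: "C \<in> dicycles G \<Longrightarrow> dicycle_verts C \<subseteq> {..<n}"
  using dicycle_subset arc_less by (fastforce simp: dicycle_verts_def)

text \<open>The case \<open>u = v\<close> is included, so that a loop also forces d to be at most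
  2.\<close>

lemma two_cycle:
  assumes "(u, v) \<in> parcs G" "(v, u) \<in> parcs G"
  shows "\<exists>C\<in>dicycles G. card (dicycle_verts C) \<le> 2"
proof -
  obtain C where "C \<in> dicycles G" "dicycle_verts C \<subseteq> {u, v}"
    using dicycle_within[of "{u, v}"] assms arc_less by blast
  moreover have "card {u, v} \<le> 2" by (simp add: card_insert_if)
  ultimately show ?thesis
    using card_mono[of "{u, v}" "dicycle_verts C"] by (meson finite.intros order_trans)
qed

lemma dag_if_dicycles_empty: "dicycles G = {} \<Longrightarrow> dag G"
  by (auto simp: dicycles_def dag_def)

lemma dagI:
  assumes "\<And>u v. (u, v) \<in> parcs G \<Longrightarrow> p u < (p v :: nat)"
  shows "dag G"
proof -
  have "p u < p v \<or> q = []" if "awalk u q v" for u q v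
    using that
  proof (induction q arbitrary: u)
    case (Cons e q)
    then show ?case using assms by (cases e) (fastforce simp: awalk_Cons_iff awalk_Nil_iff)
  qed simp
  then show ?thesis by (fastforce simp: dag_def cycle_def)
qed

end

section \<open>An acyclic instance of the same size that preserves the arcs among kept
  vertices\<close>

section \<open>The acyclic orientation\<close>

definition orient :: "nat \<Rightarrow> (nat \<Rightarrow> nat) \<Rightarrow> nat pair_pre_digraph \<Rightarrow> nat pair_pre_digraph" where
  "orient n p G = \<lparr>pverts = {..<n},
     parcs = {(u, v). u < n \<and> v < n \<and> p u < p v \<and> ((u, v) \<in> parcs G \<or> (v, u) \<in> parcs G)}\<rparr>"

text \<open>\<open>z\<close> is the largest position a deleted vertex can have. An arc leaving a
  deleted vertex may have been reversed, and \<open>w\<close> is unconstrained off the arcs of the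
  graph, so 0 is used to stay non-negative. The value cannot influence distances between kept
  vertices, as arcs ascend and none leads from a kept to a deleted vertex.\<close>

definition orient_weight :: "nat \<Rightarrow> (nat \<Rightarrow> nat) \<Rightarrow> (nat \<times> nat \<Rightarrow> real) \<Rightarrow> nat \<times> nat \<Rightarrow> real" where
  "orient_weight z p w e = (if z < p (fst e) then w e else 0)"

text \<open>By \<open>later\<close>, only arcs into deleted vertices can descend and get reversed.
  For \<open>u = v\<close>, \<open>no_two_cycle\<close> excludes loops.\<close>

locale elimination_order = wdigraph +
  fixes p :: "nat \<Rightarrow> nat" and z :: nat
  assumes inj: "inj_on p {..<n}"
    and later: "(u, v) \<in> parcs G \<Longrightarrow> z < p v \<Longrightarrow> p u < p v"
    and no_two_cycle: "(u, v) \<in> parcs G \<Longrightarrow> (v, u) \<notin> parcs G"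
begin

text \<open>Turning each arc upwards is injective because no two arcs are opposite, and possible
  because there are no loops.\<close>

lemma card_orient: "card (parcs (orient n p G)) = card (parcs G)"
proof -
  define f where "f = (\<lambda>(u, v). if p u < p v then (u, v) else (v, u))"
  have "bij_betw f (parcs G) (parcs (orient n p G))"
    unfolding bij_betw_def
  proof
    show "inj_on f (parcs G)"
      using no_two_cycle by (auto simp: inj_on_def f_def split: if_splits)
    have "p u \<noteq> p v" if "(u, v) \<in> parcs G" for u v
      using that arc_less[OF that] no_two_cycle inj by (auto simp: inj_on_def)
    then have "f e \<in> parcs (orient n p G)" if "e \<in> parcs G" for e
    proof -
      obtain u v where e: "e = (u, v)" "(u, v) \<in> parcs G" using \<open>e \<in> parcs G\<close> by (cases e) auto
      then have "u < n" "v < n" "p u < p v \<or> p v < p u"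
        using arc_less \<open>\<And>u v. (u, v) \<in> parcs G \<Longrightarrow> p u \<noteq> p v\<close> by (auto simp: neq_iff)
      then show ?thesis using e by (auto simp: f_def orient_def)
    qed
    moreover have "e \<in> f ` parcs G" if e: "e \<in> parcs (orient n p G)" for e
    proof -
      obtain u v where uv: "e = (u, v)" "p u < p v" "(u, v) \<in> parcs G \<or> (v, u) \<in> parcs G"
        using e by (auto simp: orient_def)
      then have "f (u, v) = e" "f (v, u) = e" by (auto simp: f_def)
      then show ?thesis using uv(3) by (metis image_eqI)
    qed
    ultimately show "f ` parcs G = parcs (orient n p G)" by blast
  qed
  then show ?thesis by (metis bij_betw_same_card)
qed

lemma orient_arc_weight_nonneg: "e \<in> parcs (orient n p G) \<Longrightarrow> 0 \<le> orient_weight z p w e"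
  using later weight_nonneg by (fastforce simp: orient_def orient_weight_def)

lemma weighted_digraph_orient: "weighted_digraph n m (orient n p G) (orient_weight z p w)"
proof -
  have "finite (parcs (orient n p G))"
    by (rule finite_subset[of _ "{..<n} \<times> {..<n}"]) (auto simp: orient_def)
  then have "pair_fin_digraph (orient n p G)"
    by unfold_locales (auto simp: orient_def)
  then show ?thesis
    using orient_arc_weight_nonneg card_orient card_parcs
    by (auto simp: weighted_digraph_def orient_def)
qed

lemma wdigraph_orient: "wdigraph n m (orient n p G) (orient_weight z p w)"
  by (rule wdigraph.intro[OF weighted_digraph_orient])

abbreviation orient_distance :: "nat \<Rightarrow> nat \<Rightarrow> ereal" where
  "orient_distance \<equiv> wf_digraph.\<mu> (with_proj (orient n p G)) (orient_weight z p w)"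

lemma dag_orient: "dag (orient n p G)"
  by (rule wdigraph.dagI[OF wdigraph_orient, of p]) (auto simp: orient_def)

lemma wf_orient: "wf_digraph (with_proj (orient n p G))"
  unfolding wf_digraph_wp_iff by (auto simp: pair_wf_digraph_def orient_def)

lemma orient_distance_le_weight:
  assumes "z < p u" "z < p v"
  shows "orient_distance u v \<le> weight u v"
proof (cases "(u, v) \<in> parcs G")
  case True
  then have "(u, v) \<in> parcs (orient n p G)"
    using later[OF True] assms arc_less[OF True] by (simp add: orient_def)
  then have "wdigraph.weight (orient n p G) (orient_weight z p w) u v = weight u v"
    using True assms(1) by (simp add: wdigraph.weight_def[OF wdigraph_orient] weight_def orient_weight_def)
  then show ?thesis
    using wdigraph.distance_le_weight[OF wdigraph_orient, of u v] by simp
qed (simp add: weight_def)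

text \<open>A walk of the orientation from a kept vertex ascends, so it visits kept vertices only. A
  step from \<open>u\<close> to \<open>x\<close> cannot be a reversed arc, since
  \<open>later\<close> for the arc from \<open>x\<close> into the kept \<open>u\<close> would make
  the step descend; so it is an arc of \<open>G\<close> with its original weight.\<close>

lemma distance_le_orient_distance:
  assumes "z < p u"
  shows "distance u v \<le> orient_distance u v"
proof -
  have "awalk u q v \<and> wf_digraph.awalk_cost (orient_weight z p w) q = awalk_cost w q"
    if "pre_digraph.awalk (with_proj (orient n p G)) u q v" "z < p u" for q u
    using that
  proof (induction q arbitrary: u)
    case Nil
    then show ?case
      by (simp add: awalk_Nil_iff wf_digraph.awalk_Nil_iff[OF wf_orient] pverts
          wf_digraph.awalk_cost_Nil[OF wf_orient])
        (simp add: orient_def)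
  next
    case (Cons e q)
    obtain x where e: "e = (u, x)" "(u, x) \<in> parcs (orient n p G)"
        "pre_digraph.awalk (with_proj (orient n p G)) x q v"
      using Cons.prems by (cases e) (auto simp: wf_digraph.awalk_Cons_iff[OF wf_orient])
    then have "p u < p x" and "(u, x) \<in> parcs G \<or> (x, u) \<in> parcs G"
      by (auto simp: orient_def)
    then have "(u, x) \<in> parcs G" using later[of x u] Cons.prems(2) by auto
    then show ?case
      using Cons.IH[OF e(3)] \<open>p u < p x\<close> Cons.prems(2) e arc_less[of u x]
      by (simp add: awalk_Cons_iff orient_weight_def pverts wf_digraph.awalk_cost_Cons[OF wf_orient])
  qed
  then have "distance u v \<le> ereal (wf_digraph.awalk_cost (orient_weight z p w) q)"
    if "pre_digraph.awalk (with_proj (orient n p G)) u q v" for q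
    using that assms min_cost_le_walk_cost[of u q v w] by simp
  then show ?thesis
    unfolding wf_digraph.\<mu>_def[OF wf_orient] by (auto intro: INF_greatest)
qed

end

section \<open>The invariant of the elimination, independent of the program\<close>

section \<open>Elimination\<close>

text \<open>Position 0 means that a vertex is still present. Sources are eliminated with positions beyond
  \<open>2 * n\<close>; the sampled vertex \<open>R i\<close>, deleted for lack of a source, gets position \<open>i + 1\<close>.\<close>

definition elim_inv ::
    "nat \<Rightarrow> (nat \<times> nat) set \<Rightarrow> (nat \<Rightarrow> nat) \<Rightarrow> nat \<Rightarrow> (nat \<Rightarrow> nat) \<Rightarrow> nat \<Rightarrow> nat \<Rightarrow> bool" where
  "elim_inv n A R \<sigma> p q c \<longleftrightarrow>
     q \<le> 2 * n \<and>
     (\<forall>i<q. p (R i) \<noteq> 0) \<and>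
     (\<forall>v<n. 0 < p v \<and> p v \<le> 2 * n \<longrightarrow> p v \<le> q \<and> p v \<le> \<sigma> \<and> R (p v - 1) = v) \<and>
     (\<forall>v<n. p v \<le> 2 * n + c) \<and>
     (\<forall>u<n. \<forall>v<n. 2 * n < p u \<and> p u = p v \<longrightarrow> u = v) \<and>
     (\<forall>u v. (u, v) \<in> A \<and> 2 * n < p v \<longrightarrow> 0 < p u \<and> p u < p v)"

text \<open>The new position is the largest so far, hence the arcs from the predecessors, all
  eliminated, ascend. Arcs from \<open>x\<close> into earlier sources do not exist: the invariant
  gives their tails positive positions, but \<open>p x = 0\<close>.\<close>

lemma elim_inv_source:
  assumes "elim_inv n A R \<sigma> p q c" "x < n" "p x = 0" "A \<subseteq> {..<n} \<times> {..<n}"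
    and "\<And>u. (u, x) \<in> A \<Longrightarrow> p u \<noteq> 0"
  shows "elim_inv n A R \<sigma> (p(x := Suc (2 * n + c))) q (Suc c)"
proof -
  have p_le: "p u \<le> 2 * n + c" if "u < n" for u using assms(1) that by (simp add: elim_inv_def)
  have less: "u < n \<and> v < n" if "(u, v) \<in> A" for u v using assms(4) that by auto
  let ?p = "p(x := Suc (2 * n + c))"
  have "u = v" if "u < n" "v < n" "2 * n < ?p u" "?p u = ?p v" for u v
    using that p_le[of u] p_le[of v] assms(1) by (auto simp: elim_inv_def split: if_splits)
  moreover have "0 < ?p u \<and> ?p u < ?p v" if "(u, v) \<in> A" "2 * n < ?p v" for u v
  proof (cases "v = x")
    case True
    then show ?thesis
      using that assms(3) assms(5)[of u] p_le[of u] less by auto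
  next
    case False
    then have "0 < p u \<and> p u < p v" using that assms(1) by (simp add: elim_inv_def)
    then show ?thesis using False assms(3) by auto
  qed
  moreover have "\<forall>i<q. ?p (R i) \<noteq> 0" "q \<le> 2 * n" using assms(1) by (auto simp: elim_inv_def)
  moreover have "\<forall>v<n. 0 < ?p v \<and> ?p v \<le> 2 * n \<longrightarrow> ?p v \<le> q \<and> ?p v \<le> \<sigma> \<and> R (?p v - 1) = v"
    using assms(1) by (simp add: elim_inv_def)
  moreover have "\<forall>v<n. ?p v \<le> 2 * n + Suc c" using p_le by (simp add: le_SucI)
  ultimately show ?thesis unfolding elim_inv_def by blast
qed

text \<open>An entry whose vertex is already gone is just consumed. The bound
  \<open>q < \<sigma>\<close> is demanded only if a position is really assigned; thus the rest of
  the sample can be used up after its first \<sigma> entries.\<close>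

lemma elim_inv_sample:
  assumes "elim_inv n A R \<sigma> p q c" "q < 2 * n" and "p (R q) = 0 \<Longrightarrow> q < \<sigma>"
  shows "elim_inv n A R \<sigma> (if p (R q) = 0 then p(R q := Suc q) else p) (Suc q) c"
proof (cases "p (R q) = 0")
  case False
  then show ?thesis using assms by (auto simp: elim_inv_def less_Suc_eq le_SucI)
next
  case True
  let ?p = "p(R q := Suc q)"
  note inv = assms(1)[unfolded elim_inv_def]
  have "0 < ?p u \<and> ?p u < ?p v" if "(u, v) \<in> A" "2 * n < ?p v" for u v
  proof -
    have "v \<noteq> R q" using that assms(2) by auto
    then have "0 < p u \<and> p u < p v" using that inv by simp
    then show ?thesis using \<open>v \<noteq> R q\<close> True by auto
  qed
  moreover have "\<forall>i<Suc q. ?p (R i) \<noteq> 0" using inv by (auto simp: less_Suc_eq)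
  moreover have "\<forall>v<n. 0 < ?p v \<and> ?p v \<le> 2 * n \<longrightarrow> ?p v \<le> Suc q \<and> ?p v \<le> \<sigma> \<and> R (?p v - 1) = v"
    using inv assms(3)[OF True] by (auto simp: le_SucI)
  moreover have "\<forall>v<n. ?p v \<le> 2 * n + c" using inv assms(2) by auto
  moreover have "\<forall>u<n. \<forall>v<n. 2 * n < ?p u \<and> ?p u = ?p v \<longrightarrow> u = v" using inv assms(2) by auto
  moreover have "Suc q \<le> 2 * n" using assms(2) by simp
  ultimately have "elim_inv n A R \<sigma> ?p (Suc q) c" unfolding elim_inv_def by blast
  then show ?thesis using True by simp
qed

text \<open>If every present vertex has a present predecessor, the present vertices contain a cycle,
  which some \<open>R i\<close> with \<open>i < \<sigma>\<close> meets. Had \<sigma> entries been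
  processed already, that vertex would no longer be present.\<close>

lemma (in wdigraph) elim_stuck:
  assumes inv: "elim_inv n (parcs G) R \<sigma> p q c"
    and hit: "\<And>C. C \<in> dicycles G \<Longrightarrow> \<exists>i<\<sigma>. R i \<in> dicycle_verts C"
    and stuck: "\<And>v. v < n \<Longrightarrow> p v = 0 \<Longrightarrow> \<exists>u<n. p u = 0 \<and> (u, v) \<in> parcs G"
    and "r < n" "p r = 0"
  shows "q < \<sigma>"
proof (rule ccontr)
  assume "\<not> q < \<sigma>"
  obtain C where "C \<in> dicycles G" "dicycle_verts C \<subseteq> {v. v < n \<and> p v = 0}"
    using dicycle_within[of "{v. v < n \<and> p v = 0}"] stuck assms(4,5) by blast
  moreover from this obtain i where "i < \<sigma>" "R i \<in> dicycle_verts C" using hit by blast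
  ultimately have "i < q" "p (R i) = 0" using \<open>\<not> q < \<sigma>\<close> by auto
  then show False using inv unfolding elim_inv_def by blast
qed

text \<open>A position up to \<open>2 * n\<close> is an index into the sample plus 1, so it
  determines its vertex; deleted vertices are therefore among the first \<sigma> entries.\<close>

lemma elim_inv_card:
  assumes "elim_inv n A R \<sigma> p q c" "\<And>v. v < n \<Longrightarrow> p v \<noteq> 0"
  shows "card {v. v < n \<and> p v \<le> 2 * n} \<le> \<sigma>"
proof -
  have "{v. v < n \<and> p v \<le> 2 * n} \<subseteq> R ` {..<\<sigma>}"
  proof
    fix v assume v: "v \<in> {v. v < n \<and> p v \<le> 2 * n}"
    then have "R (p v - 1) = v" "p v \<le> \<sigma>" "0 < p v"
      using assms by (auto simp: elim_inv_def)
    then show "v \<in> R ` {..<\<sigma>}"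
      by (metis diff_less imageI lessThan_iff less_le_trans zero_less_one)
  qed
  then have "card {v. v < n \<and> p v \<le> 2 * n} \<le> card (R ` {..<\<sigma>})"
    by (rule card_mono[rotated]) simp
  also have "\<dots> \<le> \<sigma>" using card_image_le[of "{..<\<sigma>}" R] by simp
  finally show ?thesis .
qed

lemma (in wdigraph) elim_inv_order:
  assumes "elim_inv n (parcs G) R \<sigma> p q c" "\<And>v. v < n \<Longrightarrow> p v \<noteq> 0"
    and "\<And>u v. (u, v) \<in> parcs G \<Longrightarrow> (v, u) \<notin> parcs G"
  shows "elimination_order n m G w p (2 * n)"
proof
  show "inj_on p {..<n}"
  proof (rule inj_onI)
    fix u v assume "u \<in> {..<n}" "v \<in> {..<n}" "p u = p v"
    moreover from this have "0 < p u" "0 < p v" using assms(2) by auto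
    ultimately show "u = v"
      using assms(1) unfolding elim_inv_def by (metis lessThan_iff not_le)
  qed
qed (use assms in \<open>auto simp: elim_inv_def\<close>)

section \<open>The program and the verification of its phases\<close>

section \<open>The algorithm\<close>

text \<open>The invariant is indexed by the set of pairs already visited. The proof for the body
  sees an arbitrary such set, so the order of traversal never enters it.\<close>

lemma wp_iter2:
  assumes Inv0: "\<And>s'. frame {i, j} {} s s' \<Longrightarrow> Inv {} s'"
    and resp: "\<And>S s' s''. Inv S s' \<Longrightarrow> frame {i, j} {} s' s'' \<Longrightarrow> Inv S s''"
    and e: "\<And>s'. frame ({i, j} \<union> nmods c) (vmods c) s s' \<Longrightarrow> nval e s' = n"
    and ij: "i \<noteq> j" "i \<notin> nmods c" "j \<notin> nmods c"
    and body: "\<And>S s'. nats s' (i, 0, 0) < n \<Longrightarrow> nats s' (j, 0, 0) < n \<Longrightarrow> S \<subseteq> {..<n} \<times> {..<n} \<Longrightarrow>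
        (nats s' (i, 0, 0), nats s' (j, 0, 0)) \<notin> S \<Longrightarrow> Inv S s' \<Longrightarrow>
        frame ({i, j} \<union> nmods c) (vmods c) s s' \<Longrightarrow>
        wp c \<tau> (Inv (insert (nats s' (i, 0, 0), nats s' (j, 0, 0)) S)) s'"
    and T: "n * (n * (\<tau> + 4) + 7) + 3 \<le> T"
  shows "wp (iter i e (iter j e c)) T (Inv ({..<n} \<times> {..<n})) s"
proof (rule wp_iter[where I = "\<lambda>k. Inv ({..<k} \<times> {..<n})" and \<tau> = "\<lambda>_. n * (\<tau> + 4) + 3"])
  let ?F = "frame ({i, j} \<union> nmods c) (vmods c)"
  fix k s'
  assume k: "k < n" "Inv ({..<k} \<times> {..<n}) s'" "nats s' (i, 0, 0) = k"
    and fr: "frame (insert i (nmods (iter j e c))) (vmods (iter j e c)) s s'"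
  have F: "?F s s''" if "frame (insert j (nmods c)) (vmods c) s' s''" for s''
    by (rule frame_mono[OF frame_trans[OF fr that]]) auto
  have "wp (iter j e c) (n * (\<tau> + 4) + 3) (\<lambda>s'. Inv ({..<k} \<times> {..<n} \<union> {k} \<times> {..<n}) s') s'"
  proof (rule wp_iter[where I = "\<lambda>l. Inv ({..<k} \<times> {..<n} \<union> {k} \<times> {..<l})" and \<tau> = "\<lambda>_. \<tau>"])
    fix s'' assume "frame {j} {} s' s''"
    then have "frame {i, j} {} s' s''" by (rule frame_mono) auto
    then show "Inv ({..<k} \<times> {..<n} \<union> {k} \<times> {..<0}) s''" using resp[OF k(2)] by simp
  next
    fix l s1 s2 assume 1: "Inv ({..<k} \<times> {..<n} \<union> {k} \<times> {..<l}) s1" "frame {j} {} s1 s2"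
    have "frame {i, j} {} s1 s2" using 1(2) by (rule frame_mono) auto
    then show "Inv ({..<k} \<times> {..<n} \<union> {k} \<times> {..<l}) s2" using resp[OF 1(1)] by blast
  next
    fix s1 assume "frame (insert j (nmods c)) (vmods c) s' s1"
    then show "nval e s1 = n" using e F by blast
  next
    fix l s1 assume l: "l < n" "Inv ({..<k} \<times> {..<n} \<union> {k} \<times> {..<l}) s1" "nats s1 (j, 0, 0) = l"
      "frame (insert j (nmods c)) (vmods c) s' s1"
    have i: "nats s1 (i, 0, 0) = k" using l(4) k(3) ij by (simp add: frame_def)
    have "insert (k, l) ({..<k} \<times> {..<n} \<union> {k} \<times> {..<l}) = {..<k} \<times> {..<n} \<union> {k} \<times> {..<Suc l}"
      by auto
    then show "wp c \<tau> (Inv ({..<k} \<times> {..<n} \<union> {k} \<times> {..<Suc l})) s1"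
      using body[of s1 "{..<k} \<times> {..<n} \<union> {k} \<times> {..<l}"] l k(1) i F[OF l(4)] by fastforce
  qed (use ij in \<open>auto simp: algebra_simps\<close>)
  moreover have "{..<k} \<times> {..<n} \<union> {k} \<times> {..<n} = {..<Suc k} \<times> {..<n}" by auto
  ultimately show "wp (iter j e c) (n * (\<tau> + 4) + 3) (Inv ({..<Suc k} \<times> {..<n})) s'" by simp
next
  fix s' assume "frame {i} {} s s'"
  then have "frame {i, j} {} s s'" by (rule frame_mono) auto
  then show "Inv ({..<0} \<times> {..<n}) s'" using Inv0 by simp
next
  fix k s1 s2 assume 1: "Inv ({..<k} \<times> {..<n}) s1" "frame {i} {} s1 s2"
  have "frame {i, j} {} s1 s2" using 1(2) by (rule frame_mono) auto
  then show "Inv ({..<k} \<times> {..<n}) s2" using resp[OF 1(1)] by blast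
qed (use T ij e in \<open>auto simp: algebra_simps insert_commute\<close>)

text \<open>The given program uses names below \<open>b + 10\<close> only; the offset 10 also keeps the working memory
  apart from the names 0 and 1 of the input and the output.\<close>

abbreviation Num :: "name \<Rightarrow> nexp" where "Num b \<equiv> sget (b + 10)"
abbreviation Row :: "name \<Rightarrow> nexp" where "Row b \<equiv> sget (b + 11)"
abbreviation Col :: "name \<Rightarrow> nexp" where "Col b \<equiv> sget (b + 12)"
abbreviation Mid :: "name \<Rightarrow> nexp" where "Mid b \<equiv> sget (b + 13)"
abbreviation Sample :: "name \<Rightarrow> nexp \<Rightarrow> nexp" where "Sample b e \<equiv> NGet (b + 14) e (NConst 0)"
abbreviation Pos :: "name \<Rightarrow> nexp \<Rightarrow> nexp" where "Pos b e \<equiv> NGet (b + 15) e (NConst 0)"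
abbreviation Deg :: "name \<Rightarrow> nexp \<Rightarrow> nexp" where "Deg b e \<equiv> NGet (b + 16) e (NConst 0)"
abbreviation Cand :: "name \<Rightarrow> nexp" where "Cand b \<equiv> sget (b + 17)"
abbreviation Drawn :: "name \<Rightarrow> nexp" where "Drawn b \<equiv> sget (b + 18)"
abbreviation Sources :: "name \<Rightarrow> nexp" where "Sources b \<equiv> sget (b + 19)"
abbreviation Flag :: "name \<Rightarrow> nexp" where "Flag b \<equiv> sget (b + 20)"

abbreviation Arc :: "name \<Rightarrow> nexp \<Rightarrow> nexp \<Rightarrow> bexp" where
  "Arc b e f \<equiv> VLess (VGet (b + 10) e f) VInfty"

abbreviation Kept :: "name \<Rightarrow> nexp \<Rightarrow> bexp" where
  "Kept b e \<equiv> NLess (NAdd (Num b) (Num b)) (Pos b e)"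

definition relax :: "nexp \<Rightarrow> nexp \<Rightarrow> nexp \<Rightarrow> com" where
  "relax x y z = Cond (VLess (VAdd (VGet 1 x y) (VGet 1 y z)) (VGet 1 x z))
     (VSet 1 x z (VAdd (VGet 1 x y) (VGet 1 y z))) Skip"

text \<open>For a deleted row vertex both its row and its column are relaxed. This covers every pair
  with a deleted vertex in either place at linear cost per pivot and deleted vertex.\<close>

definition pivots_kept :: "name \<Rightarrow> com" where
  "pivots_kept b = iter (b + 13) (Num b) (Cond (Kept b (Mid b))
     (iter (b + 11) (Num b) (Cond (Kept b (Row b)) Skip
       (iter (b + 12) (Num b) (Seq (relax (Row b) (Mid b) (Col b)) (relax (Col b) (Mid b) (Row b)))))) Skip)"

definition pivots_deleted :: "name \<Rightarrow> com" where
  "pivots_deleted b = iter (b + 13) (Num b) (Cond (Kept b (Mid b)) Skip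
     (iter (b + 11) (Num b) (iter (b + 12) (Num b) (relax (Row b) (Mid b) (Col b)))))"

definition fill_in :: "name \<Rightarrow> com" where
  "fill_in b = iter (b + 11) (Num b) (iter (b + 12) (Num b)
     (Cond (Conj (Kept b (Row b)) (Kept b (Col b))) Skip
       (Cond (Conj (Neg (NLess (Row b) (Col b))) (Neg (NLess (Col b) (Row b))))
         (VSet 1 (Row b) (Col b) (VConst 0)) (VSet 1 (Row b) (Col b) (VGet (b + 10) (Row b) (Col b))))))"

definition recover :: "name \<Rightarrow> com" where
  "recover b = Seq (fill_in b) (Seq (pivots_kept b) (pivots_deleted b))"

definition extend_sample :: "name \<Rightarrow> com" where
  "extend_sample b = iter (b + 11) (Num b) (NSet (b + 14) (NAdd (Num b) (Row b)) (NConst 0) (Row b))"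

text \<open>\<open>build\<close> overwrites the input cells with the instance for the given program,
  whereas \<open>fill_in\<close> needs the original weights.\<close>

definition copy_weights :: "name \<Rightarrow> com" where
  "copy_weights b = iter (b + 11) (Num b) (iter (b + 12) (Num b)
     (VSet (b + 10) (Row b) (Col b) (VGet 0 (Row b) (Col b))))"

text \<open>The diagonal is not left out, so loops raise the flag as well.\<close>

definition detect :: "name \<Rightarrow> com" where
  "detect b = Seq (sset (b + 20) (NConst 0)) (iter (b + 11) (Num b) (iter (b + 12) (Num b)
     (Cond (Conj (Arc b (Row b) (Col b)) (Arc b (Col b) (Row b))) (sset (b + 20) (NConst 1)) Skip)))"

definition elim_start :: "name \<Rightarrow> com" where
  "elim_start b = Seq (iter (b + 11) (Num b)
       (Seq (NSet (b + 15) (Row b) (NConst 0) (NConst 0)) (NSet (b + 16) (Row b) (NConst 0) (NConst 0))))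
     (Seq (iter (b + 11) (Num b) (iter (b + 12) (Num b) (Cond (Arc b (Row b) (Col b))
       (NSet (b + 16) (Col b) (NConst 0) (NAdd (Deg b (Col b)) (NConst 1))) Skip)))
     (Seq (sset (b + 18) (NConst 0)) (sset (b + 19) (NConst 0))))"

definition find_source :: "name \<Rightarrow> com" where
  "find_source b = Seq (sset (b + 17) (Num b)) (iter (b + 11) (Num b)
     (Cond (Conj (NLess (Pos b (Row b)) (NConst 1)) (NLess (Deg b (Row b)) (NConst 1)))
       (sset (b + 17) (Row b)) Skip))"

text \<open>A candidate equal to \<open>Num\<close> means that there is none. \<open>Drawn\<close>
  is incremented before it is used as a position, because position 0 marks presence. If the sampled
  vertex is already gone, the candidate is reset and \<open>delete_vertex\<close> does
  nothing.\<close>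

definition choose_vertex :: "name \<Rightarrow> com" where
  "choose_vertex b = Cond (NLess (Cand b) (Num b))
     (Seq (NSet (b + 15) (Cand b) (NConst 0) (NAdd (NAdd (NAdd (Num b) (Num b)) (Sources b)) (NConst 1)))
       (sset (b + 19) (NAdd (Sources b) (NConst 1))))
     (Seq (sset (b + 17) (Sample b (Drawn b))) (Seq (sset (b + 18) (NAdd (Drawn b) (NConst 1)))
       (Cond (NLess (Pos b (Cand b)) (NConst 1)) (NSet (b + 15) (Cand b) (NConst 0) (Drawn b))
         (sset (b + 17) (Num b)))))"

definition delete_vertex :: "name \<Rightarrow> com" where
  "delete_vertex b = Cond (NLess (Cand b) (Num b)) (iter (b + 11) (Num b) (Cond (Arc b (Cand b) (Row b))
     (NSet (b + 16) (Row b) (NConst 0) (NSub (Deg b (Row b)) (NConst 1))) Skip)) Skip"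

text \<open>The loop ends when the extended sample is used up, which implies that no vertex is left,
  as every vertex occurs in it.\<close>

definition eliminate :: "name \<Rightarrow> com" where
  "eliminate b = While (NLess (Drawn b) (NAdd (Num b) (Num b)))
     (Seq (find_source b) (Seq (choose_vertex b) (delete_vertex b)))"

definition build :: "name \<Rightarrow> com" where
  "build b = iter (b + 11) (Num b) (iter (b + 12) (Num b)
     (Cond (Conj (NLess (Pos b (Row b)) (Pos b (Col b)))
         (Neg (Conj (Neg (Arc b (Row b) (Col b))) (Neg (Arc b (Col b) (Row b))))))
       (Cond (Kept b (Row b)) (VSet 0 (Row b) (Col b) (VGet (b + 10) (Row b) (Col b)))
         (VSet 0 (Row b) (Col b) (VConst 0)))
       (VSet 0 (Row b) (Col b) VInfty)))"

text \<open>Equal positions are harmless here: \<open>recover\<close> merely asks whether a position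
  exceeds \<open>2 * n\<close>.\<close>

definition delete_all :: "name \<Rightarrow> com" where
  "delete_all b = iter (b + 11) (Num b) (NSet (b + 15) (Row b) (NConst 0) (NConst 1))"

definition draw :: "name \<Rightarrow> com" where
  "draw b = iter (b + 11) (Num b) (Rand (b + 14) (Row b) (NConst 0) (NSub (Num b) (NConst 1)))"

definition apsp_after_draw :: "name \<Rightarrow> com \<Rightarrow> com" where
  "apsp_after_draw b c = Seq (extend_sample b) (Seq (copy_weights b) (Seq (detect b)
     (Seq (Cond (NLess (Flag b) (NConst 1))
         (Seq (elim_start b) (Seq (eliminate b) (Seq (build b) c))) (delete_all b))
       (recover b))))"

definition apsp :: "name \<Rightarrow> com \<Rightarrow> com" where
  "apsp b c = Seq (sset (b + 10) (NGet 0 (NConst 0) (NConst 0))) (Seq (draw b) (apsp_after_draw b c))"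

section \<open>Floyd-Warshall with restricted kept pivots\<close>

subsection \<open>Recovering the deleted vertices\<close>

lemma wp_relax: "2 \<le> T \<Longrightarrow> wp (relax x y z) T Q s =
    Q (s\<lparr>vals := (vals s)((1, nval x s, nval z s) :=
      min (vals s (1, nval x s, nval z s))
        (vals s (1, nval x s, nval y s) + vals s (1, nval y s, nval z s)))\<rparr>)"
proof -
  assume T: "2 \<le> T"
  let ?a = "vals s (1, nval x s, nval z s)"
  let ?b = "vals s (1, nval x s, nval y s) + vals s (1, nval y s, nval z s)"
  show ?thesis
  proof (cases "?b < ?a")
    case True
    then have "min ?a ?b = ?b" by simp
    then show ?thesis using T True by (simp add: relax_def wp_simps)
  next
    case False
    then have "min ?a ?b = ?a" by simp
    then show ?thesis using T False by (simp add: relax_def wp_simps wp_Skip)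
  qed
qed

lemma nmods_relax [simp]: "nmods (relax x y z) = {}" and vmods_relax [simp]: "vmods (relax x y z) = {1}"
  by (simp_all add: relax_def)

locale apsp_prog = wdigraph +
  fixes b :: name
begin

definition matrix :: "(nat \<Rightarrow> nat \<Rightarrow> ereal) \<Rightarrow> state \<Rightarrow> bool" where
  "matrix D s \<longleftrightarrow> (\<forall>u<n. \<forall>v<n. vals s (1, u, v) = D u v)"

definition partly :: "nat \<Rightarrow> (nat \<Rightarrow> nat \<Rightarrow> ereal) \<Rightarrow> (nat \<times> nat) set \<Rightarrow> state \<Rightarrow> bool" where
  "partly k D S s \<longleftrightarrow> matrix (\<lambda>u v. if (u, v) \<in> S then pivot k D u v else D u v) s"

text \<open>The two summands read lie in the column and the row of \<open>k\<close>, where old and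
  new matrix agree by \<open>pivot_row_column\<close>; so it does not matter whether they are in
  \<open>S\<close>.\<close>

lemma wp_relax_partly:
  assumes D: "approx D" "k < n" and "partly k D S s" "nval y s = k" "nval x s < n" "nval z s < n"
  shows "wp (relax x y z) 2 (partly k D (insert (nval x s, nval z s) S)) s"
proof -
  have *: "vals s (1, u, v) = (if (u, v) \<in> S then pivot k D u v else D u v)" if "u < n" "v < n" for u v
    using assms(3) that by (simp add: partly_def matrix_def)
  have "vals s (1, nval x s, k) = D (nval x s) k" "vals s (1, k, nval z s) = D k (nval z s)"
    using * D assms pivot_row_column[OF D] by auto
  moreover have "min (vals s (1, nval x s, nval z s)) (D (nval x s) k + D k (nval z s)) =
      pivot k D (nval x s) (nval z s)"
    using * assms(5,6) by (simp add: pivot_def)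
  ultimately show ?thesis
    using assms(4) * by (simp add: wp_relax partly_def matrix_def)
qed

abbreviation kept :: "state \<Rightarrow> nat \<Rightarrow> bool" where
  "kept s v \<equiv> 2 * n < nats s (b + 15, v, 0)"

definition deleted :: "state \<Rightarrow> nat set" where
  "deleted s = {v. v < n \<and> \<not> kept s v}"

lemma sum_deleted: "(\<Sum>v<n. if kept s v then 0 else x) = card (deleted s) * x" for x :: nat
proof -
  have "(\<Sum>v<n. if kept s v then 0 else x) = (\<Sum>v\<in>deleted s. x)"
    by (rule sum.mono_neutral_cong_right) (auto simp: deleted_def)
  then show ?thesis by simp
qed

lemma wp_pivot_deleted:
  assumes D: "approx D" "k < n" and s: "matrix D s" "nats s (b + 10, 0, 0) = n" "nats s (b + 13, 0, 0) = k"
  shows "wp (iter (b + 11) (Num b) (iter (b + 12) (Num b) (relax (Row b) (Mid b) (Col b))))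
    (n * (n * 6 + 7) + 3) (matrix (pivot k D)) s"
proof -
  have "wp (iter (b + 11) (Num b) (iter (b + 12) (Num b) (relax (Row b) (Mid b) (Col b))))
      (n * (n * 6 + 7) + 3) (partly k D ({..<n} \<times> {..<n})) s"
  proof (rule wp_iter2[where n = n and \<tau> = 2])
    fix S s' assume "nats s' (b + 11, 0, 0) < n" "nats s' (b + 12, 0, 0) < n" "partly k D S s'"
      "frame ({b + 11, b + 12} \<union> nmods (relax (Row b) (Mid b) (Col b))) (vmods (relax (Row b) (Mid b) (Col b))) s s'"
    then show "wp (relax (Row b) (Mid b) (Col b)) 2
        (partly k D (insert (nats s' (b + 11, 0, 0), nats s' (b + 12, 0, 0)) S)) s'"
      using wp_relax_partly[OF D, of S s' "Mid b" "Row b" "Col b"] s by (simp add: frame_def)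
  qed (use s in \<open>auto simp: partly_def matrix_def frame_def\<close>)
  then show ?thesis
    by (rule wp_mono) (auto simp: partly_def matrix_def)
qed

text \<open>Closedness under the kept vertices is inherited from the preceding phase, so only the
  deleted ones remain as pivots, each for all pairs.\<close>

lemma wp_pivots_deleted:
  assumes D: "approx D" "closed_under D {v. v < n \<and> kept s v}"
    and s: "matrix D s" "nats s (b + 10, 0, 0) = n"
  shows "wp (pivots_deleted b) (card (deleted s) * (n * (n * 6 + 7) + 3) + 5 * n + 3) (matrix distance) s"
proof -
  let ?A = "\<lambda>k. {v. v < n \<and> kept s v} \<union> {..<k}"
  define Inv where "Inv k s' \<longleftrightarrow> (\<exists>D. approx D \<and> closed_under D (?A k) \<and> matrix D s')" for k s'
  have "wp (pivots_deleted b) (card (deleted s) * (n * (n * 6 + 7) + 3) + 5 * n + 3) (Inv n) s"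
    unfolding pivots_deleted_def
  proof (rule wp_iter[where \<tau> = "\<lambda>k. 1 + (if kept s k then 0 else n * (n * 6 + 7) + 3)"])
    fix k s'
    assume k: "k < n" "Inv k s'" "nats s' (b + 13, 0, 0) = k"
      and fr: "frame (insert (b + 13) (nmods (Cond (Kept b (Mid b)) Skip
         (iter (b + 11) (Num b) (iter (b + 12) (Num b) (relax (Row b) (Mid b) (Col b)))))))
        (vmods (Cond (Kept b (Mid b)) Skip
         (iter (b + 11) (Num b) (iter (b + 12) (Num b) (relax (Row b) (Mid b) (Col b)))))) s s'"
    then obtain D where D: "approx D" "closed_under D (?A k)" "matrix D s'" by (auto simp: Inv_def)
    have n: "nats s' (b + 10, 0, 0) = n" and P: "kept s' v = kept s v" for v
      using fr s(2) by (simp_all add: frame_def)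
    show "wp (Cond (Kept b (Mid b)) Skip
         (iter (b + 11) (Num b) (iter (b + 12) (Num b) (relax (Row b) (Mid b) (Col b)))))
        (1 + (if kept s k then 0 else n * (n * 6 + 7) + 3)) (Inv (Suc k)) s'"
    proof (cases "kept s k")
      case True
      then have "?A (Suc k) = ?A k" using k(1) by (auto simp: less_Suc_eq)
      then have "Inv (Suc k) s'" using k(2) by (simp add: Inv_def)
      then show ?thesis using True P[of k] k(3) n by (simp add: wp_simps wp_Skip mult_2)
    next
      case False
      have "?A (Suc k) = insert k (?A k)" by auto
      then have "closed_under (pivot k D) (?A (Suc k))"
        using closed_under_pivot[OF D(1) k(1) D(2)] k(1) by auto
      then have "Inv (Suc k) s''" if "matrix (pivot k D) s''" for s''
        using that approx_pivot[OF D(1) k(1)] by (auto simp: Inv_def)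
      then have "wp (iter (b + 11) (Num b) (iter (b + 12) (Num b) (relax (Row b) (Mid b) (Col b))))
          (n * (n * 6 + 7) + 3) (Inv (Suc k)) s'"
        by (rule wp_mono[OF wp_pivot_deleted[OF D(1) k(1) D(3) n k(3)] order_refl])
      then show ?thesis using False P[of k] k(3) n by (simp add: wp_simps mult_2 add.commute[of 3])
    qed
  next
    show "(\<Sum>k<n. 1 + (if kept s k then 0 else n * (n * 6 + 7) + 3)) + n * 4 + 3
        \<le> card (deleted s) * (n * (n * 6 + 7) + 3) + 5 * n + 3"
      unfolding sum.distrib sum_deleted by simp
  qed (use D s in \<open>auto simp: Inv_def frame_def matrix_def\<close>)
  then show ?thesis
  proof (rule wp_mono)
    fix s' assume "Inv n s'"
    then obtain D where D: "approx D" "closed_under D (?A n)" "matrix D s'" by (auto simp: Inv_def)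
    moreover have "?A n = {..<n}" by auto
    ultimately show "matrix distance s'"
      using approx_closed_eq_distance[of D] by (auto simp: matrix_def)
  qed simp
qed

text \<open>A pivot among the kept vertices cannot improve the distance between two kept vertices, so it
  suffices to relax the pairs that involve a deleted vertex.\<close>

lemma wp_pivot_kept:
  assumes D: "approx D" "k < n" and s: "matrix D s" "nats s (b + 10, 0, 0) = n" "nats s (b + 13, 0, 0) = k"
    and tri: "\<And>u v. u < n \<Longrightarrow> v < n \<Longrightarrow> kept s u \<Longrightarrow> kept s v \<Longrightarrow> D u v \<le> D u k + D k v"
  shows "wp (iter (b + 11) (Num b) (Cond (Kept b (Row b)) Skip
       (iter (b + 12) (Num b) (Seq (relax (Row b) (Mid b) (Col b)) (relax (Col b) (Mid b) (Row b))))))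
    (card (deleted s) * (9 * n + 3) + 5 * n + 3) (matrix (pivot k D)) s" (is "wp (iter _ _ ?c) _ _ _")
proof -
  define S where "S i = {(u, v). \<not> kept s u \<and> u < i \<or> \<not> kept s v \<and> v < i}" for i
  have "wp (iter (b + 11) (Num b) ?c) (card (deleted s) * (9 * n + 3) + 5 * n + 3) (partly k D (S n)) s"
  proof (rule wp_iter[where n = n and I = "\<lambda>i. partly k D (S i)"
        and \<tau> = "\<lambda>i. 1 + (if kept s i then 0 else 9 * n + 3)"])
    fix i s'
    assume i: "i < n" "partly k D (S i) s'" "nats s' (b + 11, 0, 0) = i"
      and fr: "frame (insert (b + 11) (nmods ?c)) (vmods ?c) s s'"
    have s': "nats s' (b + 10, 0, 0) = n" "nats s' (b + 13, 0, 0) = k" and P: "kept s' v = kept s v" for v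
      using fr s by (simp_all add: frame_def)
    show "wp ?c (1 + (if kept s i then 0 else 9 * n + 3)) (partly k D (S (Suc i))) s'"
    proof (cases "kept s i")
      case True
      then have "S (Suc i) = S i" by (auto simp: S_def less_Suc_eq)
      then show ?thesis using True P[of i] i s' by (simp add: wp_simps wp_Skip mult_2)
    next
      case False
      define S' where "S' j = S i \<union> {(u, v). u = i \<and> v < j \<or> v = i \<and> u < j}" for j
      have "wp (iter (b + 12) (Num b) (Seq (relax (Row b) (Mid b) (Col b)) (relax (Col b) (Mid b) (Row b))))
          (9 * n + 3) (partly k D (S' n)) s'" (is "wp (iter _ _ ?d) _ _ _")
      proof (rule wp_iter[where n = n and I = "\<lambda>j. partly k D (S' j)" and \<tau> = "\<lambda>_. 5"])
        fix j s1 assume j: "j < n" "partly k D (S' j) s1" "nats s1 (b + 12, 0, 0) = j"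
          and fr: "frame (insert (b + 12) (nmods ?d)) (vmods ?d) s' s1"
        have s1: "nats s1 (b + 13, 0, 0) = k" "nats s1 (b + 11, 0, 0) = i"
          using s' i fr by (simp_all add: frame_def)
        have "wp (relax (Row b) (Mid b) (Col b)) 2 (partly k D (insert (i, j) (S' j))) s1"
          using wp_relax_partly[OF D j(2), of "Mid b" "Row b" "Col b"] s1 j i(1) by simp
        then show "wp ?d 5 (partly k D (S' (Suc j))) s1"
        proof (rule wp_Seq_conseq)
          fix s2 assume s2: "partly k D (insert (i, j) (S' j)) s2"
            "frame (nmods (relax (Row b) (Mid b) (Col b))) (vmods (relax (Row b) (Mid b) (Col b))) s1 s2"
          have "insert (j, i) (insert (i, j) (S' j)) = S' (Suc j)"
            by (auto simp: S'_def less_Suc_eq)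
          then show "wp (relax (Col b) (Mid b) (Row b)) 2 (partly k D (S' (Suc j))) s2"
            using wp_relax_partly[OF D s2(1), of "Mid b" "Col b" "Row b"] s1 j s2(2) i(1)
            by (simp add: frame_def)
        qed simp
      qed (use i s' in \<open>auto simp: partly_def matrix_def frame_def S'_def\<close>)
      moreover have "partly k D (S (Suc i)) s''" if "partly k D (S' n) s''" for s''
      proof -
        have "(u, v) \<in> S' n \<longleftrightarrow> (u, v) \<in> S (Suc i)" if "u < n" "v < n" for u v
          using that False by (auto simp: S_def S'_def less_Suc_eq)
        then show ?thesis using that by (simp add: partly_def matrix_def)
      qed
      ultimately have "wp (iter (b + 12) (Num b) ?d) (9 * n + 3) (partly k D (S (Suc i))) s'"
        by (rule wp_mono[OF _ order_refl])
      then show ?thesis using False P[of i] i(3) s' by (simp add: wp_simps mult_2 add.commute[of 3])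
    qed
  next
    show "(\<Sum>i<n. 1 + (if kept s i then 0 else 9 * n + 3)) + n * 4 + 3
        \<le> card (deleted s) * (9 * n + 3) + 5 * n + 3"
      unfolding sum.distrib sum_deleted by simp
  qed (use s in \<open>auto simp: partly_def matrix_def frame_def S_def\<close>)
  moreover have "pivot k D u v = D u v" if "u < n" "v < n" "(u, v) \<notin> S n" for u v
    using tri[of u v] that by (auto simp: S_def pivot_def min_def)
  then have "matrix (pivot k D) s'" if "partly k D (S n) s'" for s'
    using that by (auto simp: partly_def matrix_def)
  ultimately show ?thesis
    by (rule wp_mono[OF _ order_refl])
qed

definition kept_metric :: "(nat \<Rightarrow> nat \<Rightarrow> ereal) \<Rightarrow> state \<Rightarrow> bool" where
  "kept_metric D s \<longleftrightarrow> (\<forall>u<n. \<forall>k<n. \<forall>v<n. kept s u \<and> kept s k \<and> kept s v \<longrightarrow> D u v \<le> D u k + D k v)"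

text \<open>A kept pivot changes no entry between kept vertices. Hence \<open>kept_metric\<close>
  survives it and justifies skipping these entries at the next kept pivot, too.\<close>

lemma wp_pivots_kept:
  assumes D: "approx D" "kept_metric D s" and s: "matrix D s" "nats s (b + 10, 0, 0) = n"
  shows "wp (pivots_kept b) (n * (card (deleted s) * (9 * n + 3) + 5 * n + 4) + 4 * n + 3)
    (\<lambda>s'. \<exists>D. approx D \<and> closed_under D {v. v < n \<and> kept s v} \<and> matrix D s') s"
proof -
  let ?A = "\<lambda>k. {v. v < k \<and> kept s v}"
  define Inv where
    "Inv k s' \<longleftrightarrow> (\<exists>D. approx D \<and> kept_metric D s \<and> closed_under D (?A k) \<and> matrix D s')" for k s'
  have "wp (pivots_kept b) (n * (card (deleted s) * (9 * n + 3) + 5 * n + 4) + 4 * n + 3) (Inv n) s"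
    unfolding pivots_kept_def
  proof (rule wp_iter[where \<tau> = "\<lambda>_. card (deleted s) * (9 * n + 3) + 5 * n + 4"])
    let ?d = "iter (b + 11) (Num b) (Cond (Kept b (Row b)) Skip
         (iter (b + 12) (Num b) (Seq (relax (Row b) (Mid b) (Col b)) (relax (Col b) (Mid b) (Row b)))))"
    let ?c = "Cond (Kept b (Mid b)) ?d Skip"
    fix k s'
    assume k: "k < n" "Inv k s'" "nats s' (b + 13, 0, 0) = k"
      and fr: "frame (insert (b + 13) (nmods ?c)) (vmods ?c) s s'"
    then obtain D where D: "approx D" "kept_metric D s" "closed_under D (?A k)" "matrix D s'"
      by (auto simp: Inv_def)
    have n: "nats s' (b + 10, 0, 0) = n" and P: "kept s' v = kept s v" for v
      using fr s(2) by (simp_all add: frame_def)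
    then have del: "deleted s' = deleted s" by (simp add: deleted_def)
    show "wp ?c (card (deleted s) * (9 * n + 3) + 5 * n + 4) (Inv (Suc k)) s'"
    proof (cases "kept s k")
      case False
      then have "?A (Suc k) = ?A k" by (auto simp: less_Suc_eq)
      then have "Inv (Suc k) s'" using k(2) by (simp add: Inv_def)
      then show ?thesis using False P[of k] k(3) n by (simp add: wp_simps wp_Skip mult_2)
    next
      case True
      have "?A (Suc k) = insert k (?A k)" using True by (auto simp: less_Suc_eq)
      moreover have "?A k \<subseteq> {..<n}" using k(1) by auto
      ultimately have "closed_under (pivot k D) (?A (Suc k))"
        using closed_under_pivot[OF D(1) k(1) D(3)] by simp
      moreover have "pivot k D u v = D u v" if "u < n" "v < n" "kept s u" "kept s v" for u v
        using that True k(1) D(2) by (simp add: kept_metric_def pivot_def min_def)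
      then have "kept_metric (pivot k D) s" using D(2) by (simp add: kept_metric_def)
      ultimately have Inv: "Inv (Suc k) s''" if "matrix (pivot k D) s''" for s''
        using that approx_pivot[OF D(1) k(1)] by (auto simp: Inv_def)
      have "wp ?d (card (deleted s') * (9 * n + 3) + 5 * n + 3) (matrix (pivot k D)) s'"
        by (rule wp_pivot_kept[OF D(1) k(1) D(4) n k(3)])
          (use D(2) True k(1) P in \<open>auto simp: kept_metric_def\<close>)
      then have "wp ?d (card (deleted s) * (9 * n + 3) + 5 * n + 3) (Inv (Suc k)) s'"
        unfolding del by (rule wp_mono[OF _ order_refl Inv])
      then show ?thesis using True P[of k] k(3) n by (simp add: wp_simps mult_2 add.commute[of 3])
    qed
  qed (use D s in \<open>auto simp: Inv_def frame_def matrix_def closed_under_def algebra_simps\<close>)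
  then show ?thesis by (rule wp_mono) (auto simp: Inv_def)
qed

lemma wp_fill_in:
  assumes s: "nats s (b + 10, 0, 0) = n" "\<And>u v. u < n \<Longrightarrow> v < n \<Longrightarrow> vals s (b + 10, u, v) = weight u v"
  shows "wp (fill_in b) (n * (n * 7 + 7) + 3) (matrix (\<lambda>u v. if kept s u \<and> kept s v then vals s (1, u, v)
     else if u = v then 0 else weight u v)) s"
proof -
  let ?D = "\<lambda>u v. if kept s u \<and> kept s v then vals s (1, u, v) else if u = v then 0 else weight u v"
  define Inv where
    "Inv S = matrix (\<lambda>u v. if (u, v) \<in> S then ?D u v else vals s (1, u, v))" for S
  let ?c = "Cond (Conj (Kept b (Row b)) (Kept b (Col b))) Skip
       (Cond (Conj (Neg (NLess (Row b) (Col b))) (Neg (NLess (Col b) (Row b))))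
         (VSet 1 (Row b) (Col b) (VConst 0)) (VSet 1 (Row b) (Col b) (VGet (b + 10) (Row b) (Col b))))"
  have "wp (fill_in b) (n * (n * 7 + 7) + 3) (Inv ({..<n} \<times> {..<n})) s"
    unfolding fill_in_def
  proof (rule wp_iter2[where n = n and \<tau> = 3])
    fix S s' assume 1: "nats s' (b + 11, 0, 0) < n" "nats s' (b + 12, 0, 0) < n"
      "(nats s' (b + 11, 0, 0), nats s' (b + 12, 0, 0)) \<notin> S" "Inv S s'"
      "frame ({b + 11, b + 12} \<union> nmods ?c) (vmods ?c) s s'"
    moreover from this have "nats s' (b + 10, 0, 0) = n"
      "\<And>u v. u < n \<Longrightarrow> v < n \<Longrightarrow> vals s' (b + 10, u, v) = weight u v" "\<And>v. kept s' v = kept s v"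
      using s by (simp_all add: frame_def)
    ultimately show "wp ?c 3 (Inv (insert (nats s' (b + 11, 0, 0), nats s' (b + 12, 0, 0)) S)) s'"
      by (auto simp: wp_simps wp_Skip Inv_def matrix_def mult_2 zero_ereal_def)
  qed (use s in \<open>auto simp: Inv_def matrix_def frame_def\<close>)
  then show ?thesis by (rule wp_mono) (auto simp: Inv_def matrix_def)
qed

text \<open>The premises on output cells concern kept pairs only; all other entries restart from the
  weights. They hold vacuously after \<open>delete_all\<close>, where the whole computation is plain
  Floyd-Warshall.\<close>

lemma wp_recover:
  assumes s: "nats s (b + 10, 0, 0) = n" "\<And>u v. u < n \<Longrightarrow> v < n \<Longrightarrow> vals s (b + 10, u, v) = weight u v"
    and D: "\<And>u v. u < n \<Longrightarrow> v < n \<Longrightarrow> kept s u \<Longrightarrow> kept s v \<Longrightarrow>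
        distance u v \<le> vals s (1, u, v) \<and> vals s (1, u, v) \<le> weight u v"
      "\<And>u. u < n \<Longrightarrow> kept s u \<Longrightarrow> vals s (1, u, u) = 0"
      "kept_metric (\<lambda>u v. vals s (1, u, v)) s"
    and T: "20 * n\<^sup>2 + 50 * n + 20 + card (deleted s) * (15 * n\<^sup>2 + 10 * n + 3) \<le> T"
  shows "wp (recover b) T (matrix distance) s"
proof -
  let ?D = "\<lambda>u v. if kept s u \<and> kept s v then vals s (1, u, v) else if u = v then 0 else weight u v"
  let ?T1 = "n * (card (deleted s) * (9 * n + 3) + 5 * n + 4) + 4 * n + 3"
  let ?T2 = "card (deleted s) * (n * (n * 6 + 7) + 3) + 5 * n + 3"
  have weight_nonneg': "0 \<le> weight u v" for u v
    using order_trans[OF distance_nonneg distance_le_weight] .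
  have approx: "approx ?D"
    using D(1,2) distance_self distance_le_weight weight_nonneg' by (auto simp: approx_def)
  have metric: "kept_metric ?D s" using D(3) by (simp add: kept_metric_def)
  have "wp (recover b) ((n * (n * 7 + 7) + 3) + 1 + (?T1 + 1 + ?T2)) (matrix distance) s"
    unfolding recover_def
  proof (rule wp_Seq_conseq[OF wp_fill_in[OF s] order_refl])
    fix s1 assume s1: "matrix ?D s1" "frame (nmods (fill_in b)) (vmods (fill_in b)) s s1"
    then have P: "\<And>v. kept s1 v = kept s v" and n: "nats s1 (b + 10, 0, 0) = n"
      using s by (simp_all add: fill_in_def frame_def)
    have del: "deleted s1 = deleted s" using P by (simp add: deleted_def)
    have "kept_metric ?D s1" using metric P by (simp add: kept_metric_def)
    note wp_pivots_kept[OF approx this s1(1) n]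
    then show "wp (Seq (pivots_kept b) (pivots_deleted b)) (?T1 + 1 + ?T2) (matrix distance) s1"
    proof (rule wp_Seq_conseq)
      fix s2 assume "\<exists>D. approx D \<and> closed_under D {v. v < n \<and> kept s1 v} \<and> matrix D s2"
        and fr: "frame (nmods (pivots_kept b)) (vmods (pivots_kept b)) s1 s2"
      then obtain D where D: "approx D" "closed_under D {v. v < n \<and> kept s1 v}" "matrix D s2" by blast
      have P2: "\<And>v. kept s2 v = kept s1 v" and n2: "nats s2 (b + 10, 0, 0) = n"
        using fr n by (simp_all add: pivots_kept_def frame_def)
      have "deleted s2 = deleted s" using P P2 by (simp add: deleted_def)
      then show "wp (pivots_deleted b) ?T2 (matrix distance) s2"
        using wp_pivots_deleted[OF D(1) _ D(3) n2] D(2) P2 by simp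
    qed (simp add: del)
  qed
  then show ?thesis
  proof (rule wp_mono)
    have "(n * (n * 7 + 7) + 3) + 1 + (?T1 + 1 + ?T2) =
        12 * n\<^sup>2 + 20 * n + 11 + card (deleted s) * (15 * n\<^sup>2 + 10 * n + 3)"
      by (simp add: algebra_simps power2_eq_square)
    then show "(n * (n * 7 + 7) + 3) + 1 + (?T1 + 1 + ?T2) \<le> T"
      using T by linarith
  qed
qed

end

lemma (in wdigraph) elim_inv_start:
  assumes "\<And>v. v < n \<Longrightarrow> p v = 0"
  shows "elim_inv n (parcs G) R \<sigma> p 0 0"
  using assms arc_less by (fastforce simp: elim_inv_def)

lemma wp_if_solves:
  assumes "solves_apsp_within c n G w (real T) 1" "input_state n G w s"
  shows "wp c T (output_state n G w) s"
proof -
  obtain k where k: "k \<le> T"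
    "1 \<le> measure_pmf.prob (run k (c, s)) {(c', s'). c' = Skip \<and> output_state n G w s'}"
    using assms by (auto simp: solves_apsp_within_def)
  then have "success c k (output_state n G w) s = 1"
    using success_le_1[of c k "output_state n G w" s] unfolding success_def by linarith
  then show ?thesis using success_imp_wp wp_mono k(1) by blast
qed

section \<open>The elimination loop as a program\<close>

subsection \<open>Elimination\<close>

context apsp_prog
begin

definition stored :: "state \<Rightarrow> bool" where
  "stored s \<longleftrightarrow> nats s (b + 10, 0, 0) = n \<and> (\<forall>u<n. \<forall>v<n. vals s (b + 10, u, v) = weight u v)"

lemma stored_frame: "stored s \<Longrightarrow> frame N V s s' \<Longrightarrow> b + 10 \<notin> N \<Longrightarrow> b + 10 \<notin> V \<Longrightarrow> stored s'"
  by (simp add: stored_def frame_def)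

lemma bval_Arc:
  assumes "stored s" "nval e s < n" "nval f s < n"
  shows "bval (Arc b e f) s \<longleftrightarrow> (nval e s, nval f s) \<in> parcs G"
  using assms by (simp add: stored_def weight_def)

abbreviation pos :: "state \<Rightarrow> nat \<Rightarrow> nat" where
  "pos s \<equiv> \<lambda>v. nats s (b + 15, v, 0)"

abbreviation deg :: "state \<Rightarrow> nat \<Rightarrow> nat" where
  "deg s \<equiv> \<lambda>v. nats s (b + 16, v, 0)"

text \<open>As in Kahn's topological sorting, \<open>deg\<close> holds the size of this set, so that
  each vertex can be tested for being a source in constant time.\<close>

definition present_preds :: "(nat \<Rightarrow> nat) \<Rightarrow> nat \<Rightarrow> nat set" where
  "present_preds p v = {u. u < n \<and> p u = 0 \<and> (u, v) \<in> parcs G}"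

lemma finite_present_preds: "finite (present_preds p v)"
  by (simp add: present_preds_def)

lemma present_preds_upd:
  assumes "x < n" "p x = 0" "y \<noteq> 0"
  shows "card (present_preds (p(x := y)) v) =
    (if (x, v) \<in> parcs G then card (present_preds p v) - 1 else card (present_preds p v))"
proof -
  have "present_preds (p(x := y)) v = present_preds p v - {x}"
    using assms by (auto simp: present_preds_def)
  moreover have "x \<in> present_preds p v \<longleftrightarrow> (x, v) \<in> parcs G"
    using assms by (auto simp: present_preds_def)
  ultimately show ?thesis by (simp add: finite_present_preds)
qed

lemma wp_extend_sample:
  assumes "nats s (b + 10, 0, 0) = n"
  shows "wp (extend_sample b) (5 * n + 3) (\<lambda>s'. \<forall>i<2 * n. nats s' (b + 14, i, 0) =
    (if i < n then nats s (b + 14, i, 0) else i - n)) s"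
proof -
  define Inv where "Inv k s' \<longleftrightarrow> (\<forall>i<n. nats s' (b + 14, i, 0) = nats s (b + 14, i, 0)) \<and>
    (\<forall>i<k. nats s' (b + 14, n + i, 0) = i)" for k :: nat and s' :: state
  have "wp (extend_sample b) (5 * n + 3) (Inv n) s"
    unfolding extend_sample_def
    by (rule wp_iter[where \<tau> = "\<lambda>_. 1"])
      (use assms in \<open>auto simp: wp_simps Inv_def frame_def less_Suc_eq\<close>)
  then show ?thesis
  proof (rule wp_mono)
    fix s' assume "Inv n s'"
    then have "nats s' (b + 14, i, 0) = i - n" if "n \<le> i" "i < 2 * n" for i
      using that le_Suc_ex[OF that(1)] by (auto simp: Inv_def)
    then show "\<forall>i<2 * n. nats s' (b + 14, i, 0) = (if i < n then nats s (b + 14, i, 0) else i - n)"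
      using \<open>Inv n s'\<close> by (auto simp: Inv_def)
  qed simp
qed

lemma wp_copy_weights:
  assumes "nats s (b + 10, 0, 0) = n" "\<And>u v. u < n \<Longrightarrow> v < n \<Longrightarrow> vals s (0, u, v) = weight u v"
  shows "wp (copy_weights b) (n * (n * 5 + 7) + 3) stored s"
proof -
  define Inv where "Inv S s' \<longleftrightarrow> (\<forall>(u, v)\<in>S. vals s' (b + 10, u, v) = weight u v)" for S and s' :: state
  have "wp (copy_weights b) (n * (n * 5 + 7) + 3) (Inv ({..<n} \<times> {..<n})) s"
    unfolding copy_weights_def
    by (rule wp_iter2[where \<tau> = 1 and n = n])
      (use assms in \<open>auto simp: wp_simps Inv_def frame_def\<close>)
  then show ?thesis
    by (rule wp_conseq) (use assms(1) in \<open>auto simp: Inv_def stored_def copy_weights_def frame_def\<close>)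
qed

lemma wp_detect:
  assumes "stored s"
  shows "wp (detect b) (n * (n * 6 + 7) + 5)
    (\<lambda>s'. nats s' (b + 20, 0, 0) = 0 \<longleftrightarrow> (\<forall>u v. (u, v) \<in> parcs G \<longrightarrow> (v, u) \<notin> parcs G)) s"
proof -
  define Inv where "Inv S s' \<longleftrightarrow> (nats s' (b + 20, 0, 0) = 0 \<longleftrightarrow>
    (\<forall>(u, v)\<in>S. (u, v) \<in> parcs G \<longrightarrow> (v, u) \<notin> parcs G))" for S and s' :: state
  let ?s = "s\<lparr>nats := (nats s)((b + 20, 0, 0) := 0)\<rparr>"
  let ?c = "Cond (Conj (Arc b (Row b) (Col b)) (Arc b (Col b) (Row b))) (sset (b + 20) (NConst 1)) Skip"
  have s: "stored ?s" using assms by (simp add: stored_def)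
  have "wp (iter (b + 11) (Num b) (iter (b + 12) (Num b) ?c)) (n * (n * 6 + 7) + 3) (Inv ({..<n} \<times> {..<n})) ?s"
  proof (rule wp_iter2[where \<tau> = 2 and n = n])
    fix S s' assume 1: "nats s' (b + 11, 0, 0) < n" "nats s' (b + 12, 0, 0) < n" "Inv S s'"
      and "frame ({b + 11, b + 12} \<union> nmods ?c) (vmods ?c) ?s s'"
    then have "stored s'" using s by (auto intro: stored_frame)
    then show "wp ?c 2 (Inv (insert (nats s' (b + 11, 0, 0), nats s' (b + 12, 0, 0)) S)) s'"
      using 1 bval_Arc[of s' "Row b" "Col b"] bval_Arc[of s' "Col b" "Row b"]
      by (auto simp: wp_simps wp_Skip Inv_def simp del: bval.simps(2))
  qed (use s in \<open>auto simp: Inv_def stored_def frame_def\<close>)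
  then have "wp (detect b) (n * (n * 6 + 7) + 5) (Inv ({..<n} \<times> {..<n})) s"
    by (simp add: detect_def wp_Seq_simps add.commute[of 3])
  then show ?thesis
    by (rule wp_mono) (use arc_less in \<open>auto simp: Inv_def\<close>)
qed

lemma wp_elim_start:
  assumes "stored s"
  shows "wp (elim_start b) (n * (n * 6 + 7) + 7 * n + 11)
    (\<lambda>s'. (\<forall>v<n. pos s' v = 0 \<and> deg s' v = card (present_preds (pos s') v)) \<and>
       nats s' (b + 18, 0, 0) = 0 \<and> nats s' (b + 19, 0, 0) = 0) s"
proof -
  let ?init = "iter (b + 11) (Num b)
       (Seq (NSet (b + 15) (Row b) (NConst 0) (NConst 0)) (NSet (b + 16) (Row b) (NConst 0) (NConst 0)))"
  let ?c = "Cond (Arc b (Row b) (Col b))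
       (NSet (b + 16) (Col b) (NConst 0) (NAdd (Deg b (Col b)) (NConst 1))) Skip"
  let ?cs = "iter (b + 11) (Num b) (iter (b + 12) (Num b) ?c)"
  let ?set = "Seq (sset (b + 18) (NConst 0)) (sset (b + 19) (NConst 0))"
  have "wp ?init (7 * n + 3) (\<lambda>s'. \<forall>v<n. pos s' v = 0 \<and> deg s' v = 0) s"
    by (rule wp_iter[where \<tau> = "\<lambda>_. 3" and I = "\<lambda>k s'. \<forall>v<k. pos s' v = 0 \<and> deg s' v = 0"])
      (use assms in \<open>auto simp: wp_simps wp_Seq_simps frame_def less_Suc_eq stored_def\<close>)
  then show ?thesis
    unfolding elim_start_def
  proof (rule wp_Seq_conseq)
    fix s1 :: state assume s1: "\<forall>v<n. pos s1 v = 0 \<and> deg s1 v = 0" "frame (nmods ?init) (vmods ?init) s s1"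
    have st: "stored s1" by (rule stored_frame[OF assms s1(2)]) auto
    define cnt where "cnt S v = card {u. (u, v) \<in> S \<and> (u, v) \<in> parcs G}" for S v
    define Inv where "Inv S s' \<longleftrightarrow> (\<forall>v<n. deg s' v = cnt S v)" for S and s' :: state
    have "wp ?cs (n * (n * 6 + 7) + 3) (Inv ({..<n} \<times> {..<n})) s1"
    proof (rule wp_iter2[where \<tau> = 2 and n = n])
      fix S s' assume 1: "nats s' (b + 11, 0, 0) < n" "nats s' (b + 12, 0, 0) < n" "Inv S s'"
        and S: "S \<subseteq> {..<n} \<times> {..<n}" "(nats s' (b + 11, 0, 0), nats s' (b + 12, 0, 0)) \<notin> S"
        and "frame ({b + 11, b + 12} \<union> nmods ?c) (vmods ?c) s1 s'"
      then have st': "stored s'" using st by (auto intro: stored_frame)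
      let ?i = "nats s' (b + 11, 0, 0)" and ?j = "nats s' (b + 12, 0, 0)"
      have eq: "{u. (u, v) \<in> insert (?i, ?j) S \<and> (u, v) \<in> parcs G} =
        (if v = ?j \<and> (?i, ?j) \<in> parcs G then insert ?i {u. (u, v) \<in> S \<and> (u, v) \<in> parcs G}
         else {u. (u, v) \<in> S \<and> (u, v) \<in> parcs G})" for v by auto
      have fin: "finite {u. (u, v) \<in> S \<and> (u, v) \<in> parcs G}" for v
        by (rule finite_subset[of _ "{..<n}"]) (use S(1) in auto)
      have cnt: "cnt (insert (?i, ?j) S) v = (if v = ?j \<and> (?i, ?j) \<in> parcs G then Suc (cnt S v) else cnt S v)" for v
        unfolding cnt_def eq using fin S(2) by auto
      have "bval (Arc b (Row b) (Col b)) s' \<longleftrightarrow> (?i, ?j) \<in> parcs G"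
        using bval_Arc[OF st', of "Row b" "Col b"] 1 by simp
      then show "wp ?c 2 (Inv (insert (?i, ?j) S)) s'"
        using 1 by (auto simp: wp_simps wp_Skip Inv_def cnt simp del: bval.simps(2))
    next
      fix s' assume "frame {b + 11, b + 12} {} s1 s'"
      then show "Inv {} s'" using s1(1) by (simp add: Inv_def cnt_def frame_def)
    qed (use st in \<open>auto simp: Inv_def stored_def frame_def\<close>)
    then show "wp (Seq ?cs ?set) ((n * (n * 6 + 7) + 3) + 1 + 3) (\<lambda>s'.
       (\<forall>v<n. pos s' v = 0 \<and> deg s' v = card (present_preds (pos s') v)) \<and>
       nats s' (b + 18, 0, 0) = 0 \<and> nats s' (b + 19, 0, 0) = 0) s1"
    proof (rule wp_Seq_conseq[OF _ order_refl])
      fix s2 :: state assume s2: "Inv ({..<n} \<times> {..<n}) s2" "frame (nmods ?cs) (vmods ?cs) s1 s2"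
      have pos0: "pos s2 v = 0" if "v < n" for v using s1(1) s2(2) that by (simp add: frame_def)
      have *: "deg s2 v = card (present_preds (pos s2) v)" if "v < n" for v
      proof -
        have "present_preds (pos s2) v = {u. (u, v) \<in> {..<n} \<times> {..<n} \<and> (u, v) \<in> parcs G}"
          using that pos0 unfolding present_preds_def by blast
        then show ?thesis using s2(1) that by (simp add: Inv_def cnt_def)
      qed
      have "wp ?set 3 (\<lambda>s'. nats s' (b + 18, 0, 0) = 0 \<and> nats s' (b + 19, 0, 0) = 0) s2"
        by (simp add: wp_simps wp_Seq_simps)
      then show "wp ?set 3 (\<lambda>s'.
         (\<forall>v<n. pos s' v = 0 \<and> deg s' v = card (present_preds (pos s') v)) \<and>
         nats s' (b + 18, 0, 0) = 0 \<and> nats s' (b + 19, 0, 0) = 0) s2"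
      proof (rule wp_conseq[OF _ order_refl])
        fix s3 :: state
        assume s3: "nats s3 (b + 18, 0, 0) = 0 \<and> nats s3 (b + 19, 0, 0) = 0"
          "frame (nmods ?set) (vmods ?set) s2 s3"
        then have eq: "pos s3 v = pos s2 v" "deg s3 v = deg s2 v" for v by (simp_all add: frame_def)
        then have "present_preds (pos s3) = present_preds (pos s2)" by simp
        then show "(\<forall>v<n. pos s3 v = 0 \<and> deg s3 v = card (present_preds (pos s3) v)) \<and>
           nats s3 (b + 18, 0, 0) = 0 \<and> nats s3 (b + 19, 0, 0) = 0"
          using s3(1) * pos0 eq by simp
      qed
    qed
  qed (simp add: algebra_simps)
qed

abbreviation source :: "state \<Rightarrow> nat \<Rightarrow> bool" where
  "source s v \<equiv> pos s v = 0 \<and> deg s v = 0"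

lemma wp_find_source:
  assumes "nats s (b + 10, 0, 0) = n"
  shows "wp (find_source b) (6 * n + 5) (\<lambda>s'.
    nats s' (b + 17, 0, 0) = n \<and> (\<forall>v<n. \<not> source s' v) \<or>
    nats s' (b + 17, 0, 0) < n \<and> source s' (nats s' (b + 17, 0, 0))) s"
proof -
  let ?s = "s\<lparr>nats := (nats s)((b + 17, 0, 0) := n)\<rparr>"
  let ?c = "Cond (Conj (NLess (Pos b (Row b)) (NConst 1)) (NLess (Deg b (Row b)) (NConst 1)))
       (sset (b + 17) (Row b)) Skip"
  define Inv where "Inv k s' \<longleftrightarrow> nats s' (b + 17, 0, 0) = n \<and> (\<forall>v<k. \<not> source s' v) \<or>
    nats s' (b + 17, 0, 0) < n \<and> source s' (nats s' (b + 17, 0, 0))" for k :: nat and s' :: state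
  have "wp (iter (b + 11) (Num b) ?c) (6 * n + 3) (Inv n) ?s"
    by (rule wp_iter[where \<tau> = "\<lambda>_. 2"])
      (use assms in \<open>auto simp: Inv_def frame_def wp_simps wp_Skip less_Suc_eq\<close>)
  then have "wp (find_source b) (6 * n + 5) (Inv n) s"
    by (simp add: find_source_def wp_Seq_simps assms add.commute[of 3])
  then show ?thesis by (rule wp_mono) (auto simp: Inv_def)
qed

lemma wp_delete_vertex:
  assumes "stored s"
  shows "wp (delete_vertex b) (6 * n + 4) (\<lambda>s'. \<forall>v<n. deg s' v =
    (if nats s (b + 17, 0, 0) < n \<and> (nats s (b + 17, 0, 0), v) \<in> parcs G then deg s v - 1 else deg s v)) s"
proof (cases "nats s (b + 17, 0, 0) < n")
  case True
  let ?x = "nats s (b + 17, 0, 0)"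
  let ?c = "Cond (Arc b (Cand b) (Row b))
     (NSet (b + 16) (Row b) (NConst 0) (NSub (Deg b (Row b)) (NConst 1))) Skip"
  define Inv where "Inv k s' \<longleftrightarrow>
    (\<forall>v<n. deg s' v = (if v < k \<and> (?x, v) \<in> parcs G then deg s v - 1 else deg s v))" for k :: nat and s' :: state
  have "wp (iter (b + 11) (Num b) ?c) (6 * n + 3) (Inv n) s"
  proof (rule wp_iter[where \<tau> = "\<lambda>_. 2"])
    fix k s' assume k: "k < n" "Inv k s'" "nats s' (b + 11, 0, 0) = k"
      and fr: "frame (insert (b + 11) (nmods ?c)) (vmods ?c) s s'"
    have st: "stored s'" by (rule stored_frame[OF assms fr]) auto
    have "nats s' (b + 17, 0, 0) = ?x" using fr by (simp add: frame_def)
    then have "bval (Arc b (Cand b) (Row b)) s' \<longleftrightarrow> (?x, k) \<in> parcs G"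
      using bval_Arc[OF st, of "Cand b" "Row b"] k True by simp
    then show "wp ?c 2 (Inv (Suc k)) s'"
      using k by (auto simp: wp_simps wp_Skip Inv_def less_Suc_eq simp del: bval.simps(2))
  qed (use assms in \<open>auto simp: Inv_def frame_def stored_def\<close>)
  then have "wp (delete_vertex b) (6 * n + 4) (Inv n) s"
    using True assms by (simp add: delete_vertex_def wp_simps stored_def add.commute[of 3])
  then show ?thesis by (rule wp_mono) (use True in \<open>auto simp: Inv_def\<close>)
qed (use assms in \<open>simp add: delete_vertex_def wp_simps wp_Skip stored_def\<close>)

definition elim_state :: "(nat \<Rightarrow> nat) \<Rightarrow> nat \<Rightarrow> state \<Rightarrow> bool" where
  "elim_state R \<sigma> s \<longleftrightarrow> stored s \<and> (\<forall>i<2 * n. nats s (b + 14, i, 0) = R i) \<and>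
     elim_inv n (parcs G) R \<sigma> (pos s) (nats s (b + 18, 0, 0)) (nats s (b + 19, 0, 0)) \<and>
     (\<forall>v<n. deg s v = card (present_preds (pos s) v))"

text \<open>A round eliminates a source or consumes a sample entry. This gives at most
  \<open>3 * n\<close> rounds, each linear because of the search for a source.\<close>

definition elim_measure :: "state \<Rightarrow> nat" where
  "elim_measure s = (2 * n - nats s (b + 18, 0, 0)) + card {v. v < n \<and> pos s v = 0}"

lemma no_source_iff: "deg s v = card (present_preds (pos s) v) \<Longrightarrow>
    deg s v = 0 \<longleftrightarrow> (\<forall>u<n. (u, v) \<in> parcs G \<longrightarrow> pos s u \<noteq> 0)"
  using finite_present_preds[of "pos s" v] by (auto simp: present_preds_def)

lemma present_pred:
  assumes "card (present_preds p v) \<noteq> 0"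
  shows "\<exists>u<n. p u = 0 \<and> (u, v) \<in> parcs G"
proof -
  have "present_preds p v \<noteq> {}" using assms by auto
  then obtain u where "u \<in> present_preds p v" by blast
  then have "u < n \<and> p u = 0 \<and> (u, v) \<in> parcs G" by (simp add: present_preds_def)
  then show ?thesis by (rule exI)
qed

text \<open>The degrees are out of date until \<open>delete_vertex\<close> has run. The last
  conjunct records the one vertex whose position has changed, which is what their correction
  requires.\<close>

lemma wp_choose_vertex:
  assumes s: "elim_state R \<sigma> s" "nats s (b + 18, 0, 0) < 2 * n"
    and R: "\<And>i. i < 2 * n \<Longrightarrow> R i < n"
    and hit: "\<And>C. C \<in> dicycles G \<Longrightarrow> \<exists>i<\<sigma>. R i \<in> dicycle_verts C"
    and x: "nats s (b + 17, 0, 0) = n \<and> (\<forall>v<n. \<not> source s v) \<or>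
      nats s (b + 17, 0, 0) < n \<and> source s (nats s (b + 17, 0, 0))"
  shows "wp (choose_vertex b) 8 (\<lambda>s'.
    elim_inv n (parcs G) R \<sigma> (pos s') (nats s' (b + 18, 0, 0)) (nats s' (b + 19, 0, 0)) \<and>
    elim_measure s' < elim_measure s \<and>
    (if nats s' (b + 17, 0, 0) < n
     then pos s (nats s' (b + 17, 0, 0)) = 0 \<and>
       (\<exists>y. y \<noteq> 0 \<and> pos s' = (pos s)(nats s' (b + 17, 0, 0) := y))
     else pos s' = pos s)) s"
proof -
  let ?q = "nats s (b + 18, 0, 0)" and ?c = "nats s (b + 19, 0, 0)" and ?x = "nats s (b + 17, 0, 0)"
  have inv: "elim_inv n (parcs G) R \<sigma> (pos s) ?q ?c" and n: "nats s (b + 10, 0, 0) = n"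
    and Rq: "nats s (b + 14, ?q, 0) = R ?q" "R ?q < n"
    and deg: "\<And>v. v < n \<Longrightarrow> deg s v = card (present_preds (pos s) v)"
    using s R by (auto simp: elim_state_def stored_def)
  have pos_upd: "(\<lambda>v. if v = x then y else pos s v) = (pos s)(x := y)" for x y by auto
  have less: "card {v. v < n \<and> ((pos s)(x := y)) v = 0} < card {v. v < n \<and> pos s v = 0}"
    if "x < n" "pos s x = 0" "y \<noteq> 0" for x y
    by (rule psubset_card_mono) (use that in auto)
  from x show ?thesis
  proof
    assume x: "?x < n \<and> source s ?x"
    have "elim_inv n (parcs G) R \<sigma> ((pos s)(?x := Suc (2 * n + ?c))) ?q (Suc ?c)"
    proof (rule elim_inv_source[OF inv])
      have "deg s ?x = card (present_preds (pos s) ?x)" using deg x by blast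
      then show "pos s u \<noteq> 0" if "(u, ?x) \<in> parcs G" for u
        using no_source_iff[of s ?x] x arc_less[OF that] that by simp
    qed (use x arc_less in auto)
    then show ?thesis
      using x n less[of ?x "Suc (2 * n + ?c)"]
      by (simp add: choose_vertex_def wp_simps wp_Seq_simps pos_upd elim_measure_def mult_2)
        (rule exI[of _ "Suc (n + n + nats s (b + 19, 0, 0))"], rule conjI[OF zero_less_Suc refl])
  next
    assume x: "?x = n \<and> (\<forall>v<n. \<not> source s v)"
    \<comment> \<open>The only place where the sample meeting all cycles is used: a vertex is
      deleted only when no source exists, and then fewer than \<sigma> entries have been
      consumed.\<close>
    have q\<sigma>: "?q < \<sigma>" if "pos s (R ?q) = 0"
    proof (rule elim_stuck[where p = "pos s" and r = "R ?q", OF inv])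
      show "\<exists>i<\<sigma>. R i \<in> dicycle_verts C" if "C \<in> dicycles G" for C using hit[OF that] .
      show "R ?q < n" "pos s (R ?q) = 0" using Rq(2) that by simp_all
    next
      fix v assume v: "v < n" "pos s v = 0"
      have "deg s v \<noteq> 0" using conjunct2[OF x, rule_format, OF v(1)] v(2) by simp
      then have "card (present_preds (pos s) v) \<noteq> 0" using deg[OF v(1)] by simp
      then show "\<exists>u<n. pos s u = 0 \<and> (u, v) \<in> parcs G" by (rule present_pred)
    qed
    have inv': "elim_inv n (parcs G) R \<sigma>
        (if pos s (R ?q) = 0 then (pos s)(R ?q := Suc ?q) else pos s) (Suc ?q) ?c"
      by (rule elim_inv_sample[where p = "pos s", OF inv s(2)]) (rule q\<sigma>)
    show ?thesis
    proof (cases "pos s (R ?q) = 0")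
      case True
      define st where "st = s\<lparr>nats := (nats s)((b + 17, 0, 0) := R ?q, (b + 18, 0, 0) := Suc ?q,
        (b + 15, R ?q, 0) := Suc ?q)\<rparr>"
      have "wp (choose_vertex b) 8 ((=) st) s"
        using x n Rq True by (simp add: choose_vertex_def wp_simps wp_Seq_simps st_def)
      then show ?thesis
      proof (rule wp_mono[OF _ order_refl])
        fix s' assume "st = s'"
        have pos: "nats st (b + 15, v, 0) = ((pos s)(R ?q := Suc ?q)) v" for v
          by (simp add: st_def)
        have st: "nats st (b + 17, 0, 0) = R ?q" "nats st (b + 18, 0, 0) = Suc ?q" "nats st (b + 19, 0, 0) = ?c"
          by (simp_all add: st_def)
        have "elim_measure st < elim_measure s"
          using less[OF Rq(2) True, of "Suc ?q"] s(2)
          unfolding elim_measure_def pos st by linarith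
        moreover have "elim_inv n (parcs G) R \<sigma> ((pos s)(R ?q := Suc ?q)) (Suc ?q) ?c"
          using inv' True by simp
        moreover have "\<exists>y. y \<noteq> 0 \<and> (pos s)(R ?q := Suc ?q) = (pos s)(R ?q := y)" by blast
        ultimately show "elim_inv n (parcs G) R \<sigma> (pos s') (nats s' (b + 18, 0, 0)) (nats s' (b + 19, 0, 0)) \<and>
          elim_measure s' < elim_measure s \<and>
          (if nats s' (b + 17, 0, 0) < n
           then pos s (nats s' (b + 17, 0, 0)) = 0 \<and>
             (\<exists>y. y \<noteq> 0 \<and> pos s' = (pos s)(nats s' (b + 17, 0, 0) := y))
           else pos s' = pos s)"
          unfolding \<open>st = s'\<close>[symmetric] pos st if_P[OF Rq(2)] using True by blast
      qed
    next
      case False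
      define st where "st = s\<lparr>nats := (nats s)((b + 17, 0, 0) := R ?q, (b + 18, 0, 0) := Suc ?q,
        (b + 17, 0, 0) := n)\<rparr>"
      have "wp (choose_vertex b) 8 ((=) st) s"
        using x n Rq False by (simp add: choose_vertex_def wp_simps wp_Seq_simps st_def)
      then show ?thesis
      proof (rule wp_mono[OF _ order_refl])
        fix s' assume "st = s'"
        have pos: "nats st (b + 15, v, 0) = pos s v" for v
          by (simp add: st_def)
        have st: "nats st (b + 17, 0, 0) = n" "nats st (b + 18, 0, 0) = Suc ?q" "nats st (b + 19, 0, 0) = ?c"
          by (simp_all add: st_def)
        have "elim_measure st < elim_measure s"
          using s(2) unfolding elim_measure_def pos st by linarith
        moreover have "elim_inv n (parcs G) R \<sigma> (pos s) (Suc ?q) ?c"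
          using inv' False by simp
        ultimately show "elim_inv n (parcs G) R \<sigma> (pos s') (nats s' (b + 18, 0, 0)) (nats s' (b + 19, 0, 0)) \<and>
          elim_measure s' < elim_measure s \<and>
          (if nats s' (b + 17, 0, 0) < n
           then pos s (nats s' (b + 17, 0, 0)) = 0 \<and>
             (\<exists>y. y \<noteq> 0 \<and> pos s' = (pos s)(nats s' (b + 17, 0, 0) := y))
           else pos s' = pos s)"
          unfolding \<open>st = s'\<close>[symmetric] pos st by simp
      qed
    qed
  qed
qed

lemma wp_eliminate:
  assumes s: "elim_state R \<sigma> s" "nats s (b + 18, 0, 0) = 0"
    and R: "\<And>i. i < 2 * n \<Longrightarrow> R i < n" "\<And>v. v < n \<Longrightarrow> \<exists>i<2 * n. R i = v"
    and hit: "\<And>C. C \<in> dicycles G \<Longrightarrow> \<exists>i<\<sigma>. R i \<in> dicycle_verts C"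
  shows "wp (eliminate b) (3 * n * (12 * n + 21) + 1)
    (\<lambda>s'. elim_state R \<sigma> s' \<and> (\<forall>v<n. pos s' v \<noteq> 0)) s"
  unfolding eliminate_def
proof (rule wp_mono[OF wp_While_frame[where I = "elim_state R \<sigma>" and M = elim_measure and m = "3 * n"
      and T = "12 * n + 19" and Q = "\<lambda>s'. elim_state R \<sigma> s' \<and> (\<forall>v<n. pos s' v \<noteq> 0)"]])
  show "elim_measure s \<le> 3 * n"
    using card_mono[of "{..<n}" "{v. v < n \<and> pos s v = 0}"] by (fastforce simp: elim_measure_def)
next
  fix s1 :: state assume s1: "elim_state R \<sigma> s1" "bval (NLess (Drawn b) (NAdd (Num b) (Num b))) s1"
  then have n: "nats s1 (b + 10, 0, 0) = n" by (simp add: elim_state_def stored_def)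
  let ?T = "12 * n + 19"
  show "wp (Seq (find_source b) (Seq (choose_vertex b) (delete_vertex b))) ?T
      (\<lambda>s'. elim_state R \<sigma> s' \<and> elim_measure s' < elim_measure s1) s1"
  proof (rule wp_Seq_conseq[OF wp_find_source[OF n]])
    fix s2 :: state assume x: "nats s2 (b + 17, 0, 0) = n \<and> (\<forall>v<n. \<not> source s2 v) \<or>
        nats s2 (b + 17, 0, 0) < n \<and> source s2 (nats s2 (b + 17, 0, 0))"
      and fr: "frame (nmods (find_source b)) (vmods (find_source b)) s1 s2"
    have s2: "elim_state R \<sigma> s2" and q: "nats s2 (b + 18, 0, 0) < 2 * n"
      and m: "elim_measure s2 = elim_measure s1"
      using s1 fr n by (simp_all add: elim_state_def stored_def frame_def find_source_def elim_measure_def mult_2)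
    have "wp (choose_vertex b) 8 (\<lambda>s'.
      elim_inv n (parcs G) R \<sigma> (pos s') (nats s' (b + 18, 0, 0)) (nats s' (b + 19, 0, 0)) \<and>
      elim_measure s' < elim_measure s2 \<and>
      (if nats s' (b + 17, 0, 0) < n
       then pos s2 (nats s' (b + 17, 0, 0)) = 0 \<and>
         (\<exists>y. y \<noteq> 0 \<and> pos s' = (pos s2)(nats s' (b + 17, 0, 0) := y))
       else pos s' = pos s2)) s2"
      by (rule wp_choose_vertex[OF s2 q _ _ x]) (fact R(1) hit)+
    then show "wp (Seq (choose_vertex b) (delete_vertex b)) (8 + 1 + (6 * n + 4))
        (\<lambda>s'. elim_state R \<sigma> s' \<and> elim_measure s' < elim_measure s1) s2"
    proof (rule wp_Seq_conseq[OF _ order_refl])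
      fix s3 :: state
      let ?x = "nats s3 (b + 17, 0, 0)"
      assume s3: "elim_inv n (parcs G) R \<sigma> (pos s3) (nats s3 (b + 18, 0, 0)) (nats s3 (b + 19, 0, 0)) \<and>
        elim_measure s3 < elim_measure s2 \<and>
        (if ?x < n then pos s2 ?x = 0 \<and> (\<exists>y. y \<noteq> 0 \<and> pos s3 = (pos s2)(?x := y)) else pos s3 = pos s2)"
        and fr: "frame (nmods (choose_vertex b)) (vmods (choose_vertex b)) s2 s3"
      have st: "stored s3"
        by (rule stored_frame[OF _ fr]) (use s2 in \<open>auto simp: elim_state_def choose_vertex_def\<close>)
      have R3: "\<forall>i<2 * n. nats s3 (b + 14, i, 0) = R i" and "\<And>v. deg s3 v = deg s2 v"
        using fr s2 by (simp_all add: frame_def elim_state_def choose_vertex_def)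
      then have deg: "\<And>v. v < n \<Longrightarrow> deg s3 v = card (present_preds (pos s2) v)"
        using s2 by (simp add: elim_state_def)
      have deg': "card (present_preds (pos s3) v) =
          (if ?x < n \<and> (?x, v) \<in> parcs G then deg s3 v - 1 else deg s3 v)" if "v < n" for v
      proof (cases "?x < n")
        case True
        then obtain y where y: "y \<noteq> 0" "pos s3 = (pos s2)(?x := y)" "pos s2 ?x = 0" using s3 by auto
        show ?thesis
          using present_preds_upd[of ?x "pos s2" y v, OF True y(3) y(1)] True deg[OF that] unfolding y(2) by simp
      next
        case False
        then have "pos s3 = pos s2" using s3 by simp
        then show ?thesis using False deg[OF that] by simp
      qed
      show "wp (delete_vertex b) (6 * n + 4)
          (\<lambda>s'. elim_state R \<sigma> s' \<and> elim_measure s' < elim_measure s1) s3"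
      proof (rule wp_conseq[OF wp_delete_vertex[OF st] order_refl])
        fix s4 :: state assume s4: "\<forall>v<n. deg s4 v = (if ?x < n \<and> (?x, v) \<in> parcs G then deg s3 v - 1 else deg s3 v)"
          and fr: "frame (nmods (delete_vertex b)) (vmods (delete_vertex b)) s3 s4"
        have "stored s4" by (rule stored_frame[OF st fr]) (auto simp: delete_vertex_def)
        moreover have eq: "pos s4 v = pos s3 v" "nats s4 (b + 18, 0, 0) = nats s3 (b + 18, 0, 0)"
          "nats s4 (b + 19, 0, 0) = nats s3 (b + 19, 0, 0)" "nats s4 (b + 14, v, 0) = nats s3 (b + 14, v, 0)" for v
          using fr by (simp_all add: frame_def delete_vertex_def)
        moreover have "elim_measure s4 = elim_measure s3" by (simp add: elim_measure_def eq)
        moreover have "deg s4 v = card (present_preds (pos s4) v)" if "v < n" for v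
          using s4 deg'[OF that] that by (simp add: eq)
        ultimately show "elim_state R \<sigma> s4 \<and> elim_measure s4 < elim_measure s1"
          using conjunct1[OF s3] conjunct1[OF conjunct2[OF s3]] R3 m by (simp add: elim_state_def)
      qed
    qed
  qed simp
next
  fix s' assume s': "elim_state R \<sigma> s'" "\<not> bval (NLess (Drawn b) (NAdd (Num b) (Num b))) s'"
  \<comment> \<open>All \<open>2 * n\<close> entries have been processed, and by \<open>R(2)\<close>
    they include every vertex.\<close>
  then have "\<not> nats s' (b + 18, 0, 0) < 2 * n" by (simp add: elim_state_def stored_def mult_2)
  then have "pos s' v \<noteq> 0" if "v < n" for v
    using s'(1) R(2)[OF that] by (auto simp: elim_state_def elim_inv_def)
  then show "elim_state R \<sigma> s' \<and> (\<forall>v<n. pos s' v \<noteq> 0)" using s'(1) by blast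
qed (use s(1) in \<open>auto simp: algebra_simps\<close>)

section \<open>Calling the given program, and correctness for a fixed sample\<close>

subsection \<open>The program after the draws\<close>

lemma wp_build:
  assumes st: "stored s" and p: "elimination_order n m G w (pos s) (2 * n)"
    and n0: "nats s (0, 0, 0) = n"
  shows "wp (build b) (n * (n * 7 + 7) + 3)
    (input_state n (orient n (pos s) G) (orient_weight (2 * n) (pos s) w)) s"
proof -
  let ?G = "orient n (pos s) G" and ?w = "orient_weight (2 * n) (pos s) w"
  let ?c = "Cond (Conj (NLess (Pos b (Row b)) (Pos b (Col b)))
         (Neg (Conj (Neg (Arc b (Row b) (Col b))) (Neg (Arc b (Col b) (Row b))))))
       (Cond (Kept b (Row b)) (VSet 0 (Row b) (Col b) (VGet (b + 10) (Row b) (Col b)))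
         (VSet 0 (Row b) (Col b) (VConst 0)))
       (VSet 0 (Row b) (Col b) VInfty)"
  define Inv where "Inv S s' \<longleftrightarrow> (\<forall>(u, v)\<in>S. vals s' (0, u, v) =
    (if (u, v) \<in> parcs ?G then ereal (?w (u, v)) else \<infinity>))" for S and s' :: state
  have "wp (build b) (n * (n * 7 + 7) + 3) (Inv ({..<n} \<times> {..<n})) s"
    unfolding build_def
  proof (rule wp_iter2[where \<tau> = 3 and n = n])
    fix S and s' :: state
    let ?i = "nats s' (b + 11, 0, 0)" and ?j = "nats s' (b + 12, 0, 0)"
    assume 1: "?i < n" "?j < n" "Inv S s'" "(?i, ?j) \<notin> S"
      and fr: "frame ({b + 11, b + 12} \<union> nmods ?c) (vmods ?c) s s'"
    then have st': "stored s'" using st by (auto intro: stored_frame)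
    have pos: "pos s' v = pos s v" for v using fr by (simp add: frame_def)
    have n': "nats s' (b + 10, 0, 0) = n" using st' by (simp add: stored_def)
    have W: "vals s' (b + 10, u, v) = weight u v" if "u < n" "v < n" for u v
      using st' that by (simp add: stored_def)
    have arc: "(?i, ?j) \<in> parcs ?G \<longleftrightarrow> pos s ?i < pos s ?j \<and>
        ((?i, ?j) \<in> parcs G \<or> (?j, ?i) \<in> parcs G)"
      using 1 by (simp add: orient_def)
    \<comment> \<open>An arc of the orientation that leaves a kept vertex is an original one, so the
      weight copied for it is finite.\<close>
    have kept: "(?i, ?j) \<in> parcs G" if "2 * n < pos s ?i" "(?i, ?j) \<in> parcs ?G"
      using that elimination_order.later[OF p, of ?j ?i] by (auto simp: orient_def)
    show "wp ?c 3 (Inv (insert (?i, ?j) S)) s'"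
    proof (cases "(?i, ?j) \<in> parcs ?G")
      case True
      then have "bval (Conj (NLess (Pos b (Row b)) (Pos b (Col b)))
         (Neg (Conj (Neg (Arc b (Row b) (Col b))) (Neg (Arc b (Col b) (Row b)))))) s'"
        using arc W 1 pos by (auto simp: weight_def)
      then show ?thesis
        using True 1 n' W kept pos
        by (auto simp: wp_simps Inv_def orient_weight_def weight_def mult_2 simp del: bval.simps(2-4))
    next
      case False
      then have "\<not> bval (Conj (NLess (Pos b (Row b)) (Pos b (Col b)))
         (Neg (Conj (Neg (Arc b (Row b) (Col b))) (Neg (Arc b (Col b) (Row b)))))) s'"
        using arc W 1 pos by (auto simp: weight_def)
      then show ?thesis
        using False 1 by (auto simp: wp_simps Inv_def simp del: bval.simps(2-4))
    qed
  qed (use st in \<open>auto simp: Inv_def stored_def frame_def\<close>)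
  then show ?thesis
    by (rule wp_conseq) (use n0 in \<open>auto simp: Inv_def input_state_def build_def frame_def\<close>)
qed

lemma wp_delete_all:
  assumes "nats s (b + 10, 0, 0) = n"
  shows "wp (delete_all b) (5 * n + 3) (\<lambda>s'. \<forall>v<n. pos s' v = 1) s"
  unfolding delete_all_def
  by (rule wp_iter[where \<tau> = "\<lambda>_. 1" and I = "\<lambda>k s'. \<forall>v<k. pos s' v = 1"])
    (use assms in \<open>auto simp: wp_simps frame_def less_Suc_eq\<close>)

end

lemma wp_Cond: "wp (if bval e s then c1 else c2) T Q s \<Longrightarrow> wp (Cond e c1 c2) (1 + T) Q s"
  by (simp add: wp_simps)

context apsp_prog
begin

text \<open>The common postcondition of both branches, tailored to
  \<open>wp_recover\<close>.\<close>

definition ready :: "nat \<Rightarrow> state \<Rightarrow> bool" where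
  "ready \<sigma> s \<longleftrightarrow> stored s \<and>
     (\<forall>u<n. \<forall>v<n. kept s u \<and> kept s v \<longrightarrow> distance u v \<le> vals s (1, u, v) \<and> vals s (1, u, v) \<le> weight u v) \<and>
     (\<forall>u<n. kept s u \<longrightarrow> vals s (1, u, u) = 0) \<and>
     kept_metric (\<lambda>u v. vals s (1, u, v)) s \<and> card (deleted s) \<le> \<sigma>"

lemma ready_orient:
  assumes st: "stored s" and p: "elimination_order n m G w (pos s) (2 * n)"
    and out: "output_state n (orient n (pos s) G) (orient_weight (2 * n) (pos s) w) s"
    and card: "card (deleted s) \<le> \<sigma>"
  shows "ready \<sigma> s"
proof -
  note O = elimination_order.wdigraph_orient[OF p]
  let ?d = "wf_digraph.\<mu> (with_proj (orient n (pos s) G)) (orient_weight (2 * n) (pos s) w)"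
  have out: "vals s (1, u, v) = ?d u v" if "u < n" "v < n" for u v
    using out that by (simp add: output_state_def)
  have "distance u v \<le> ?d u v" "?d u v \<le> weight u v" if "kept s u" "kept s v" for u v
    using elimination_order.distance_le_orient_distance[OF p that(1)]
      elimination_order.orient_distance_le_weight[OF p that] by blast+
  moreover have "?d u u = 0" if "u < n" for u using wdigraph.distance_self[OF O that] .
  moreover have "?d u v \<le> ?d u k + ?d k v" for u k v using wdigraph.distance_triangle[OF O] .
  ultimately show ?thesis
    using st card out by (simp add: ready_def kept_metric_def)
qed

lemma wp_eliminate_branch:
  assumes st: "stored s" and n0: "nats s (0, 0, 0) = n"
    and R: "\<And>i. i < 2 * n \<Longrightarrow> nats s (b + 14, i, 0) = R i" "\<And>i. i < 2 * n \<Longrightarrow> R i < n"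
      "\<And>v. v < n \<Longrightarrow> \<exists>i<2 * n. R i = v"
    and hit: "\<And>C. C \<in> dicycles G \<Longrightarrow> \<exists>i<\<sigma>. R i \<in> dicycle_verts C"
    and no2: "\<And>u v. (u, v) \<in> parcs G \<Longrightarrow> (v, u) \<notin> parcs G"
    and c: "\<And>G' w' s. weighted_digraph n m G' w' \<Longrightarrow> dag G' \<Longrightarrow> input_state n G' w' s \<Longrightarrow>
        wp c t0 (output_state n G' w') s"
    and fresh: "nmods c \<subseteq> {..<b + 10}" "vmods c \<subseteq> {..<b + 10}"
  shows "wp (Seq (elim_start b) (Seq (eliminate b) (Seq (build b) c)))
    (49 * n\<^sup>2 + 84 * n + 18 + t0) (ready \<sigma>) s"
proof -
  let ?T1 = "n * (n * 6 + 7) + 7 * n + 11" and ?T2 = "3 * n * (12 * n + 21) + 1" and ?T3 = "n * (n * 7 + 7) + 3"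
  have "wp (Seq (elim_start b) (Seq (eliminate b) (Seq (build b) c)))
      (?T1 + 1 + (?T2 + 1 + (?T3 + 1 + t0))) (ready \<sigma>) s"
  proof (rule wp_Seq_conseq[OF wp_elim_start[OF st] order_refl])
    fix s1 :: state
    assume s1: "(\<forall>v<n. pos s1 v = 0 \<and> deg s1 v = card (present_preds (pos s1) v)) \<and>
        nats s1 (b + 18, 0, 0) = 0 \<and> nats s1 (b + 19, 0, 0) = 0"
      and fr: "frame (nmods (elim_start b)) (vmods (elim_start b)) s s1"
    have "stored s1" by (rule stored_frame[OF st fr]) (auto simp: elim_start_def)
    moreover have "\<forall>i<2 * n. nats s1 (b + 14, i, 0) = R i"
      using R(1) fr by (simp add: frame_def elim_start_def)
    moreover have "elim_inv n (parcs G) R \<sigma> (pos s1) 0 0"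
      by (rule elim_inv_start) (use s1 in simp)
    ultimately have es: "elim_state R \<sigma> s1" using s1 by (simp add: elim_state_def)
    have n1: "nats s1 (0, 0, 0) = n" using n0 fr by (simp add: frame_def elim_start_def)
    have "nats s1 (b + 18, 0, 0) = 0" using s1 by blast
    then have "wp (eliminate b) ?T2 (\<lambda>s'. elim_state R \<sigma> s' \<and> (\<forall>v<n. pos s' v \<noteq> 0)) s1"
      by (rule wp_eliminate[OF es]) (fact R(2) R(3) hit)+
    then show "wp (Seq (eliminate b) (Seq (build b) c)) (?T2 + 1 + (?T3 + 1 + t0)) (ready \<sigma>) s1"
    proof (rule wp_Seq_conseq[OF _ order_refl])
      fix s2 :: state
      assume s2: "elim_state R \<sigma> s2 \<and> (\<forall>v<n. pos s2 v \<noteq> 0)"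
        and fr: "frame (nmods (eliminate b)) (vmods (eliminate b)) s1 s2"
      have st2: "stored s2" using s2 by (simp add: elim_state_def)
      have n2: "nats s2 (0, 0, 0) = n"
        using n1 fr by (simp add: frame_def eliminate_def find_source_def choose_vertex_def delete_vertex_def)
      have inv: "elim_inv n (parcs G) R \<sigma> (pos s2) (nats s2 (b + 18, 0, 0)) (nats s2 (b + 19, 0, 0))"
        using s2 by (simp add: elim_state_def)
      have pos: "\<And>v. v < n \<Longrightarrow> pos s2 v \<noteq> 0" using s2 by blast
      have p: "elimination_order n m G w (pos s2) (2 * n)"
        by (rule elim_inv_order[OF inv]) (fact pos no2)+
      have card: "card {v. v < n \<and> pos s2 v \<le> 2 * n} \<le> \<sigma>"
        by (rule elim_inv_card[OF inv]) (fact pos)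
      let ?G = "orient n (pos s2) G" and ?w = "orient_weight (2 * n) (pos s2) w"
      show "wp (Seq (build b) c) (?T3 + 1 + t0) (ready \<sigma>) s2"
      proof (rule wp_Seq_conseq[OF wp_build[OF st2 p n2] order_refl])
        fix s3 :: state
        assume s3: "input_state n ?G ?w s3" and fr3: "frame (nmods (build b)) (vmods (build b)) s2 s3"
        have "wp c t0 (output_state n ?G ?w) s3"
          by (rule c[OF elimination_order.weighted_digraph_orient[OF p] elimination_order.dag_orient[OF p] s3])
        then show "wp c t0 (ready \<sigma>) s3"
        proof (rule wp_conseq[OF _ order_refl])
          fix s4 :: state
          assume out: "output_state n ?G ?w s4" and fr4: "frame (nmods c) (vmods c) s3 s4"
          note fr = frame_trans[OF fr3 fr4]
          have st4: "stored s4" by (rule stored_frame[OF st2 fr]) (use fresh in \<open>auto simp: build_def\<close>)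
          \<comment> \<open>The given program cannot write the positions, so they still describe the
            order for which it was called.\<close>
          have "b + 15 \<notin> nmods (build b) \<union> nmods c" using fresh by (auto simp: build_def)
          then have "nats s4 (b + 15, v, 0) = nats s2 (b + 15, v, 0)" for v
            using fr unfolding frame_def by blast
          then have eq: "pos s4 = pos s2" by simp
          have "deleted s4 = {v. v < n \<and> pos s2 v \<le> 2 * n}"
            unfolding deleted_def using fun_cong[OF eq] by (simp add: not_less)
          then have "card (deleted s4) \<le> \<sigma>" using card by simp
          moreover have "elimination_order n m G w (pos s4) (2 * n)" unfolding eq by (rule p)
          moreover have "output_state n (orient n (pos s4) G) (orient_weight (2 * n) (pos s4) w) s4"
            unfolding eq by (rule out)
          ultimately show "ready \<sigma> s4" using ready_orient[OF st4] by blast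
        qed
      qed
    qed
  qed
  then show ?thesis
    by (rule wp_mono) (simp_all add: algebra_simps power2_eq_square)
qed

lemma output_if_matrix: "matrix distance s \<Longrightarrow> output_state n G w s"
  by (simp add: matrix_def output_state_def)

definition sample :: "state \<Rightarrow> nat \<Rightarrow> nat" where
  "sample s i = (if i < n then nats s (b + 14, i, 0) else i - n)"

text \<open>\<sigma> bounds the number of deleted vertices in both branches: through
  \<open>hit\<close> after an elimination, and through \<open>two\<close> when opposite arcs cause
  all n vertices to be deleted.\<close>

lemma wp_apsp_after_draw:
  assumes n: "1 \<le> n" and input: "input_state n G w s" and num: "nats s (b + 10, 0, 0) = n"
    and draws: "\<And>i. i < n \<Longrightarrow> nats s (b + 14, i, 0) < n"
    and hit: "\<And>C. C \<in> dicycles G \<Longrightarrow> \<exists>i<\<sigma>. sample s i \<in> dicycle_verts C"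
    and two: "\<And>u v. (u, v) \<in> parcs G \<Longrightarrow> (v, u) \<in> parcs G \<Longrightarrow> n \<le> \<sigma>"
    and c: "\<And>G' w' s. weighted_digraph n m G' w' \<Longrightarrow> dag G' \<Longrightarrow> input_state n G' w' s \<Longrightarrow>
        wp c t0 (output_state n G' w') s"
    and fresh: "nmods c \<subseteq> {..<b + 10}" "vmods c \<subseteq> {..<b + 10}"
    and T: "400 * n\<^sup>2 + t0 + 28 * n\<^sup>2 * \<sigma> \<le> T"
  shows "wp (apsp_after_draw b c) T (output_state n G w) s"
proof -
  let ?T1 = "5 * n + 3" and ?T2 = "n * (n * 5 + 7) + 3" and ?T3 = "n * (n * 6 + 7) + 5"
    and ?T4 = "1 + (49 * n\<^sup>2 + 84 * n + 18 + t0)"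
    and ?T5 = "20 * n\<^sup>2 + 50 * n + 20 + \<sigma> * (15 * n\<^sup>2 + 10 * n + 3)"
  let ?branch = "Cond (NLess (Flag b) (NConst 1))
         (Seq (elim_start b) (Seq (eliminate b) (Seq (build b) c))) (delete_all b)"
  have R: "sample s i < n" if "i < 2 * n" for i
    using draws that by (auto simp: sample_def)
  have R': "\<exists>i<2 * n. sample s i = v" if "v < n" for v
    by (rule exI[of _ "n + v"]) (use that in \<open>simp add: sample_def\<close>)
  have "wp (apsp_after_draw b c) (?T1 + 1 + (?T2 + 1 + (?T3 + 1 + (?T4 + 1 + ?T5)))) (matrix distance) s"
    unfolding apsp_after_draw_def
  proof (rule wp_Seq_conseq[OF wp_extend_sample[OF num] order_refl])
    fix s1 :: state
    assume s1: "\<forall>i<2 * n. nats s1 (b + 14, i, 0) = (if i < n then nats s (b + 14, i, 0) else i - n)"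
      and fr1: "frame (nmods (extend_sample b)) (vmods (extend_sample b)) s s1"
    have num1: "nats s1 (b + 10, 0, 0) = n" and n01: "nats s1 (0, 0, 0) = n"
      and W1: "\<And>u v. u < n \<Longrightarrow> v < n \<Longrightarrow> vals s1 (0, u, v) = weight u v"
      using num input fr1 by (simp_all add: frame_def extend_sample_def input_state_def weight_def)
    have "wp (copy_weights b) ?T2 stored s1" by (rule wp_copy_weights[OF num1 W1])
    then show "wp (Seq (copy_weights b) (Seq (detect b) (Seq ?branch (recover b))))
        (?T2 + 1 + (?T3 + 1 + (?T4 + 1 + ?T5))) (matrix distance) s1"
    proof (rule wp_Seq_conseq[OF _ order_refl])
      fix s2 :: state
      assume st2: "stored s2" and fr2: "frame (nmods (copy_weights b)) (vmods (copy_weights b)) s1 s2"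
      have s2: "nats s2 (0, 0, 0) = n" "\<And>i. nats s2 (b + 14, i, 0) = nats s1 (b + 14, i, 0)"
        using n01 fr2 by (simp_all add: frame_def copy_weights_def)
      show "wp (Seq (detect b) (Seq ?branch (recover b))) (?T3 + 1 + (?T4 + 1 + ?T5)) (matrix distance) s2"
      proof (rule wp_Seq_conseq[OF wp_detect[OF st2] order_refl])
        fix s3 :: state
        assume flag: "nats s3 (b + 20, 0, 0) = 0 \<longleftrightarrow> (\<forall>u v. (u, v) \<in> parcs G \<longrightarrow> (v, u) \<notin> parcs G)"
          and fr3: "frame (nmods (detect b)) (vmods (detect b)) s2 s3"
        have st3: "stored s3" by (rule stored_frame[OF st2 fr3]) (auto simp: detect_def)
        have s3: "nats s3 (0, 0, 0) = n" "\<And>i. i < 2 * n \<Longrightarrow> nats s3 (b + 14, i, 0) = sample s i"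
          using s1 s2 fr3 by (simp_all add: frame_def detect_def sample_def)
        have "wp ?branch ?T4 (ready \<sigma>) s3"
        proof (cases "nats s3 (b + 20, 0, 0) = 0")
          case True
          have "wp (Seq (elim_start b) (Seq (eliminate b) (Seq (build b) c)))
              (49 * n\<^sup>2 + 84 * n + 18 + t0) (ready \<sigma>) s3"
            by (rule wp_eliminate_branch[OF st3 s3(1), where R = "sample s"])
              (use s3(2) R R' hit c fresh True flag in blast)+
          then show ?thesis using True by (intro wp_Cond) simp
        next
          case False
          then have "\<not> (\<forall>u v. (u, v) \<in> parcs G \<longrightarrow> (v, u) \<notin> parcs G)" unfolding flag .
          then obtain u v where "(u, v) \<in> parcs G" "(v, u) \<in> parcs G" by blast
          then have \<sigma>: "n \<le> \<sigma>" by (rule two)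
          have num3: "nats s3 (b + 10, 0, 0) = n" using st3 by (simp add: stored_def)
          have "wp (delete_all b) (49 * n\<^sup>2 + 84 * n + 18 + t0) (ready \<sigma>) s3"
          proof (rule wp_conseq[OF wp_delete_all[OF num3]])
            fix s4 :: state
            assume s4: "\<forall>v<n. pos s4 v = 1" and fr4: "frame (nmods (delete_all b)) (vmods (delete_all b)) s3 s4"
            have "stored s4" by (rule stored_frame[OF st3 fr4]) (auto simp: delete_all_def)
            moreover have "\<not> kept s4 v" if "v < n" for v using s4 that n by simp
            moreover from this have "deleted s4 = {..<n}" by (auto simp: deleted_def)
            ultimately show "ready \<sigma> s4" using \<sigma> by (auto simp: ready_def kept_metric_def)
          qed simp
          then show ?thesis using False by (intro wp_Cond) simp
        qed
        then show "wp (Seq ?branch (recover b)) (?T4 + 1 + ?T5) (matrix distance) s3"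
        proof (rule wp_Seq_conseq[OF _ order_refl])
          fix s5 :: state
          assume s5: "ready \<sigma> s5"
          have "card (deleted s5) * (15 * n\<^sup>2 + 10 * n + 3) \<le> \<sigma> * (15 * n\<^sup>2 + 10 * n + 3)"
            using s5 by (intro mult_right_mono) (auto simp: ready_def)
          then show "wp (recover b) ?T5 (matrix distance) s5"
            using s5 by (intro wp_recover) (auto simp: ready_def stored_def)
        qed
      qed
    qed
  qed
  then show ?thesis
  proof (rule wp_mono)
    have "n \<le> n\<^sup>2" "1 \<le> n\<^sup>2" using n by (simp_all add: power2_eq_square)
    then have "\<sigma> * (15 * n\<^sup>2 + 10 * n + 3) \<le> \<sigma> * (28 * n\<^sup>2)" by (intro mult_left_mono) linarith+
    then have 1: "\<sigma> * (15 * n\<^sup>2 + 10 * n + 3) \<le> 28 * n\<^sup>2 * \<sigma>" by (simp add: ac_simps)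
    have "?T2 = 5 * n\<^sup>2 + 7 * n + 3" "?T3 = 6 * n\<^sup>2 + 7 * n + 5" by (simp_all add: power2_eq_square algebra_simps)
    then show "?T1 + 1 + (?T2 + 1 + (?T3 + 1 + (?T4 + 1 + ?T5))) \<le> T"
      using T 1 \<open>n \<le> n\<^sup>2\<close> \<open>1 \<le> n\<^sup>2\<close> by linarith
  qed (rule output_if_matrix)
qed

section \<open>Hitting all cycles with high probability, and the total running time\<close>

section \<open>The random sample\<close>

abbreviation draw_loop :: com where
  "draw_loop \<equiv> loop (b + 11) (Num b) (Rand (b + 14) (Row b) (NConst 0) (NSub (Num b) (NConst 1)))"

abbreviation drawn :: "state \<Rightarrow> nat \<Rightarrow> nat" where
  "drawn s \<equiv> \<lambda>i. nats s (b + 14, i, 0)"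

text \<open>A round takes exactly five steps: the test, the draw, the increment and two removals of
  \<open>Skip\<close>.\<close>

lemma success_draw_loop:
  assumes "nats s (b + 10, 0, 0) = n" "nats s (b + 11, 0, 0) = i" "i < n"
  shows "success draw_loop (Suc (Suc (Suc (Suc (Suc T))))) P s =
    (\<Sum>k<n. success draw_loop T P (s\<lparr>nats := (nats s)((b + 14, i, 0) := k, (b + 11, 0, 0) := Suc i)\<rparr>)) / n"
proof -
  have "{..n - 1} = {..<n}" using assms(3) by auto
  then show ?thesis
    using assms by (simp add: loop_def success_Suc case_prod_unfold integral_pmf_of_set lessThan_empty_iff)
qed

text \<open>Generalized for induction to a loop entered at index \<open>i\<close>. Earlier draws are
  fixed and must not have hit \<open>S\<close>; each of the \<open>\<sigma> - i\<close> relevant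
  draws to come misses with probability \<open>1 - card S / n\<close>.\<close>

lemma success_draw_loop_miss:
  assumes S: "S \<subseteq> {..<n}" and "\<sigma> \<le> n"
    and "nats s (b + 10, 0, 0) = n" "nats s (b + 11, 0, 0) = i" "i \<le> n"
  shows "success draw_loop (5 * (n - i) + 1) (\<lambda>s'. \<forall>j<\<sigma>. drawn s' j \<notin> S) s \<le>
    (if \<exists>j<min i \<sigma>. drawn s j \<in> S then 0 else (1 - card S / n) ^ (\<sigma> - i))"
  using assms(3-)
proof (induction "n - i" arbitrary: i s)
  case 0
  then have "i = n" by simp
  then show ?case
    using 0 \<open>\<sigma> \<le> n\<close>
    by (auto simp: loop_def success_Suc success_0 success_le_1)
next
  case (Suc l)
  then have "i < n" by simp
  let ?s = "\<lambda>k. s\<lparr>nats := (nats s)((b + 14, i, 0) := k, (b + 11, 0, 0) := Suc i)\<rparr>"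
  let ?P = "\<lambda>s'. \<forall>j<\<sigma>. drawn s' j \<notin> S"
  let ?q = "1 - card S / n"
  have q: "0 \<le> ?q" using card_mono[OF _ S] \<open>i < n\<close> by (simp add: field_simps)
  define F where "F k = success draw_loop (5 * (n - Suc i) + 1) ?P (?s k)" for k
  have "5 * (n - i) + 1 = Suc (Suc (Suc (Suc (Suc (5 * (n - Suc i) + 1)))))"
    using \<open>i < n\<close> by (simp add: Suc_diff_Suc[symmetric])
  then have eq: "success draw_loop (5 * (n - i) + 1) ?P s = (\<Sum>k<n. F k) / n"
    using success_draw_loop[OF Suc.prems(1,2) \<open>i < n\<close>] by (simp add: F_def)
  have IH: "F k \<le> (if \<exists>j<min (Suc i) \<sigma>. drawn (?s k) j \<in> S then 0 else ?q ^ (\<sigma> - Suc i))" for k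
    unfolding F_def by (rule Suc.hyps(1)) (use Suc \<open>i < n\<close> in auto)
  have zero: "F k \<le> 0" if j: "j < min (Suc i) \<sigma>" "(if j = i then k else drawn s j) \<in> S" for j k
  proof -
    have "drawn (?s k) j \<in> S" using j(2) by simp
    then have "\<exists>j<min (Suc i) \<sigma>. drawn (?s k) j \<in> S" using j(1) by (intro exI conjI)
    then show ?thesis using IH[of k] by (simp only: if_True)
  qed
  have le: "F k \<le> ?q ^ (\<sigma> - Suc i)" for k
  proof -
    have "(if P then 0 else x) \<le> x" if "0 \<le> x" for P and x :: real using that by simp
    from order_trans[OF IH this[OF zero_le_power[OF q]]] show ?thesis .
  qed
  show ?case
  proof (cases "\<exists>j<min i \<sigma>. drawn s j \<in> S")
    case True
    then obtain j where j: "j < min i \<sigma>" "drawn s j \<in> S" by blast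
    have "F k \<le> 0" for k by (rule zero[of j]) (use j in auto)
    then have "(\<Sum>k<n. F k) \<le> 0" by (intro sum_nonpos)
    then show ?thesis unfolding eq if_P[OF True] by (simp add: divide_nonpos_nonneg)
  next
    case False
    show ?thesis
    proof (cases "i < \<sigma>")
      case True
      have "F k \<le> (if k \<in> S then 0 else ?q ^ (\<sigma> - Suc i))" for k
        using zero[of i k] le[of k] True by simp
      then have "(\<Sum>k<n. F k) \<le> (\<Sum>k<n. if k \<in> S then 0 else ?q ^ (\<sigma> - Suc i))"
        by (rule sum_mono)
      also have "\<dots> = (\<Sum>k\<in>{..<n} - S. ?q ^ (\<sigma> - Suc i))"
        by (rule sum.mono_neutral_cong_right) auto
      also have "\<dots> = real (n - card S) * ?q ^ (\<sigma> - Suc i)"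
        using card_Diff_subset[OF finite_subset[OF S] S] by simp
      also have "real (n - card S) = n * ?q"
        using card_mono[OF _ S] \<open>i < n\<close> by (simp add: of_nat_diff field_simps)
      also have "n * ?q * ?q ^ (\<sigma> - Suc i) = n * ?q ^ (\<sigma> - i)"
        using True by (simp add: power_Suc[symmetric] Suc_diff_Suc del: power_Suc)
      finally show ?thesis
        unfolding eq if_not_P[OF False] using \<open>i < n\<close> by (simp add: field_simps)
    next
      case \<sigma>: False
      \<comment> \<open>The first \<sigma> draws are over and the exponent
        \<open>\<sigma> - i\<close> is 0, so the trivial bound suffices.\<close>
      have "F k \<le> 1" for k unfolding F_def by (rule success_le_1)
      then have "(\<Sum>k<n. F k) \<le> (\<Sum>k<n. 1)" by (intro sum_mono)
      then show ?thesis
        unfolding eq if_not_P[OF False] using \<sigma> \<open>i < n\<close> by (simp add: field_simps)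
    qed
  qed
qed

lemma success_draw_miss:
  assumes "S \<subseteq> {..<n}" "\<sigma> \<le> n" "nats s (b + 10, 0, 0) = n"
  shows "success (draw b) (5 * n + 3) (\<lambda>s'. \<forall>j<\<sigma>. drawn s' j \<notin> S) s \<le> (1 - card S / n) ^ \<sigma>"
proof -
  let ?s = "s\<lparr>nats := (nats s)((b + 11, 0, 0) := 0)\<rparr>"
  have "success (draw b) (Suc (Suc (5 * n + 1))) P s = success draw_loop (5 * n + 1) P ?s" for P
    unfolding draw_def iter_def by (simp only: success_Suc) simp
  moreover have "success draw_loop (5 * (n - 0) + 1) (\<lambda>s'. \<forall>j<\<sigma>. drawn s' j \<notin> S) ?s \<le>
      (if \<exists>j<min 0 \<sigma>. drawn ?s j \<in> S then 0 else (1 - card S / n) ^ (\<sigma> - 0))"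
    by (rule success_draw_loop_miss) (use assms in auto)
  ultimately show ?thesis by (simp add: numeral_eq_Suc)
qed

lemma wp_draw:
  assumes "nats s (b + 10, 0, 0) = n"
  shows "wp (draw b) (5 * n + 3) (\<lambda>s'. \<forall>i<n. drawn s' i < n) s"
  unfolding draw_def
  by (rule wp_iter[where \<tau> = "\<lambda>_. 1" and I = "\<lambda>k s'. \<forall>i<k. drawn s' i < n"])
    (use assms in \<open>auto simp: wp_simps frame_def less_Suc_eq\<close>)

text \<open>A union bound over the cycles. Range and frame hold in every run, so including them
  costs no probability.\<close>

lemma success_draw_hit:
  assumes num: "nats s (b + 10, 0, 0) = n" and \<sigma>: "\<sigma> \<le> n" and "1 \<le> n"
    and d: "\<And>C. C \<in> dicycles G \<Longrightarrow> d \<le> card (dicycle_verts C)"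
  shows "1 - card (dicycles G) * (1 - d / n) ^ \<sigma> \<le>
    success (draw b) (5 * n + 3) (\<lambda>s'. (\<forall>i<n. drawn s' i < n) \<and> frame (nmods (draw b)) (vmods (draw b)) s s' \<and>
      (\<forall>C\<in>dicycles G. \<exists>i<\<sigma>. drawn s' i \<in> dicycle_verts C)) s"
proof -
  let ?M = "run (5 * n + 3) (draw b, s)"
  let ?valid = "\<lambda>s'. (\<forall>i<n. drawn s' i < n) \<and> frame (nmods (draw b)) (vmods (draw b)) s s'"
  let ?good = "{(c', s'). c' = Skip \<and> ((\<forall>i<n. drawn s' i < n) \<and> frame (nmods (draw b)) (vmods (draw b)) s s' \<and>
      (\<forall>C\<in>dicycles G. \<exists>i<\<sigma>. drawn s' i \<in> dicycle_verts C))}"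
  let ?miss = "\<lambda>C. {(c', s'). c' = Skip \<and> (\<forall>i<\<sigma>. drawn s' i \<notin> dicycle_verts C)}"
  have "wp (draw b) (5 * n + 3) ?valid s" by (rule wp_frame[OF wp_draw[OF num]])
  then have "AE x in ?M. x \<in> - ?good \<longrightarrow> x \<in> (\<Union>C\<in>dicycles G. ?miss C)"
    by (auto simp: AE_measure_pmf_iff wp_def)
  then have "measure_pmf.prob ?M (- ?good) \<le> measure_pmf.prob ?M (\<Union>C\<in>dicycles G. ?miss C)"
    by (rule measure_pmf.finite_measure_mono_AE) auto
  also have "\<dots> \<le> (\<Sum>C\<in>dicycles G. measure_pmf.prob ?M (?miss C))"
    by (rule measure_pmf.finite_measure_subadditive_finite) (auto simp: finite_dicycles)
  also have "\<dots> \<le> (\<Sum>C\<in>dicycles G. (1 - d / n) ^ \<sigma>)"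
  proof (rule sum_mono)
    fix C assume C: "C \<in> dicycles G"
    have "measure_pmf.prob ?M (?miss C) \<le> (1 - card (dicycle_verts C) / n) ^ \<sigma>"
      using success_draw_miss[OF dicycle_verts_subset[OF C] \<sigma> num] by (simp add: success_def)
    also have "\<dots> \<le> (1 - d / n) ^ \<sigma>"
      using d[OF C] card_mono[OF _ dicycle_verts_subset[OF C]] \<open>1 \<le> n\<close>
      by (intro power_mono) (auto simp: field_simps)
    finally show "measure_pmf.prob ?M (?miss C) \<le> (1 - d / n) ^ \<sigma>" .
  qed
  also have "\<dots> = card (dicycles G) * (1 - d / n) ^ \<sigma>" by simp
  finally have "measure_pmf.prob ?M (- ?good) \<le> card (dicycles G) * (1 - d / n) ^ \<sigma>" .
  moreover have "measure_pmf.prob ?M (- ?good) = 1 - measure_pmf.prob ?M ?good"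
    by (subst measure_pmf.prob_compl[symmetric]) (auto simp: Compl_eq_Diff_UNIV)
  ultimately show ?thesis unfolding success_def by linarith
qed

lemma success_Seq_NSet: "success (Seq (NSet a e f g) c) (Suc (Suc T)) P s =
    success c T P (s\<lparr>nats := (nats s)((a, nval e s, nval f s) := nval g s)\<rparr>)"
  by (simp add: success_Suc)

lemma success_apsp:
  assumes n: "1 \<le> n" and input: "input_state n G w s"
    and good: "\<And>s. nats s (b + 10, 0, 0) = n \<Longrightarrow> x \<le> success (draw b) (5 * n + 3) (\<lambda>s'. (\<forall>i<n. drawn s' i < n) \<and>
      frame (nmods (draw b)) (vmods (draw b)) s s' \<and>
      (\<forall>C\<in>dicycles G. \<exists>i<\<sigma>. sample s' i \<in> dicycle_verts C)) s"
    and two: "\<And>u v. (u, v) \<in> parcs G \<Longrightarrow> (v, u) \<in> parcs G \<Longrightarrow> n \<le> \<sigma>"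
    and c: "\<And>G' w' s. weighted_digraph n m G' w' \<Longrightarrow> dag G' \<Longrightarrow> input_state n G' w' s \<Longrightarrow>
        wp c t0 (output_state n G' w') s"
    and fresh: "nmods c \<subseteq> {..<b + 10}" "vmods c \<subseteq> {..<b + 10}"
  shows "x \<le> success (apsp b c) (500 * n\<^sup>2 + t0 + 28 * n\<^sup>2 * \<sigma>) (output_state n G w) s"
proof -
  let ?s = "s\<lparr>nats := (nats s)((b + 10, 0, 0) := n)\<rparr>"
  let ?T = "400 * n\<^sup>2 + t0 + 28 * n\<^sup>2 * \<sigma>"
  have num: "nats ?s (b + 10, 0, 0) = n" by simp
  have input': "input_state n G w ?s" and n0: "nats s (0, 0, 0) = n"
    using input by (simp_all add: input_state_def)
  have "x \<le> success (draw b) (5 * n + 3) (wp (apsp_after_draw b c) ?T (output_state n G w)) ?s"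
  proof (rule order_trans[OF good[OF num] success_mono[OF order_refl]])
    fix s' assume s': "(\<forall>i<n. drawn s' i < n) \<and> frame (nmods (draw b)) (vmods (draw b)) ?s s' \<and>
      (\<forall>C\<in>dicycles G. \<exists>i<\<sigma>. sample s' i \<in> dicycle_verts C)"
    then have fr: "frame (nmods (draw b)) (vmods (draw b)) ?s s'" by blast
    have "input_state n G w s'" "nats s' (b + 10, 0, 0) = n"
      using fr input' num by (simp_all add: input_state_def frame_def draw_def)
    then show "wp (apsp_after_draw b c) ?T (output_state n G w) s'"
      by (rule wp_apsp_after_draw[OF n]) (use s' two c fresh in blast)+
  qed
  also have "\<dots> \<le> success (Seq (draw b) (apsp_after_draw b c)) (Suc (5 * n + 3 + ?T)) (output_state n G w) ?s"
    by (rule success_Seq)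
  also have "\<dots> = success (apsp b c) (Suc (Suc (Suc (5 * n + 3 + ?T)))) (output_state n G w) s"
    unfolding apsp_def success_Seq_NSet nval.simps n0 ..
  also have "\<dots> \<le> success (apsp b c) (500 * n\<^sup>2 + t0 + 28 * n\<^sup>2 * \<sigma>) (output_state n G w) s"
  proof (rule success_mono)
    have "n \<le> n\<^sup>2" "1 \<le> n\<^sup>2" using n by (simp_all add: power2_eq_square)
    then show "Suc (Suc (Suc (5 * n + 3 + ?T))) \<le> 500 * n\<^sup>2 + t0 + 28 * n\<^sup>2 * \<sigma>" by linarith
  qed
  finally show ?thesis .
qed

text \<open>Output cells may initially hold -1, which is no distance as distances are non-negative;
  so each of the n^2 cells has to change.\<close>

lemma square_le_time:
  assumes "solves_apsp_within c n G w (real T) 1"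
  shows "n\<^sup>2 \<le> T"
proof -
  define s :: state where "s = \<lparr>nats = \<lambda>_. n, vals = \<lambda>(a, u, v). if a = 0 then weight u v else -1\<rparr>"
  have "input_state n G w s" by (simp add: input_state_def s_def weight_def)
  then have wp: "wp c T (output_state n G w) s" by (rule wp_if_solves[OF assms])
  obtain c' s' where run: "(c', s') \<in> set_pmf (run T (c, s))"
    using set_pmf_not_empty[of "run T (c, s)"] by auto
  then have "output_state n G w s'" using wp by (auto simp: wp_def)
  then have "vals s' (1, u, v) \<noteq> vals s (1, u, v)" if "u < n" "v < n" for u v
    using that distance_nonneg[of u v] by (auto simp: output_state_def s_def)
  then have "{1} \<times> {..<n} \<times> {..<n} \<subseteq> {x. vals s' x \<noteq> vals s x}" by auto
  then have "card ({1::nat} \<times> {..<n} \<times> {..<n}) \<le> T"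
    using run_vals[OF run] card_mono order_trans by blast
  then show ?thesis by (simp add: power2_eq_square)
qed

lemma success_draw_sample:
  assumes "nats s (b + 10, 0, 0) = n" "\<sigma> \<le> n" "1 \<le> n"
    and "\<And>C. C \<in> dicycles G \<Longrightarrow> d \<le> card (dicycle_verts C)"
  shows "1 - card (dicycles G) * (1 - d / n) ^ \<sigma> \<le>
    success (draw b) (5 * n + 3) (\<lambda>s'. (\<forall>i<n. drawn s' i < n) \<and> frame (nmods (draw b)) (vmods (draw b)) s s' \<and>
      (\<forall>C\<in>dicycles G. \<exists>i<\<sigma>. sample s' i \<in> dicycle_verts C)) s"
proof (rule order_trans[OF success_draw_hit[OF assms(1-3)] success_mono[OF order_refl]])
  fix s'
  have "sample s' i = drawn s' i" if "i < \<sigma>" for i using that assms(2) by (simp add: sample_def)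
  moreover assume "(\<forall>i<n. drawn s' i < n) \<and> frame (nmods (draw b)) (vmods (draw b)) s s' \<and>
      (\<forall>C\<in>dicycles G. \<exists>i<\<sigma>. drawn s' i \<in> dicycle_verts C)"
  ultimately show "(\<forall>i<n. drawn s' i < n) \<and> frame (nmods (draw b)) (vmods (draw b)) s s' \<and>
      (\<forall>C\<in>dicycles G. \<exists>i<\<sigma>. sample s' i \<in> dicycle_verts C)" by metis
qed (fact assms(4))

text \<open>The appended half of the sample lists all vertices and thus meets every nonempty vertex
  set.\<close>

lemma success_draw_all:
  assumes "nats s (b + 10, 0, 0) = n" and "\<And>C. C \<in> dicycles G \<Longrightarrow> 1 \<le> card (dicycle_verts C)"
  shows "1 \<le> success (draw b) (5 * n + 3) (\<lambda>s'. (\<forall>i<n. drawn s' i < n) \<and>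
      frame (nmods (draw b)) (vmods (draw b)) s s' \<and>
      (\<forall>C\<in>dicycles G. \<exists>i<2 * n. sample s' i \<in> dicycle_verts C)) s"
proof -
  have "\<exists>i<2 * n. sample s' i \<in> dicycle_verts C" if C: "C \<in> dicycles G" for C s'
  proof -
    obtain v where v: "v \<in> dicycle_verts C" using assms(2)[OF C] by (metis card.empty ex_in_conv not_one_le_zero)
    then have "v < n" using dicycle_verts_subset[OF C] by auto
    then show ?thesis using v by (intro exI[of _ "n + v"]) (simp add: sample_def)
  qed
  then have "wp (draw b) (5 * n + 3) (\<lambda>s'. (\<forall>i<n. drawn s' i < n) \<and>
      frame (nmods (draw b)) (vmods (draw b)) s s' \<and>
      (\<forall>C\<in>dicycles G. \<exists>i<2 * n. sample s' i \<in> dicycle_verts C)) s"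
    by (intro wp_conseq[OF wp_draw[OF assms(1)] order_refl]) blast
  then show ?thesis using wp_imp_success by fastforce
qed

text \<open>By \<open>1 - y \<le> exp (- y)\<close>, a cycle is missed with probability at most
  n^-(a+1); the exponent a + 1 leaves 1/n after summing over n^a cycles.\<close>

lemma miss_bound:
  assumes d: "1 \<le> d" "d \<le> n" and n: "2 \<le> n" and N: "real N \<le> real n ^ a"
    and \<sigma>: "(a + 1) * (n * ln n / d) \<le> \<sigma>"
  shows "N * (1 - d / n) ^ \<sigma> \<le> 1 / n"
proof -
  have "1 - d / n \<le> exp (- (d / n))" using exp_ge_add_one_self[of "- (d / n)"] by simp
  then have "(1 - d / n) ^ \<sigma> \<le> exp (- (d / n)) ^ \<sigma>"
    using d n by (intro power_mono) (auto simp: field_simps)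
  also have "\<dots> = exp (- (d / n * \<sigma>))" by (simp add: exp_of_nat_mult[symmetric] mult.commute)
  also have "\<dots> \<le> exp (- ((a + 1) * ln n))"
  proof -
    have "(a + 1) * ln n = d / n * ((a + 1) * (n * ln n / d))" using d n by simp
    also have "\<dots> \<le> d / n * \<sigma>" using \<sigma> by (intro mult_left_mono) (auto simp: add.commute)
    finally show ?thesis by simp
  qed
  also have "\<dots> = 1 / real n ^ (a + 1)"
  proof -
    have "exp ((a + 1) * ln n) = real n ^ (a + 1)" using n exp_of_nat_mult[of "a + 1" "ln n"] by simp
    then show ?thesis by (simp only: exp_minus inverse_eq_divide)
  qed
  finally have 1: "(1 - d / n) ^ \<sigma> \<le> 1 / real n ^ (a + 1)" .
  have "N * (1 - d / n) ^ \<sigma> \<le> real n ^ a * (1 / real n ^ (a + 1))"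
    by (rule mult_mono[OF N 1]) (use d n in auto)
  also have "\<dots> = 1 / n" using n by simp
  finally show ?thesis .
qed

text \<open>\<sigma> is chosen in three ways: 0 for acyclic graphs; \<open>\<sigma>0\<close>, just
  large enough for \<open>miss_bound\<close>, if it is at most n and no arcs are opposite; otherwise
  \<open>2 * n\<close>.\<close>

lemma apsp_solves:
  fixes a :: nat
  assumes c: "\<And>G' w'. weighted_digraph n m G' w' \<Longrightarrow> dag G' \<Longrightarrow> solves_apsp_within c n G' w' (real t0) 1"
    and fresh: "nmods c \<subseteq> {..<b + 10}" "vmods c \<subseteq> {..<b + 10}"
    and n: "2 \<le> n" and d: "1 \<le> d" "\<And>C. C \<in> dicycles G \<Longrightarrow> d \<le> card (dicycle_verts C)"
    and N: "real (card (dicycles G)) \<le> real n ^ a"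
  shows "solves_apsp_within (apsp b c) n G w
    ((2000 + 56 * real a) * (real t0 + real n ^ 3 * ln (real n) / real d)) (1 - 1 / real n)"
  unfolding solves_apsp_within_def
proof (intro allI impI)
  fix s assume input: "input_state n G w s"
  define x where "x = n * ln n / d"
  have x: "real n ^ 3 * ln (real n) / real d = real (n\<^sup>2) * x"
    by (simp add: x_def power3_eq_cube power2_eq_square)
  let ?T = "\<lambda>\<sigma>. 500 * n\<^sup>2 + t0 + 28 * n\<^sup>2 * \<sigma>"
  have c': "wp c t0 (output_state n G' w') s"
    if "weighted_digraph n m G' w'" "dag G'" "input_state n G' w' s" for G' w' s
    using wp_if_solves c that by blast
  have "0 \<le> x" using n by (simp add: x_def)
  have "\<exists>\<sigma>. real (?T \<sigma>) \<le> (2000 + 56 * real a) * (real t0 + real (n\<^sup>2) * x) \<and>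
      1 - 1 / real n \<le> success (apsp b c) (?T \<sigma>) (output_state n G w) s"
  proof (cases "dicycles G = {}")
    case True
    have "n\<^sup>2 \<le> t0"
      by (rule square_le_time[OF c[OF weighted_digraph dag_if_dicycles_empty[OF True]]])
    then have "?T 0 \<le> 501 * t0" by simp
    then have "real (?T 0) \<le> 501 * real t0" using of_nat_mono by fastforce
    also have "\<dots> \<le> (2000 + 56 * real a) * (real t0 + real (n\<^sup>2) * x)"
      by (rule mult_mono) (use \<open>0 \<le> x\<close> in auto)
    finally have T: "real (?T 0) \<le> (2000 + 56 * real a) * (real t0 + real (n\<^sup>2) * x)" .
    have "1 - 1 / real n \<le> success (apsp b c) (?T 0) (output_state n G w) s"
    proof (rule success_apsp[OF _ input])
      fix s :: state assume num: "nats s (b + 10, 0, 0) = n"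
      have "1 - 1 / real n \<le> 1 - card (dicycles G) * (1 - d / n) ^ 0" by (simp add: True)
      also have "\<dots> \<le> success (draw b) (5 * n + 3) (\<lambda>s'. (\<forall>i<n. drawn s' i < n) \<and>
        frame (nmods (draw b)) (vmods (draw b)) s s' \<and>
        (\<forall>C\<in>dicycles G. \<exists>i<0. sample s' i \<in> dicycle_verts C)) s"
        by (rule success_draw_sample[OF num]) (use n True in auto)
      finally show "1 - 1 / real n \<le> success (draw b) (5 * n + 3) (\<lambda>s'. (\<forall>i<n. drawn s' i < n) \<and>
        frame (nmods (draw b)) (vmods (draw b)) s s' \<and>
        (\<forall>C\<in>dicycles G. \<exists>i<0. sample s' i \<in> dicycle_verts C)) s" .
    qed (use n c' fresh True two_cycle in auto)
    then show ?thesis using T by blast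
  next
    case False
    then obtain C where "C \<in> dicycles G" by blast
    then have "d \<le> n"
      using d(2)[of C] card_mono[OF _ dicycle_verts_subset[of C]] by fastforce
    \<comment> \<open>This yields \<open>1 / 2 \<le> x\<close>, by which additive constants and the
      rounding in \<open>\<sigma>0\<close> are absorbed into multiples of \<open>x\<close>.\<close>
    have ln: "1 / 2 \<le> ln (real n)"
      using ln2_ge_two_thirds ln_le_cancel_iff[of 2 "real n"] n by linarith
    also have "\<dots> \<le> x"
      using \<open>d \<le> n\<close> d(1) n by (simp add: x_def field_simps mult_right_mono)
    finally have "1 / 2 \<le> x" .
    define \<sigma>0 where "\<sigma>0 = nat \<lceil>(a + 1) * x\<rceil>"
    have \<sigma>0: "(a + 1) * x \<le> \<sigma>0" "\<sigma>0 \<le> (a + 1) * x + 1"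
      using \<open>0 \<le> x\<close> unfolding \<sigma>0_def by (simp_all add: real_nat_ceiling_ge) 
    \<comment> \<open>The term \<open>28 * \<sigma>\<close> contributes
      \<open>(280 + 56 * a) * x\<close>, and 500 is at most \<open>1000 * x\<close>; 2000 is a
      generous round value above their sum 1280.\<close>
    have T: "real (?T \<sigma>) \<le> (2000 + 56 * real a) * (real t0 + real (n\<^sup>2) * x)"
      if \<sigma>: "real \<sigma> \<le> (2 * a + 10) * x" for \<sigma>
    proof -
      have "real (?T \<sigma>) = real t0 + real (n\<^sup>2) * (500 + 28 * real \<sigma>)" by (simp add: algebra_simps)
      also have "\<dots> \<le> real t0 + real (n\<^sup>2) * ((1280 + 56 * real a) * x)"
        using \<sigma> \<open>1 / 2 \<le> x\<close> by (intro add_left_mono mult_left_mono) (auto simp: algebra_simps)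
      also have "\<dots> \<le> (2000 + 56 * real a) * real t0 + (2000 + 56 * real a) * (real (n\<^sup>2) * x)"
        using \<open>0 \<le> x\<close> by (intro add_mono) (auto simp: algebra_simps)
      finally show ?thesis by (simp add: distrib_left)
    qed
    show ?thesis
    proof (cases "\<sigma>0 \<le> n \<and> (\<forall>u v. (u, v) \<in> parcs G \<longrightarrow> (v, u) \<notin> parcs G)")
      case True
      have "1 - 1 / real n \<le> success (apsp b c) (?T \<sigma>0) (output_state n G w) s"
      proof (rule success_apsp[OF _ input])
        fix s :: state assume num: "nats s (b + 10, 0, 0) = n"
        have "1 - 1 / real n \<le> 1 - card (dicycles G) * (1 - d / n) ^ \<sigma>0"
          using miss_bound[OF d(1) \<open>d \<le> n\<close> n N] \<sigma>0(1) by (simp add: x_def add.commute)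
        also have "\<dots> \<le> success (draw b) (5 * n + 3) (\<lambda>s'. (\<forall>i<n. drawn s' i < n) \<and>
          frame (nmods (draw b)) (vmods (draw b)) s s' \<and>
          (\<forall>C\<in>dicycles G. \<exists>i<\<sigma>0. sample s' i \<in> dicycle_verts C)) s"
          by (rule success_draw_sample[OF num]) (use True n d(2) in auto)
        finally show "1 - 1 / real n \<le> success (draw b) (5 * n + 3) (\<lambda>s'. (\<forall>i<n. drawn s' i < n) \<and>
          frame (nmods (draw b)) (vmods (draw b)) s s' \<and>
          (\<forall>C\<in>dicycles G. \<exists>i<\<sigma>0. sample s' i \<in> dicycle_verts C)) s" .
      qed (use n c' fresh True in auto)
      moreover have "real \<sigma>0 \<le> (2 * a + 10) * x"
      proof -
        have "(a + 1) * x + 1 \<le> (a + 1) * x + 2 * x" using \<open>1 / 2 \<le> x\<close> by simp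
        also have "\<dots> = (a + 3) * x" by (simp add: algebra_simps)
        also have "\<dots> \<le> (2 * a + 10) * x" using \<open>0 \<le> x\<close> by (intro mult_right_mono) auto
        finally show ?thesis using \<sigma>0(2) by linarith
      qed
      ultimately show ?thesis using T by blast
    next
      case False
      \<comment> \<open>Deleting all vertices is affordable here: opposite arcs give
        \<open>d \<le> 2\<close> and hence \<open>n \<le> 4 * x\<close>, and otherwise n is smaller
        than \<open>\<sigma>0\<close>. Doubling this bound is the origin of
        \<open>2 * a + 10\<close>.\<close>
      have "real n \<le> (a + 5) * x"
      proof (cases "\<sigma>0 \<le> n")
        case True
        then obtain u v where "(u, v) \<in> parcs G" "(v, u) \<in> parcs G" using False by blast
        then obtain C where "C \<in> dicycles G" "card (dicycle_verts C) \<le> 2" using two_cycle by blast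
        then have "real d \<le> 2" using d(2)[of C] by linarith
        have "real n * (1 / 2) / 2 \<le> real n * ln n / d"
          using \<open>real d \<le> 2\<close> d(1) ln by (intro frac_le mult_left_mono) auto
        then have "real n \<le> 4 * x" unfolding x_def by linarith
        also have "\<dots> \<le> (a + 5) * x" using \<open>0 \<le> x\<close> by (intro mult_right_mono) auto
        finally show ?thesis .
      next
        case False
        then have "real n \<le> (a + 1) * x + 1" using \<sigma>0(2) by linarith
        also have "\<dots> \<le> (a + 1) * x + 2 * x" using \<open>1 / 2 \<le> x\<close> by simp
        also have "\<dots> = (a + 3) * x" by (simp add: algebra_simps)
        also have "\<dots> \<le> (a + 5) * x" using \<open>0 \<le> x\<close> by (intro mult_right_mono) auto
        finally show ?thesis .
      qed
      then have "real (2 * n) \<le> (2 * a + 10) * x" by (simp add: algebra_simps)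
      moreover have "1 - 1 / real n \<le> success (apsp b c) (?T (2 * n)) (output_state n G w) s"
      proof (rule success_apsp[OF _ input])
        fix s :: state assume num: "nats s (b + 10, 0, 0) = n"
        have "1 - 1 / real n \<le> 1" by simp
        also have "\<dots> \<le> success (draw b) (5 * n + 3) (\<lambda>s'. (\<forall>i<n. drawn s' i < n) \<and>
          frame (nmods (draw b)) (vmods (draw b)) s s' \<and>
          (\<forall>C\<in>dicycles G. \<exists>i<2 * n. sample s' i \<in> dicycle_verts C)) s"
          by (rule success_draw_all[OF num]) (use d in \<open>fastforce intro: order_trans\<close>)
        finally show "1 - 1 / real n \<le> success (draw b) (5 * n + 3) (\<lambda>s'. (\<forall>i<n. drawn s' i < n) \<and>
          frame (nmods (draw b)) (vmods (draw b)) s s' \<and>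
          (\<forall>C\<in>dicycles G. \<exists>i<2 * n. sample s' i \<in> dicycle_verts C)) s" .
      qed (use n c' fresh in auto)
      ultimately show ?thesis using T by blast
    qed
  qed
  then show "\<exists>k. real k \<le> (2000 + 56 * real a) * (real t0 + real n ^ 3 * ln (real n) / real d) \<and>
      1 - 1 / real n \<le> measure_pmf.prob (run k (apsp b c, s)) {(c', s'). c' = Skip \<and> output_state n G w s'}"
    unfolding x success_def by blast
qed

end

text \<open>From n = 2 on, even the sum of the absolute coefficients is absorbed by a power of n, so
  no constant factor remains.\<close>

lemma poly_le_power:
  fixes p :: "real poly"
  shows "\<exists>a. \<forall>n\<ge>2. poly p (real n) \<le> real n ^ a"
proof -
  obtain l where l: "(\<Sum>i\<le>degree p. \<bar>coeff p i\<bar>) < 2 ^ l"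
    using real_arch_pow[of 2] by auto
  have "poly p (real n) \<le> real n ^ (l + degree p)" if "2 \<le> n" for n
  proof -
    have "poly p (real n) = (\<Sum>i\<le>degree p. coeff p i * real n ^ i)" by (simp add: poly_altdef)
    also have "\<dots> \<le> (\<Sum>i\<le>degree p. \<bar>coeff p i\<bar> * real n ^ degree p)"
      using that by (intro sum_mono mult_mono power_increasing) auto
    also have "\<dots> = (\<Sum>i\<le>degree p. \<bar>coeff p i\<bar>) * real n ^ degree p" by (simp add: sum_distrib_right)
    also have "\<dots> \<le> real n ^ l * real n ^ degree p"
    proof (rule mult_right_mono)
      have "(2::real) ^ l \<le> real n ^ l" using that by (intro power_mono) auto
      then show "(\<Sum>i\<le>degree p. \<bar>coeff p i\<bar>) \<le> real n ^ l" using l by linarith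
    qed simp
    finally show ?thesis by (simp add: power_add)
  qed
  then show ?thesis by blast
qed

theorem theorem4:
  fixes t :: "nat \<Rightarrow> nat \<Rightarrow> nat"
    and p :: "real poly"
  assumes "dag_apsp_time t"
  shows "\<exists>c. \<exists>K>0. \<forall>n m d G w.
           1 \<le> n \<and> 1 \<le> d \<and> weighted_digraph n m G w \<and>
           real (card (dicycles G)) \<le> poly p (real n) \<and>
           (\<forall>C\<in>dicycles G. d \<le> card (dicycle_verts C)) \<longrightarrow>
           solves_apsp_within c n G w
             (K * (real (t n m) + real n ^ 3 * ln (real n) / real d)) (1 - 1 / real n)"
proof -
  obtain c where c: "\<And>n m G w. 1 \<le> n \<Longrightarrow> weighted_digraph n m G w \<Longrightarrow> dag G \<Longrightarrow>
      solves_apsp_within c n G w (real (t n m)) 1"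
    using assms unfolding dag_apsp_time_def by blast
  obtain a where a: "\<And>n. 2 \<le> n \<Longrightarrow> poly p (real n) \<le> real n ^ a" using poly_le_power by blast
  \<comment> \<open>Avoiding the names that \<open>c\<close> may write is enough, since
    \<open>input_state\<close> allows arbitrary contents in all cells besides the input.\<close>
  obtain b where b: "\<forall>x\<in>nmods c \<union> vmods c. x < b"
    using finite_nat_set_iff_bounded[of "nmods c \<union> vmods c"] finite_mods[of c] by auto
  have fresh: "nmods c \<subseteq> {..<b + 10}" "vmods c \<subseteq> {..<b + 10}" using b by (auto simp: trans_less_add1)
  have "solves_apsp_within (apsp b c) n G w
      ((2000 + 56 * real a) * (real (t n m) + real n ^ 3 * ln (real n) / real d)) (1 - 1 / real n)"
    if "1 \<le> n" "1 \<le> d" and G: "weighted_digraph n m G w"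
      and N: "real (card (dicycles G)) \<le> poly p (real n)"
      and d: "\<forall>C\<in>dicycles G. d \<le> card (dicycle_verts C)" for n m d :: nat and G w
  \<comment> \<open>For n = 1 the required probability is 0, so zero steps will do; the bounds by
    powers of n and by \<open>ln n\<close> start at 2.\<close>
  proof (cases "n = 1")
    case True
    then show ?thesis
      unfolding solves_apsp_within_def by (auto intro!: exI[of _ "0::nat"] mult_nonneg_nonneg)
  next
    case False
    then have n: "2 \<le> n" using \<open>1 \<le> n\<close> by simp
    show ?thesis
    proof (rule apsp_prog.apsp_solves)
      show "apsp_prog n m G w" using G by (simp add: apsp_prog_def wdigraph_def)
      show "real (card (dicycles G)) \<le> real n ^ a" using N a[OF n] by linarith
    qed (use c[OF \<open>1 \<le> n\<close>] fresh n \<open>1 \<le> d\<close> d in auto)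
  qed
  then show ?thesis
    by (intro exI[of _ "apsp b c"] exI[of _ "2000 + 56 * real a"]) auto
qed

end
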